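(* Let $A\in\mathbb{R}^{n_x\times n_x}$, $B\in\mathbb{R}^{n_x\times n_u}$, and let $Q\in\mathbb{R}^{n_x\times n_x}$, $R\in\mathbb{R}^{n_u\times n_u}$ be symmetric positive definite, with $(A,B)$ stabilizable. Let $\mathcal{K}=\{K\in\mathbb{R}^{n_u\times n_x}:\rho(A-BK)<1\}$, for $K\in\mathcal{K}$ let $$J(K)=\sup_{\omega\in[0,2\pi]}\lambda_{\max}^{1/2}\Big((e^{-j\omega}I-A+BK)^{-\mathsf{T}}(Q+K^{\mathsf{T}}RK)(e^{j\omega}I-A+BK)^{-1}\Big),$$ and $J^*=\min_{K\in\mathcal{K}}J(K)$. Let $K^0\in\mathcal{K}$ and set $\Delta_0:=\mathrm{dist}(\mathcal{K}_{J(K^0)},\mathcal{K}^c)>0$. Fix $c\in(0,1)$ and let $\delta^n=\frac{c\Delta_0}{n+1}$. Consider Goldstein's subgradient method $$K^{n+1}=K^n-\delta^nF^n/\|F^n\|_F,$$ where $F^n$ is the minimum-(Frobenius-)norm element of the Goldstein subdifferential $\partial_{\delta^n}J(K^n)$. Then $K^n\in\mathcal{K}$ for all $n$, and $J(K^n)\to J^*$ as $n\to\infty$.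
   Context: $\rho(\cdot)$ denotes spectral radius, $j=\sqrt{-1}$, $\lambda_{\max}$ the largest eigenvalue of a Hermitian matrix, $\|\cdot\|_F$ the Frobenius norm, $\mathcal{K}^c$ the complement of $\mathcal{K}$, $\mathcal{K}_\gamma=\{K\in\mathcal{K}:J(K)\le\gamma\}$, and $\mathrm{dist}$ the Frobenius-norm distance between sets. $J$ is locally Lipschitz on the open set $\mathcal{K}$. The Clarke subdifferential is $\partial_CJ(K)=\mathrm{conv}\{\lim_i\nabla J(K_i):K_i\to K,\ K_i\text{ differentiability points of }J\}$. For $\delta>0$ with the closed $\delta$-ball $\mathbb{B}_\delta(K)\subset\mathcal{K}$, the Goldstein subdifferential is $\partial_\delta J(K)=\mathrm{conv}\big(\bigcup_{K'\in\mathbb{B}_\delta(K)}\partial_CJ(K')\big)$. *)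

theory Defs
  imports "HOL-Analysis.Analysis"
begin

definition cmat :: "real^'n^'m \<Rightarrow> complex^'n^'m" where
  "cmat M = (\<chi> i j. complex_of_real (M $ i $ j))"

definition eigenvalues :: "complex^'n^'n \<Rightarrow> complex set" where
  "eigenvalues M = {l. \<exists>v. v \<noteq> 0 \<and> M *v v = l *s v}"

definition spectral_radius :: "real^'n^'n \<Rightarrow> real" where
  "spectral_radius M = Sup (cmod ` eigenvalues (cmat M))"

text \<open>Largest eigenvalue of a Hermitian matrix (its eigenvalues are real).\<close>
definition lambda_max :: "complex^'n^'n \<Rightarrow> real" where
  "lambda_max H = Sup {r::real. complex_of_real r \<in> eigenvalues H}"

definition sym_pos_def :: "real^'n^'n \<Rightarrow> bool" where
  "sym_pos_def Q \<longleftrightarrow> transpose Q = Q \<and> (\<forall>x. x \<noteq> 0 \<longrightarrow> x \<bullet> (Q *v x) > 0)"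

definition stab_set :: "real^'nx^'nx \<Rightarrow> real^'nu^'nx \<Rightarrow> (real^'nx^'nu) set" where
  "stab_set A B = {K. spectral_radius (A - B ** K) < 1}"

definition stabilizable :: "real^'nx^'nx \<Rightarrow> real^'nu^'nx \<Rightarrow> bool" where
  "stabilizable A B \<longleftrightarrow> stab_set A B \<noteq> {}"

definition Jcost :: "real^'nx^'nx \<Rightarrow> real^'nu^'nx \<Rightarrow> real^'nx^'nx \<Rightarrow> real^'nu^'nu
                     \<Rightarrow> real^'nx^'nu \<Rightarrow> real" where
  "Jcost A B Q R K =
     (SUP \<omega>\<in>{0..2*pi}.
        sqrt (lambda_max
          (transpose (matrix_inv (mat (cis (-\<omega>)) - cmat A + cmat (B ** K)))
           ** cmat (Q + transpose K ** R ** K)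
           ** matrix_inv (mat (cis \<omega>) - cmat A + cmat (B ** K)))))"

text \<open>Clarke subdifferential of \<open>f\<close> (defined on the open set \<open>D\<close>) at \<open>x\<close>:
  convex hull of limits of gradients at differentiability points converging to \<open>x\<close>.
  The gradient is taken w.r.t. the Frobenius inner product (the inner product of
  \<open>real^'n^'m\<close>).\<close>
definition clarke_subdiff :: "('a::euclidean_space \<Rightarrow> real) \<Rightarrow> 'a set \<Rightarrow> 'a \<Rightarrow> 'a set" where
  "clarke_subdiff f D x = convex hull
     {G. \<exists>xs Gs. (\<forall>i. xs i \<in> D \<and> (f has_derivative (\<lambda>h. Gs i \<bullet> h)) (at (xs i)))
                 \<and> xs \<longlonglongrightarrow> x \<and> Gs \<longlonglongrightarrow> G}"

definition goldstein_subdiff :: "('a::euclidean_space \<Rightarrow> real) \<Rightarrow> 'a set \<Rightarrow> real \<Rightarrow> 'a \<Rightarrow> 'a set" where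
  "goldstein_subdiff f D \<delta> x = convex hull (\<Union>y\<in>cball x \<delta>. clarke_subdiff f D y)"

definition min_norm_elem :: "'a::real_normed_vector set \<Rightarrow> 'a \<Rightarrow> bool" where
  "min_norm_elem S F \<longleftrightarrow> F \<in> S \<and> (\<forall>G\<in>S. norm F \<le> norm G)"

end

theory Submission
  imports Defs
begin

text \<open>
  Near every stabilising gain, \<open>J\<close> is supported from below by quadratics with uniform constants,
  being a supremum of uniformly smooth functions. Hence differentiability points are dense without
  Rademacher's theorem, Clarke subgradients are proximal subgradients, and Goldstein's step decreases
  \<open>J\<close> by at least \<open>\<delta> \<parallel>F\<parallel>\<close>. As \<open>\<Sum> \<delta>\<close> diverges and sublevel sets are compact, the limit
  of the costs is attained at some \<open>K\<close> near which \<open>J\<close> drops at most quadratically.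

  Such a \<open>K\<close> is a global minimiser by hidden convexity. By the bounded real lemma, \<open>J K \<le> \<gamma>\<close> holds
  iff a quadratic storage function \<open>P\<close> satisfies the dissipation inequality with gain \<open>\<gamma>\<^sup>2\<close>, which is
  jointly convex in \<open>(P\<^sup>-\<^sup>1, K P\<^sup>-\<^sup>1, \<gamma>\<^sup>2)\<close>. A strictly better gain would thus give a curve from \<open>K\<close>
  along which \<open>J\<^sup>2\<close> decreases at a linear rate.
\<close>

subsection \<open>Goldstein's method for locally weakly convex functions\<close>

text \<open>\<open>J\<close>^2 is the maximum over \<open>(\<theta>, a, b)\<close> of a quotient of
  two quadratics in the gain: weighted energy over \<open>resolvent_sq\<close>. On a small ball the
  denominator stays away from 0, so the quotient frozen at a maximiser touches \<open>J\<close>^2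
  from below with uniformly bounded curvature. This matters twice: the method works without
  differentiability theory for Lipschitz functions, and stationarity becomes an inequality that
  survives the limit, whereas Clarke stationarity of a nonconvex function would say nothing about
  distant gains.

  The storage function carries more than hidden convexity. The bounded real lemma assumes that
  powers tend to 0 rather than a spectral condition, so it can itself be used to derive that decay
  from the spectrum, and even to show that an eigenvalue exists, without which the supremum in
  \<open>spectral_radius\<close> could not be bounded above. The pairs \<open>(K, P)\<close>
  certifying a given gain form a closed bounded set, so compactness of sublevel sets needs no study
  of \<open>J\<close> near the boundary of the stability region.\<close>

text \<open>In effect \<open>f\<close> plus \<open>C\<close> times the squared norm is convex on
  each ball, with a bound \<open>L\<close> on the slopes. Radius and constants are common to all
  base points \<open>y\<close> of the ball, so that supports at moving base points pass to a
  limit.\<close>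

definition locally_weakly_convex_on :: "('a::euclidean_space \<Rightarrow> real) \<Rightarrow> 'a set \<Rightarrow> bool" where
  "locally_weakly_convex_on f D \<longleftrightarrow>
     (\<forall>x\<in>D. \<exists>r>0. \<exists>C\<ge>0. \<exists>L\<ge>0. cball x r \<subseteq> D \<and>
        (\<forall>y\<in>cball x r. \<exists>g. norm g \<le> L \<and>
           (\<forall>z\<in>cball x r. f z \<ge> f y + g \<bullet> (z - y) - C * (norm (z - y))\<^sup>2)))"

text \<open>Along \<open>h = t v\<close> the left side is of order \<open>t\<close> and the right
  side of order \<open>t^2\<close>. This identifies gradients wherever one quadratic touches from
  below and another from above.\<close>

lemma inner_le_quadratic_imp_zero:
  fixes v :: "'a::real_inner"
  assumes "\<rho> > 0" and bound: "\<And>h. norm h < \<rho> \<Longrightarrow> v \<bullet> h \<le> C * (norm h)\<^sup>2"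
  shows "v = 0"
proof (rule ccontr)
  assume "v \<noteq> 0"
  then have nv: "norm v > 0" by simp
  define t where "t = min (\<rho> / (2 * norm v)) (1 / (2 * (\<bar>C\<bar> + 1)))"
  have t: "t > 0" using nv \<open>\<rho> > 0\<close> by (simp add: t_def)
  have "t \<le> \<rho> / (2 * norm v)" by (simp add: t_def)
  then have "t * norm v < \<rho>" using nv \<open>\<rho> > 0\<close> by (simp add: field_simps)
  then have "v \<bullet> (t *\<^sub>R v) \<le> C * (norm (t *\<^sub>R v))\<^sup>2" using t by (intro bound) simp
  then have "t * (norm v)\<^sup>2 \<le> t * (norm v)\<^sup>2 * (C * t)"
    using t by (simp add: dot_square_norm power2_eq_square algebra_simps)
  then have "1 \<le> C * t" using t nv by (simp add: mult_le_cancel_left1)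
  moreover have "t \<le> 1 / (2 * (\<bar>C\<bar> + 1))" by (simp add: t_def)
  then have "t * (\<bar>C\<bar> + 1) \<le> 1/2" by (simp add: field_simps)
  moreover have "C * t \<le> t * (\<bar>C\<bar> + 1)" using t by (simp add: mult.commute mult_le_cancel_left)
  ultimately show False by linarith
qed

text \<open>First-order condition for \<open>F\<close> along the segment towards \<open>G\<close>:
  if \<open>(G - F) \<bullet> F\<close> were negative, a short move would decrease the norm.\<close>

lemma min_norm_elem_inner:
  fixes S :: "'a::real_inner set"
  assumes "convex S" "min_norm_elem S F" "G \<in> S"
  shows "(norm F)\<^sup>2 \<le> G \<bullet> F"
proof (rule ccontr)
  assume neg: "\<not> ?thesis"
  have F: "F \<in> S" and mn: "\<And>G. G \<in> S \<Longrightarrow> norm F \<le> norm G"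
    using assms(2) by (auto simp: min_norm_elem_def)
  define v where "v = G - F"
  have vF: "v \<bullet> F < 0" using neg by (simp add: v_def inner_diff_left power2_norm_eq_inner)
  define t where "t = min 1 (- (v \<bullet> F) / ((norm v)\<^sup>2 + 1))"
  have pos: "(norm v)\<^sup>2 + 1 > 0" by (smt (verit) zero_le_power2)
  have t: "0 < t" "t \<le> 1" using divide_pos_pos[of "- (v \<bullet> F)", OF _ pos] vF by (auto simp: t_def)
  have "(1 - t) *\<^sub>R F + t *\<^sub>R G \<in> S"
    using assms(1) F assms(3) t by (intro convexD) auto
  then have "F + t *\<^sub>R v \<in> S" by (simp add: v_def algebra_simps)
  then have "(norm F)\<^sup>2 \<le> (norm (F + t *\<^sub>R v))\<^sup>2" using mn by (simp add: power_mono)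
  also have "\<dots> = (norm F)\<^sup>2 + t * (2 * (v \<bullet> F) + t * (norm v)\<^sup>2)"
    by (simp add: power2_norm_eq_inner inner_simps algebra_simps inner_commute)
  finally have "0 \<le> t * (2 * (v \<bullet> F) + t * (norm v)\<^sup>2)" by simp
  then have "0 \<le> 2 * (v \<bullet> F) + t * (norm v)\<^sup>2" using t by (simp add: zero_le_mult_iff)
  moreover have "t \<le> - (v \<bullet> F) / ((norm v)\<^sup>2 + 1)" by (simp add: t_def)
  then have "t * ((norm v)\<^sup>2 + 1) \<le> - (v \<bullet> F)" using pos by (subst (asm) pos_le_divide_eq) auto
  ultimately show False using vF t by (simp add: algebra_simps)
qed

locale quadratically_supported =
  fixes f :: "'a::euclidean_space \<Rightarrow> real" and x0 :: 'a and r C L :: real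
  assumes r_pos: "r > 0" and C_nonneg: "C \<ge> 0" and L_nonneg: "L \<ge> 0"
    and support: "\<And>y. y \<in> cball x0 r \<Longrightarrow> \<exists>g. norm g \<le> L \<and>
           (\<forall>z\<in>cball x0 r. f z \<ge> f y + g \<bullet> (z - y) - C * (norm (z - y))\<^sup>2)"
begin

text \<open>A Lipschitz constant on the ball: slopes contribute \<open>L\<close>, and on a set of
  diameter \<open>2 * r\<close> the quadratic \<open>C * t^2\<close> is at most
  \<open>2 * r * C * t\<close>.\<close>

definition "\<Lambda> = L + 2 * r * C"

lemma \<Lambda>_nonneg: "\<Lambda> \<ge> 0"
  using r_pos C_nonneg L_nonneg by (simp add: \<Lambda>_def)

lemma lipschitz_one_sided:
  assumes "y \<in> cball x0 r" "z \<in> cball x0 r"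
  shows "f y - f z \<le> \<Lambda> * norm (y - z)"
proof -
  obtain g where g: "norm g \<le> L" "f z \<ge> f y + g \<bullet> (z - y) - C * (norm (z - y))\<^sup>2"
    using support[OF assms(1)] assms(2) by blast
  have "dist y z \<le> dist x0 y + dist x0 z" by (rule dist_triangle3)
  then have n: "norm (y - z) \<le> 2 * r" using assms by (simp add: dist_norm)
  have "\<bar>g \<bullet> (z - y)\<bar> \<le> norm g * norm (z - y)" by (rule Cauchy_Schwarz_ineq2)
  also have "\<dots> \<le> L * norm (y - z)" using g by (simp add: norm_minus_commute mult_right_mono)
  finally have 1: "\<bar>g \<bullet> (z - y)\<bar> \<le> L * norm (y - z)" .
  have "(norm (z - y))\<^sup>2 \<le> 2 * r * norm (y - z)"
    using n by (simp add: norm_minus_commute power2_eq_square mult_right_mono)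
  then have "C * (norm (z - y))\<^sup>2 \<le> C * (2 * r * norm (y - z))"
    using C_nonneg by (rule mult_left_mono)
  then show ?thesis using g 1 by (simp add: \<Lambda>_def algebra_simps)
qed

lemma lipschitz:
  assumes "y \<in> cball x0 r" "z \<in> cball x0 r"
  shows "\<bar>f y - f z\<bar> \<le> \<Lambda> * norm (y - z)"
  using lipschitz_one_sided[OF assms] lipschitz_one_sided[OF assms(2,1)] by (simp add: norm_minus_commute abs_le_iff)

lemma continuous_on_cball: "continuous_on (cball x0 r) f"
proof (rule continuous_onI)
  fix y e assume y: "y \<in> cball x0 r" and "(e::real) > 0"
  show "\<exists>d>0. \<forall>z\<in>cball x0 r. dist z y < d \<longrightarrow> dist (f z) (f y) \<le> e"
  proof (intro exI conjI ballI impI)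
    show "e / (\<Lambda> + 1) > 0" using \<open>e > 0\<close> \<Lambda>_nonneg by simp
    fix z assume z: "z \<in> cball x0 r" and d: "dist z y < e / (\<Lambda> + 1)"
    have "dist (f z) (f y) \<le> \<Lambda> * norm (z - y)" using lipschitz[OF z y] by (simp add: dist_real_def)
    also have "\<dots> \<le> (\<Lambda> + 1) * norm (z - y)" by (simp add: algebra_simps)
    also have "\<dots> \<le> e" using d \<Lambda>_nonneg by (simp add: dist_norm field_simps)
    finally show "dist (f z) (f y) \<le> e" .
  qed
qed

text \<open>A support vector \<open>g\<close> at a differentiability point can only be the gradient:
  along \<open>g - G\<close>, the support from below and the derivative estimate contradict each
  other for small steps. The gradient thus inherits the bound \<open>L\<close> and an inequality
  valid on the whole ball.\<close>

lemma derivative_is_support: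
  assumes y: "y \<in> ball x0 r" and der: "(f has_derivative (\<lambda>h. G \<bullet> h)) (at y)"
  shows "norm G \<le> L"
    and "z \<in> cball x0 r \<Longrightarrow> f z \<ge> f y + G \<bullet> (z - y) - C * (norm (z - y))\<^sup>2"
proof -
  obtain g where g: "norm g \<le> L"
    "\<And>z. z \<in> cball x0 r \<Longrightarrow> f z \<ge> f y + g \<bullet> (z - y) - C * (norm (z - y))\<^sup>2"
    using support[of y] y by force
  obtain \<rho> where \<rho>: "\<rho> > 0" "ball y \<rho> \<subseteq> ball x0 r"
    using y open_ball open_contains_ball by blast
  define v where "v = g - G"
  have "v = 0"
  proof (rule ccontr)
    assume "v \<noteq> 0"
    then have nv: "norm v > 0" by simp
    obtain d where d: "d > 0" "\<And>z. norm (z - y) < d \<Longrightarrow>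
        norm (f z - f y - G \<bullet> (z - y)) \<le> norm v / 4 * norm (z - y)"
      using der nv unfolding has_derivative_at_alt by (meson divide_pos_pos zero_less_numeral)
    \<comment> \<open>The first two entries keep \<open>z\<close> in the ball and within reach of
      the derivative estimate; the third gives \<open>C * t + 1/4 < 1\<close>.\<close>
    define t where "t = min (min (\<rho> / (2 * norm v)) (d / (2 * norm v))) (1 / (4 * (C + 1)))"
    have t: "t > 0" using nv \<rho> d C_nonneg by (simp add: t_def)
    have "t \<le> \<rho> / (2 * norm v)" "t \<le> d / (2 * norm v)" "t \<le> 1 / (4 * (C + 1))"
      by (auto simp: t_def)
    then have tb: "t * norm v < \<rho>" "t * norm v < d" "t * (C + 1) \<le> 1/4"
      using nv \<rho> d C_nonneg by (auto simp: field_simps)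
    define z where "z = y + t *\<^sub>R v"
    have n: "norm (z - y) = t * norm v" using t by (simp add: z_def)
    have "z \<in> ball y \<rho>" using tb n by (simp add: dist_norm norm_minus_commute)
    then have "z \<in> cball x0 r" using \<rho> by auto
    then have "f z \<ge> f y + g \<bullet> (z - y) - C * (norm (z - y))\<^sup>2" by (rule g)
    moreover have "norm (f z - f y - G \<bullet> (z - y)) \<le> norm v / 4 * norm (z - y)"
      using d(2)[of z] tb n by simp
    ultimately have "v \<bullet> (z - y) \<le> C * (norm (z - y))\<^sup>2 + norm v / 4 * norm (z - y)"
      unfolding v_def inner_diff_left real_norm_def by (smt (verit))
    then have "t * (norm v)\<^sup>2 \<le> t * (norm v)\<^sup>2 * (C * t + 1/4)"
      unfolding n by (simp add: z_def power2_norm_eq_inner[symmetric] power2_eq_square algebra_simps)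
    then have "1 \<le> C * t + 1/4" using t nv by (simp add: mult_le_cancel_left1)
    then show False using tb t by (simp add: algebra_simps)
  qed
  then have "G = g" by (simp add: v_def)
  then show "norm G \<le> L"
    "z \<in> cball x0 r \<Longrightarrow> f z \<ge> f y + G \<bullet> (z - y) - C * (norm (z - y))\<^sup>2"
    using g by auto
qed

text \<open>A maximiser of \<open>f - M \<parallel>\<cdot> - y\<parallel>\<^sup>2\<close> for large \<open>M\<close> lies near \<open>y\<close>; there \<open>f\<close> is touched
  from above by a smooth function, so the quadratic support from below forces differentiability.\<close>

lemma differentiable_points_dense:
  assumes y: "y \<in> ball x0 r" and "\<epsilon> > 0"
  obtains z G where "norm (z - y) < \<epsilon>" "z \<in> ball x0 r" "(f has_derivative (\<lambda>h. G \<bullet> h)) (at z)"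
proof -
  obtain \<rho>' where \<rho>': "\<rho>' > 0" "ball y \<rho>' \<subseteq> ball x0 r"
    using y open_ball open_contains_ball by blast
  define \<rho> where "\<rho> = min \<epsilon> \<rho>' / 2"
  have \<rho>: "\<rho> > 0" "\<rho> < \<epsilon>" "\<rho> < \<rho>'" using \<rho>' assms by (auto simp: \<rho>_def min_def)
  have sub: "cball y \<rho> \<subseteq> ball x0 r" using \<rho> \<rho>' by (auto simp: subset_eq)
  then have sub': "cball y \<rho> \<subseteq> cball x0 r" by force
  \<comment> \<open>\<open>M * \<rho>\<close> exceeds the Lipschitz constant, so at distance
    \<open>\<rho>\<close> the penalty outweighs anything \<open>f\<close> can gain, and the
    maximiser is interior.\<close>
  define M where "M = (\<Lambda> + 1) / \<rho>"
  have M: "M > 0" using \<rho> \<Lambda>_nonneg by (simp add: M_def)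
  have "continuous_on (cball y \<rho>) (\<lambda>w. f w - M * (norm (w - y))\<^sup>2)"
    by (intro continuous_intros continuous_on_subset[OF continuous_on_cball sub'])
  then obtain z where z: "z \<in> cball y \<rho>"
    "\<And>w. w \<in> cball y \<rho> \<Longrightarrow> f w - M * (norm (w - y))\<^sup>2 \<le> f z - M * (norm (z - y))\<^sup>2"
    using continuous_attains_sup[of "cball y \<rho>" "\<lambda>w. f w - M * (norm (w - y))\<^sup>2"] \<rho> by auto
  have yz: "y \<in> cball x0 r" "z \<in> cball x0 r" using z(1) sub' y by auto
  have "M * (norm (z - y))\<^sup>2 \<le> f z - f y" using z(2)[of y] \<rho> by simp
  also have "\<dots> \<le> \<Lambda> * norm (z - y)" using lipschitz_one_sided yz by simp
  finally have "norm (z - y) * (M * norm (z - y)) \<le> norm (z - y) * \<Lambda>"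
    by (simp add: power2_eq_square algebra_simps)
  then have "M * norm (z - y) \<le> \<Lambda> \<or> norm (z - y) = 0"
    by (metis mult_left_le_imp_le norm_ge_zero order_le_less)
  then have nz: "norm (z - y) < \<rho>"
  proof
    assume "M * norm (z - y) \<le> \<Lambda>"
    then have "(\<Lambda> + 1) * norm (z - y) < (\<Lambda> + 1) * \<rho>"
      using \<rho> \<Lambda>_nonneg by (simp add: M_def field_simps)
    then show ?thesis using \<Lambda>_nonneg by simp
  qed (use \<rho> in simp)
  define \<sigma> where "\<sigma> = \<rho> - norm (z - y)"
  have \<sigma>: "\<sigma> > 0" using nz by (simp add: \<sigma>_def)
  have in\<sigma>: "w \<in> cball y \<rho>" if "norm (w - z) < \<sigma>" for w
    using that norm_triangle_ineq[of "w - z" "z - y"] by (simp add: \<sigma>_def dist_norm norm_minus_commute)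
  define G where "G = (2 * M) *\<^sub>R (z - y)"
  have up: "f w \<le> f z + G \<bullet> (w - z) + M * (norm (w - z))\<^sup>2" if "norm (w - z) < \<sigma>" for w
  proof -
    have "(norm (w - y))\<^sup>2 = (norm (z - y))\<^sup>2 + 2 * ((z - y) \<bullet> (w - z)) + (norm (w - z))\<^sup>2"
      by (simp add: power2_norm_eq_inner inner_simps algebra_simps inner_commute)
    then have "M * (norm (w - y))\<^sup>2 = M * (norm (z - y))\<^sup>2 + G \<bullet> (w - z) + M * (norm (w - z))\<^sup>2"
      by (simp add: G_def distrib_left)
    then show ?thesis using z(2)[OF in\<sigma>[OF that]] by simp
  qed
  obtain g where g:
    "\<And>w. w \<in> cball x0 r \<Longrightarrow> f w \<ge> f z + g \<bullet> (w - z) - C * (norm (w - z))\<^sup>2"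
    using support[OF yz(2)] by blast
  have "(g - G) \<bullet> h \<le> (M + C) * (norm h)\<^sup>2" if "norm h < \<sigma>" for h
    using up[of "z + h"] g[of "z + h"] in\<sigma>[of "z + h"] sub' that
    by (auto simp: algebra_simps subset_eq)
  then have "g - G = 0" using \<sigma> inner_le_quadratic_imp_zero by blast
  then have gG: "g = G" by simp
  have "(f has_derivative (\<lambda>h. G \<bullet> h)) (at z)"
    unfolding has_derivative_at_alt
  proof (intro conjI allI impI)
    show "bounded_linear (\<lambda>h. G \<bullet> h)" by (rule bounded_linear_inner_right)
    fix e :: real assume "e > 0"
    define d where "d = min \<sigma> (e / (M + C))"
    have d: "d > 0" using \<sigma> \<open>e > 0\<close> M C_nonneg by (simp add: d_def)
    show "\<exists>d>0. \<forall>w. norm (w - z) < d \<longrightarrow> norm (f w - f z - G \<bullet> (w - z)) \<le> e * norm (w - z)"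
    proof (intro exI[of _ d] conjI d allI impI)
      fix w assume w: "norm (w - z) < d"
      then have w\<sigma>: "norm (w - z) < \<sigma>" and we: "(M + C) * norm (w - z) \<le> e"
        using M C_nonneg by (auto simp: d_def field_simps)
      have wc: "w \<in> cball x0 r" using in\<sigma>[OF w\<sigma>] sub' by auto
      have n0: "M * (norm (w - z))\<^sup>2 \<ge> 0" "C * (norm (w - z))\<^sup>2 \<ge> 0" using M C_nonneg by auto
      have "norm (f w - f z - G \<bullet> (w - z)) \<le> (M + C) * (norm (w - z))\<^sup>2"
        using up[OF w\<sigma>] g[OF wc] n0 unfolding gG by (simp add: abs_le_iff algebra_simps)
      also have "\<dots> = ((M + C) * norm (w - z)) * norm (w - z)" by (simp add: power2_eq_square)
      also have "\<dots> \<le> e * norm (w - z)" using we by (intro mult_right_mono) auto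
      finally show "norm (f w - f z - G \<bullet> (w - z)) \<le> e * norm (w - z)" .
    qed
  qed
  moreover have "z \<in> ball x0 r" using z(1) sub by auto
  moreover have "norm (z - y) < \<epsilon>" using nz \<rho> by simp
  ultimately show ?thesis using that by blast
qed

text \<open>For fixed \<open>z\<close> the inequality is a closed half-space condition on
  \<open>\<xi>\<close>. It holds for gradients at nearby points, hence for their limits and convex
  hull.\<close>

lemma clarke_subdiff_support:
  assumes y: "y \<in> ball x0 r" and \<xi>: "\<xi> \<in> clarke_subdiff f D y" and z: "z \<in> cball x0 r"
  shows "f z \<ge> f y + \<xi> \<bullet> (z - y) - C * (norm (z - y))\<^sup>2"
proof -
  define H where "H = {\<xi>. \<xi> \<bullet> (z - y) \<le> f z - f y + C * (norm (z - y))\<^sup>2}"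
  have "convex H" unfolding H_def inner_commute[of _ "z - y"] by (rule convex_halfspace_le)
  moreover have "{G. \<exists>xs Gs. (\<forall>i. xs i \<in> D \<and> (f has_derivative (\<lambda>h. Gs i \<bullet> h)) (at (xs i)))
                 \<and> xs \<longlonglongrightarrow> y \<and> Gs \<longlonglongrightarrow> G} \<subseteq> H"
  proof clarify
    fix G xs Gs assume der: "\<forall>i. xs i \<in> D \<and> (f has_derivative (\<lambda>h. Gs i \<bullet> h)) (at (xs i))"
      and xs: "xs \<longlonglongrightarrow> y" and Gs: "Gs \<longlonglongrightarrow> G"
    have ev: "\<forall>\<^sub>F i in sequentially. xs i \<in> ball x0 r"
      using xs y open_ball topological_tendstoD by blast
    have "isCont f y"
      using continuous_on_cball y by (metis continuous_on_interior interior_cball)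
    then have fx: "(\<lambda>i. f (xs i)) \<longlonglongrightarrow> f y" using xs isCont_tendsto_compose by blast
    have "f y + G \<bullet> (z - y) - C * (norm (z - y))\<^sup>2 \<le> f z"
    proof (rule tendsto_le[OF trivial_limit_sequentially tendsto_const])
      show "(\<lambda>i. f (xs i) + Gs i \<bullet> (z - xs i) - C * (norm (z - xs i))\<^sup>2)
          \<longlonglongrightarrow> f y + G \<bullet> (z - y) - C * (norm (z - y))\<^sup>2"
        by (intro tendsto_intros fx xs Gs)
      show "\<forall>\<^sub>F i in sequentially. f (xs i) + Gs i \<bullet> (z - xs i) - C * (norm (z - xs i))\<^sup>2 \<le> f z"
        using ev
      proof eventually_elim
        case (elim i) then show ?case using derivative_is_support(2)[OF elim _ z] der by blast
      qed
    qed
    then show "G \<in> H" by (simp add: H_def)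
  qed
  ultimately have "\<xi> \<in> H" using \<xi> unfolding clarke_subdiff_def using hull_minimal[of _ H convex] by blast
  then show ?thesis by (simp add: H_def)
qed

text \<open>Takes the place of a mean value theorem for Clarke subgradients. Steep difference
  quotients arbitrarily close to \<open>x0\<close> would yield steep gradients at nearby
  differentiability points, and a limit of these would be a Clarke subgradient at \<open>x0\<close>
  violating the bound.\<close>

lemma local_slope_le:
  assumes D: "cball x0 r \<subseteq> D" and cl: "\<And>\<xi>. \<xi> \<in> clarke_subdiff f D x0 \<Longrightarrow> \<xi> \<bullet> d < \<kappa>"
  shows "\<exists>\<eta>>0. \<forall>p \<sigma>. norm (p - x0) < \<eta> \<longrightarrow> 0 < \<sigma> \<longrightarrow> \<sigma> < \<eta> \<longrightarrow> f (p + \<sigma> *\<^sub>R d) - f p \<le> \<kappa> * \<sigma>"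
proof (rule ccontr)
  assume "\<not> ?thesis"
  then have neg: "\<exists>p \<sigma>. norm (p - x0) < \<eta> \<and> 0 < \<sigma> \<and> \<sigma> < \<eta> \<and> f (p + \<sigma> *\<^sub>R d) - f p > \<kappa> * \<sigma>"
    if "\<eta> > 0" for \<eta> using that by (meson not_le)
  define q where "q n = 1 / (real n + 1)" for n :: nat
  have q: "q n > 0" "q n \<le> 1" for n by (auto simp: q_def)
  have q0: "q \<longlonglongrightarrow> 0" unfolding q_def using LIMSEQ_Suc[OF lim_1_over_n] by (simp add: add.commute)
  \<comment> \<open>Keeps \<open>p\<close>, the end point \<open>y\<close> and the differentiability
    point \<open>z\<close> within \<open>r / 2\<close> of \<open>x0\<close>.\<close>
  define r' where "r' = r / (2 * (norm d + 2))"
  have r': "r' > 0" using r_pos by (simp add: r'_def add_nonneg_pos)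
  have ex: "\<exists>z G. norm (z - x0) \<le> r' * q n * (norm d + 2) \<and> z \<in> ball x0 r \<and>
     (f has_derivative (\<lambda>h. G \<bullet> h)) (at z) \<and> norm G \<le> L \<and> 
     G \<bullet> d \<ge> \<kappa> - (\<Lambda> + L) * q n - C * (norm d + 1)\<^sup>2 * (r' * q n)" for n
  proof -
    have "r' * q n > 0" using r' q by simp
    from neg[OF this] obtain p \<sigma> where p: "norm (p - x0) < r' * q n" and \<sigma>: "0 < \<sigma>" "\<sigma> < r' * q n"
      and f: "f (p + \<sigma> *\<^sub>R d) - f p > \<kappa> * \<sigma>" by blast
    have rq: "r' * q n * (norm d + 2) < r"
    proof -
      have "r' * q n * (norm d + 2) \<le> r' * 1 * (norm d + 2)"
        using r' q[of n] by (intro mult_right_mono mult_left_mono) auto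
      also have "\<dots> = r / 2" unfolding r'_def by (simp add: divide_simps) (smt (verit) norm_ge_zero)
      finally show ?thesis using r_pos by simp
    qed
    \<comment> \<open>The gradient is taken near the far end \<open>y\<close>: its support
      inequality, evaluated back at \<open>p\<close>, bounds \<open>G \<bullet> d\<close> from
      below.\<close>
    define y where "y = p + \<sigma> *\<^sub>R d"
    have ny: "norm (y - x0) < r' * q n * (norm d + 1)"
    proof -
      have "norm (y - x0) \<le> norm (p - x0) + norm (\<sigma> *\<^sub>R d)"
        unfolding y_def using norm_triangle_ineq[of "p - x0" "\<sigma> *\<^sub>R d"] by (simp add: algebra_simps)
      also have "\<dots> < r' * q n + r' * q n * norm d"
        using p \<sigma> by (intro add_less_le_mono) (auto intro: mult_right_mono)
      finally show ?thesis by (simp add: algebra_simps)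
    qed
    have "r' * q n * (norm d + 1) \<le> r' * q n * (norm d + 2)" using r' q[of n] by simp
    then have yb: "y \<in> ball x0 r" using ny rq by (simp add: dist_norm norm_minus_commute)
    have "r' * q n \<le> r' * q n * (norm d + 2)" using mult_pos_pos[OF r' q(1)[of n]] norm_ge_zero[of d]
      by (simp add: mult_le_cancel_left1 del: norm_ge_zero)
    then have pb: "p \<in> ball x0 r" using p rq by (simp add: dist_norm norm_minus_commute)
    \<comment> \<open>The distance of \<open>z\<close> from \<open>y\<close> must be small relative
      to \<open>\<sigma>\<close>: errors of size \<open>\<sigma> * q n\<close> still vanish after
      division by \<open>\<sigma>\<close>.\<close>
    have "\<sigma> * q n > 0" using \<sigma> q by simp
    with yb obtain z G where zy: "norm (z - y) < \<sigma> * q n" and zb: "z \<in> ball x0 r"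
      and G: "(f has_derivative (\<lambda>h. G \<bullet> h)) (at z)" using differentiable_points_dense by metis
    have GL: "norm G \<le> L" using derivative_is_support(1)[OF zb G] .
    have sq: "\<sigma> * q n \<le> \<sigma>" using \<sigma> q[of n] by (simp add: mult_left_le)
    have "norm (z - x0) \<le> norm (z - y) + norm (y - x0)"
      using norm_triangle_ineq[of "z - y" "y - x0"] by simp
    also have "\<dots> \<le> r' * q n + r' * q n * (norm d + 1)" using zy sq \<sigma> ny by linarith
    finally have zx: "norm (z - x0) \<le> r' * q n * (norm d + 2)" by (simp add: algebra_simps)
    have "f p \<ge> f z + G \<bullet> (p - z) - C * (norm (p - z))\<^sup>2"
      using derivative_is_support(2)[OF zb G] pb by simp
    moreover have "f y - f z \<le> \<Lambda> * norm (z - y)"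
      using lipschitz_one_sided[of y z] yb zb by (simp add: norm_minus_commute)
    moreover have "\<Lambda> * norm (z - y) \<le> \<Lambda> * (\<sigma> * q n)" using zy \<Lambda>_nonneg by (simp add: mult_left_mono)
    moreover have "G \<bullet> (p - z) = - \<sigma> * (G \<bullet> d) - G \<bullet> (z - y)"
      by (simp add: y_def algebra_simps)
    moreover have "\<bar>G \<bullet> (z - y)\<bar> \<le> L * (\<sigma> * q n)"
      using Cauchy_Schwarz_ineq2[of G "z - y"] mult_mono[OF GL less_imp_le[OF zy]] L_nonneg by simp
    moreover have "C * (norm (p - z))\<^sup>2 \<le> C * (\<sigma> * (norm d + 1))\<^sup>2"
    proof -
      have "norm (p - z) \<le> norm (\<sigma> *\<^sub>R d) + norm (z - y)"
        using norm_triangle_ineq[of "z - y" "\<sigma> *\<^sub>R d"] by (simp add: y_def norm_minus_commute)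
      also have "\<dots> \<le> \<sigma> * (norm d + 1)" using \<sigma> order_trans[OF less_imp_le[OF zy] sq] by (simp add: distrib_left)
      finally show ?thesis using C_nonneg by (intro mult_left_mono power_mono) auto
    qed
    moreover have "C * (\<sigma> * (norm d + 1))\<^sup>2 \<le> \<sigma> * (C * (norm d + 1)\<^sup>2 * (r' * q n))"
    proof -
      have "C * (\<sigma> * (norm d + 1))\<^sup>2 = (C * \<sigma> * (norm d + 1)\<^sup>2) * \<sigma>" 
        by (simp add: power_mult_distrib power2_eq_square)
      also have "\<dots> \<le> (C * \<sigma> * (norm d + 1)\<^sup>2) * (r' * q n)"
        using C_nonneg \<sigma> by (intro mult_left_mono) auto
      finally show ?thesis by (simp add: algebra_simps)
    qed
    moreover have "f y - f p > \<kappa> * \<sigma>" using f by (simp add: y_def)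
    ultimately have "\<sigma> * (G \<bullet> d) \<ge> \<sigma> * (\<kappa> - (\<Lambda> + L) * q n - C * (norm d + 1)\<^sup>2 * (r' * q n))"
      by (simp add: algebra_simps)
    then have "G \<bullet> d \<ge> \<kappa> - (\<Lambda> + L) * q n - C * (norm d + 1)\<^sup>2 * (r' * q n)" using \<sigma> by simp
    then show ?thesis using zx zb G GL by blast
  qed
  then obtain zs Gs where zG: "\<And>n. norm (zs n - x0) \<le> r' * q n * (norm d + 2)"
      "\<And>n. zs n \<in> ball x0 r" "\<And>n. (f has_derivative (\<lambda>h. Gs n \<bullet> h)) (at (zs n))"
      "\<And>n. norm (Gs n) \<le> L"
      "\<And>n. Gs n \<bullet> d \<ge> \<kappa> - (\<Lambda> + L) * q n - C * (norm d + 1)\<^sup>2 * (r' * q n)" by metis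
  have "(\<lambda>n. r' * q n * (norm d + 2)) \<longlonglongrightarrow> r' * 0 * (norm d + 2)" by (intro tendsto_intros q0)
  then have "(\<lambda>n. zs n - x0) \<longlonglongrightarrow> 0"
    using zG(1) by (intro Lim_null_comparison[of "\<lambda>n. zs n - x0"]) auto
  then have zs: "zs \<longlonglongrightarrow> x0" using Lim_null by blast
  have "compact (cball (0::'a) L)" by simp
  then obtain G k where k: "strict_mono k" "(Gs \<circ> k) \<longlonglongrightarrow> G"
    unfolding compact_def using zG(4) by (metis dist_0_norm mem_cball)
  have "G \<in> clarke_subdiff f D x0"
    unfolding clarke_subdiff_def
  proof (rule hull_inc, rule CollectI, intro exI conjI allI)
    show "(zs \<circ> k) i \<in> D" for i using zG(2)[of "k i"] D by auto
    show "(f has_derivative (\<lambda>h. (Gs \<circ> k) i \<bullet> h)) (at ((zs \<circ> k) i))" for i using zG(3) by simp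
    show "(zs \<circ> k) \<longlonglongrightarrow> x0" using zs k LIMSEQ_subseq_LIMSEQ by blast
  qed (rule k)
  moreover have "\<kappa> - (\<Lambda> + L) * 0 - C * (norm d + 1)\<^sup>2 * (r' * 0) \<le> G \<bullet> d"
  proof (rule LIMSEQ_le)
    have qk: "(\<lambda>n. q (k n)) \<longlonglongrightarrow> 0" using LIMSEQ_subseq_LIMSEQ[OF q0 k(1)] by (simp add: o_def)
    show "(\<lambda>n. \<kappa> - (\<Lambda> + L) * q (k n) - C * (norm d + 1)\<^sup>2 * (r' * q (k n))) \<longlonglongrightarrow>
       \<kappa> - (\<Lambda> + L) * 0 - C * (norm d + 1)\<^sup>2 * (r' * 0)" by (intro tendsto_intros qk)
    show "(\<lambda>n. (Gs \<circ> k) n \<bullet> d) \<longlonglongrightarrow> G \<bullet> d" by (intro tendsto_intros k)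
    show "\<exists>N. \<forall>n\<ge>N. \<kappa> - (\<Lambda> + L) * q (k n) - C * (norm d + 1)\<^sup>2 * (r' * q (k n)) \<le> (Gs \<circ> k) n \<bullet> d"
      using zG(5) by auto
  qed
  ultimately show False using cl by force
qed

end

lemma locally_weakly_convex_onE:
  assumes "locally_weakly_convex_on f D" "x \<in> D"
  obtains r C L where "cball x r \<subseteq> D" "quadratically_supported f x r C L"
  using assms unfolding locally_weakly_convex_on_def quadratically_supported_def by meson

lemma locally_weakly_convex_isCont:
  assumes "locally_weakly_convex_on f D" "x \<in> D"
  shows "isCont f x"
proof -
  obtain r C L where "quadratically_supported f x r C L" using locally_weakly_convex_onE assms by metis
  then interpret quadratically_supported f x r C L .
  show ?thesis using continuous_on_cball r_pos
    by (metis centre_in_ball continuous_on_interior interior_cball)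
qed

text \<open>By minimality of \<open>F\<close>, each Clarke subgradient in the ball has inner product
  at most \<open>- norm F\<close> with the unit direction \<open>d\<close>. Local slopes along
  \<open>d\<close> are therefore at most \<open>- norm F + e\<close>, and they add up over the
  step.\<close>

lemma goldstein_descent:
  assumes f: "locally_weakly_convex_on f D" and "\<delta> > 0" and sub: "cball x \<delta> \<subseteq> D"
    and F: "min_norm_elem (goldstein_subdiff f D \<delta> x) F"
  shows "f (x - (\<delta> / norm F) *\<^sub>R F) \<le> f x - \<delta> * norm F"
\<comment> \<open>For \<open>F = 0\<close> the quotient \<open>\<delta> / norm F\<close> is 0, the
  point does not move and both sides agree.\<close>
proof (cases "F = 0")
  case False
  define d where "d = (- 1 / norm F) *\<^sub>R F"
  have nd: "norm d = 1" using False by (simp add: d_def)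
  have inn: "\<xi> \<bullet> d \<le> - norm F" if "\<xi> \<in> clarke_subdiff f D y" "y \<in> cball x \<delta>" for \<xi> y
  proof -
    have "\<xi> \<in> goldstein_subdiff f D \<delta> x" unfolding goldstein_subdiff_def
      using that by (intro hull_inc) auto
    then have "(norm F)\<^sup>2 \<le> \<xi> \<bullet> F"
      using F by (intro min_norm_elem_inner) (auto simp: goldstein_subdiff_def)
    then show ?thesis using False by (simp add: d_def field_simps power2_eq_square)
  qed
  have "f (x + \<delta> *\<^sub>R d) - f x \<le> \<delta> * (- norm F + e)" if "e > 0" for e
  proof -
    have "0 \<le> \<delta>" using assms by simp
    then have "0 \<le> (0::real) \<and> \<delta> \<le> \<delta> \<longrightarrow> f (x + \<delta> *\<^sub>R d) - f (x + 0 *\<^sub>R d) \<le> (- norm F + e) * (\<delta> - 0)"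
    \<comment> \<open>The slope bound holds on short intervals around each point and adds up over
      adjacent intervals, which is what bisection requires. The slack \<open>e\<close> supplies the
      strict inequality demanded by \<open>local_slope_le\<close>.\<close>
    proof (rule Bolzano[where P="\<lambda>s t. 0 \<le> s \<and> t \<le> \<delta> \<longrightarrow>
        f (x + t *\<^sub>R d) - f (x + s *\<^sub>R d) \<le> (- norm F + e) * (t - s)"])
      fix a b c
      assume "0 \<le> a \<and> b \<le> \<delta> \<longrightarrow> f (x + b *\<^sub>R d) - f (x + a *\<^sub>R d) \<le> (- norm F + e) * (b - a)"
        "0 \<le> b \<and> c \<le> \<delta> \<longrightarrow> f (x + c *\<^sub>R d) - f (x + b *\<^sub>R d) \<le> (- norm F + e) * (c - b)"
        "a \<le> b" "b \<le> c"
      then show "0 \<le> a \<and> c \<le> \<delta> \<longrightarrow> f (x + c *\<^sub>R d) - f (x + a *\<^sub>R d) \<le> (- norm F + e) * (c - a)"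
        by (auto simp: algebra_simps)
    next
      fix t assume t: "0 \<le> t" "t \<le> \<delta>"
      define y where "y = x + t *\<^sub>R d"
      have yc: "y \<in> cball x \<delta>" using t nd by (simp add: y_def dist_norm)
      then obtain r C L where r: "cball y r \<subseteq> D" "quadratically_supported f y r C L"
        using locally_weakly_convex_onE[OF f] sub by blast
      have "\<xi> \<bullet> d < - norm F + e" if "\<xi> \<in> clarke_subdiff f D y" for \<xi>
        using inn[OF that yc] \<open>e > 0\<close> by simp
      then obtain \<eta> where \<eta>: "\<eta> > 0" "\<And>p \<sigma>. norm (p - y) < \<eta> \<Longrightarrow> 0 < \<sigma> \<Longrightarrow> \<sigma> < \<eta> \<Longrightarrow>
          f (p + \<sigma> *\<^sub>R d) - f p \<le> (- norm F + e) * \<sigma>"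
        using quadratically_supported.local_slope_le[OF r(2,1)] by metis
      show "\<exists>\<eta>>0. \<forall>a b. a \<le> t \<and> t \<le> b \<and> b - a < \<eta> \<longrightarrow> 0 \<le> a \<and> b \<le> \<delta> \<longrightarrow>
          f (x + b *\<^sub>R d) - f (x + a *\<^sub>R d) \<le> (- norm F + e) * (b - a)"
      proof (intro exI[of _ \<eta>] conjI \<eta> allI impI)
        fix a b assume ab: "a \<le> t \<and> t \<le> b \<and> b - a < \<eta>" "0 \<le> a \<and> b \<le> \<delta>"
        show "f (x + b *\<^sub>R d) - f (x + a *\<^sub>R d) \<le> (- norm F + e) * (b - a)"
        proof (cases "a = b")
          case False
          have "x + a *\<^sub>R d - y = (a - t) *\<^sub>R d" by (simp add: y_def algebra_simps)
          then have "norm (x + a *\<^sub>R d - y) < \<eta>" using ab nd by simp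
          from \<eta>(2)[OF this, of "b - a"] show ?thesis using ab False by (simp add: algebra_simps)
        qed simp
      qed
    qed
    then show ?thesis by (simp add: algebra_simps)
  qed
  note step = this
  have le: "f (x + \<delta> *\<^sub>R d) - f x + \<delta> * norm F \<le> \<delta> * e" if "e > 0" for e 
    using step[OF that] by (simp add: algebra_simps)
  have "f (x + \<delta> *\<^sub>R d) - f x + \<delta> * norm F \<le> 0"
  proof (rule field_le_epsilon)
    fix e :: real assume "e > 0"
    then show "f (x + \<delta> *\<^sub>R d) - f x + \<delta> * norm F \<le> 0 + e"
      using le[of "e / \<delta>"] \<open>\<delta> > 0\<close> by simp
  qed
  then show ?thesis by (simp add: d_def)
qed simp

text \<open>Every Clarke subgradient mixed into \<open>G\<close> belongs to some \<open>y\<close>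
  within \<open>\<rho>\<close> of \<open>x0\<close>. Moving its base to \<open>x0\<close> costs
  \<open>\<Lambda> * \<rho>\<close> for the value and as much for the inner product; (a + b)^2 \<le>
  2 a^2 + 2 b^2 turns \<open>C\<close> into \<open>2 * C\<close> and adds
  \<open>2 * C * \<rho>^2\<close>. The error vanishes with \<open>\<rho>\<close>.\<close>

lemma goldstein_support:
  assumes "quadratically_supported f x0 r C L"
    and x: "norm (x - x0) + \<delta> \<le> \<rho>" and \<rho>: "\<rho> < r"
    and G: "G \<in> goldstein_subdiff f D \<delta> x" and z: "z \<in> cball x0 r"
  shows "f z \<ge> f x0 + G \<bullet> (z - x0) - 2 * C * (norm (z - x0))\<^sup>2 
           - (2 * quadratically_supported.\<Lambda> r C L + 2 * C * \<rho>) * \<rho>"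
proof -
  interpret quadratically_supported f x0 r C L by fact
  define H where "H = {\<xi>. \<xi> \<bullet> (z - x0) \<le> f z - f x0 + 2 * C * (norm (z - x0))\<^sup>2 + (2 * \<Lambda> + 2 * C * \<rho>) * \<rho>}"
  have "convex H" unfolding H_def inner_commute[of _ "z - x0"] by (rule convex_halfspace_le)
  moreover have "(\<Union>y\<in>cball x \<delta>. clarke_subdiff f D y) \<subseteq> H"
  proof clarify
    fix y \<xi> assume y: "y \<in> cball x \<delta>" and \<xi>: "\<xi> \<in> clarke_subdiff f D y"
    have ny: "norm (y - x0) \<le> \<rho>"
      using norm_triangle_ineq[of "y - x" "x - x0"] y x by (simp add: dist_norm norm_minus_commute)
    then have yb: "y \<in> ball x0 r" using \<rho> by (simp add: dist_norm norm_minus_commute)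
    have \<rho>0: "\<rho> \<ge> 0" using ny norm_ge_zero order_trans by blast
    have "clarke_subdiff f D y \<subseteq> {\<xi>. \<xi> \<bullet> (y - x0) \<le> \<Lambda> * \<rho>}"
      unfolding clarke_subdiff_def
    proof (rule hull_minimal)
      show "convex {\<xi>. \<xi> \<bullet> (y - x0) \<le> \<Lambda> * \<rho>}" 
        unfolding inner_commute[of _ "y - x0"] by (rule convex_halfspace_le)
      show "{G. \<exists>xs Gs. (\<forall>i. xs i \<in> D \<and> (f has_derivative (\<lambda>h. Gs i \<bullet> h)) (at (xs i)))
                 \<and> xs \<longlonglongrightarrow> y \<and> Gs \<longlonglongrightarrow> G} \<subseteq> {\<xi>. \<xi> \<bullet> (y - x0) \<le> \<Lambda> * \<rho>}"
      proof clarify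
        fix G xs Gs assume der: "\<forall>i. xs i \<in> D \<and> (f has_derivative (\<lambda>h. Gs i \<bullet> h)) (at (xs i))"
          and xs: "xs \<longlonglongrightarrow> y" and Gs: "Gs \<longlonglongrightarrow> G"
        have "\<forall>\<^sub>F i in sequentially. xs i \<in> ball x0 r"
          using xs yb open_ball topological_tendstoD by blast
        then have "\<forall>\<^sub>F i in sequentially. norm (Gs i) \<le> L"
          by eventually_elim (use der derivative_is_support(1) in blast)
        then have "norm G \<le> L" by (rule tendsto_upperbound[OF tendsto_norm[OF Gs]]) simp
        then have "norm G \<le> \<Lambda>" using C_nonneg r_pos by (simp add: \<Lambda>_def add_increasing2)
        then have "norm G * norm (y - x0) \<le> \<Lambda> * \<rho>" using ny \<Lambda>_nonneg by (intro mult_mono) auto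
        then show "G \<bullet> (y - x0) \<le> \<Lambda> * \<rho>" using norm_cauchy_schwarz order_trans by blast
      qed
    qed
    then have 1: "\<xi> \<bullet> (y - x0) \<le> \<Lambda> * \<rho>" using \<xi> by auto
    have 2: "f z \<ge> f y + \<xi> \<bullet> (z - y) - C * (norm (z - y))\<^sup>2" by (rule clarke_subdiff_support[OF yb \<xi> z])
    have 3: "f x0 - f y \<le> \<Lambda> * \<rho>" 
      using lipschitz_one_sided[of x0 y] yb r_pos ny \<Lambda>_nonneg mult_left_mono[OF ny \<Lambda>_nonneg]
      by (simp add: norm_minus_commute)
    have "(norm (z - y))\<^sup>2 \<le> (norm (z - x0) + norm (y - x0))\<^sup>2"
      using norm_triangle_ineq[of "z - x0" "x0 - y"] by (intro power_mono) (auto simp: norm_minus_commute)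
    also have "\<dots> \<le> 2 * (norm (z - x0))\<^sup>2 + 2 * (norm (y - x0))\<^sup>2"
      using sum_squares_bound[of "norm (z - x0)" "norm (y - x0)"] by (simp add: power2_sum)
    also have "\<dots> \<le> 2 * (norm (z - x0))\<^sup>2 + 2 * \<rho>\<^sup>2" using ny by (simp add: power_mono)
    finally have 4: "C * (norm (z - y))\<^sup>2 \<le> C * (2 * (norm (z - x0))\<^sup>2 + 2 * \<rho>\<^sup>2)"
      using C_nonneg by (rule mult_left_mono)
    have "\<xi> \<bullet> (z - y) = \<xi> \<bullet> (z - x0) - \<xi> \<bullet> (y - x0)" by (simp add: inner_diff_right)
    then show "\<xi> \<in> H" using 1 2 3 4 by (simp add: H_def algebra_simps power2_eq_square)
  qed
  ultimately have "G \<in> H" using G unfolding goldstein_subdiff_def using hull_minimal[of _ H convex] by blast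
  then show ?thesis by (simp add: H_def)
qed

text \<open>Otherwise \<open>\<delta> n \<le> \<delta> n * F n / e\<close> eventually, and
  comparison would make \<open>\<delta>\<close> summable.\<close>

lemma not_summable_liminf_zero:
  fixes \<delta> F :: "nat \<Rightarrow> real"
  assumes "\<not> summable \<delta>" "\<And>n. \<delta> n \<ge> 0" "summable (\<lambda>n. \<delta> n * F n)" "\<And>n. F n \<ge> 0" "e > 0"
  shows "\<exists>n\<ge>N. F n < e"
proof (rule ccontr)
  assume "\<not> ?thesis"
  then have ge: "F n \<ge> e" if "n \<ge> N" for n using that by force
  have "summable \<delta>"
  proof (rule summable_comparison_test)
    show "\<exists>N. \<forall>n\<ge>N. norm (\<delta> n) \<le> \<delta> n * F n / e"
      using ge assms(2,5) by (intro exI[of _ N]) (auto simp: pos_le_divide_eq intro: mult_left_mono)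
    show "summable (\<lambda>n. \<delta> n * F n / e)" using assms(3) by (rule summable_divide)
  qed
  then show False using assms by simp
qed

text \<open>\<open>sub\<close> keeps each trial ball inside \<open>D\<close>, so descent keeps the
  iterates in the initial sublevel set. \<open>F\<close> need only be small along a subsequence:
  since the values decrease, an accumulation point of that subsequence already fixes their
  limit.\<close>

theorem goldstein_method_limit:
  fixes f :: "'a::euclidean_space \<Rightarrow> real"
  assumes f: "locally_weakly_convex_on f D" and lower: "\<And>x. x \<in> D \<Longrightarrow> m \<le> f x"
    and X0: "X 0 \<in> D" and comp: "compact {x\<in>D. f x \<le> f (X 0)}"
    and \<delta>: "\<And>n. \<delta> n > 0" "\<delta> \<longlonglongrightarrow> 0" "\<not> summable \<delta>"
    and sub: "\<And>x n. x \<in> D \<Longrightarrow> f x \<le> f (X 0) \<Longrightarrow> cball x (\<delta> n) \<subseteq> D"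
    and F: "\<And>n. min_norm_elem (goldstein_subdiff f D (\<delta> n) (X n)) (F n)"
    and step: "\<And>n. X (Suc n) = X n - (\<delta> n / norm (F n)) *\<^sub>R F n"
  obtains x r C where "\<And>n. X n \<in> D" "x \<in> D" "(\<lambda>n. f (X n)) \<longlonglongrightarrow> f x" "r > 0" "C \<ge> 0"
    "\<And>z. z \<in> ball x r \<Longrightarrow> f z \<ge> f x - C * (norm (z - x))\<^sup>2"
proof -
  have main: "X n \<in> D \<and> f (X n) \<le> f (X 0)" for n
  proof (induction n)
    case (Suc n)
    then have c: "cball (X n) (\<delta> n) \<subseteq> D" using sub by blast
    have "norm ((\<delta> n / norm (F n)) *\<^sub>R F n) \<le> \<delta> n" using \<delta>(1)[of n] by (cases "F n = 0") auto
    then have "X (Suc n) \<in> cball (X n) (\<delta> n)" by (simp add: step dist_norm)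
    moreover have "f (X (Suc n)) \<le> f (X n) - \<delta> n * norm (F n)"
      unfolding step by (rule goldstein_descent[OF f \<delta>(1) c F])
    moreover have "\<delta> n * norm (F n) \<ge> 0" using \<delta>(1)[of n] by simp
    ultimately show ?case using c Suc by auto
  qed (use X0 in simp)
  have desc: "\<delta> n * norm (F n) \<le> f (X n) - f (X (Suc n))" for n
    using goldstein_descent[OF f \<delta>(1) _ F, of n] sub main[of n] unfolding step by fastforce
  have nn: "\<delta> n * norm (F n) \<ge> 0" for n using \<delta>(1)[of n] by simp
  have dec: "decseq (\<lambda>n. f (X n))" using desc nn by (intro decseq_SucI) (smt (verit))
  then obtain l where l: "(\<lambda>n. f (X n)) \<longlonglongrightarrow> l"
    using decseq_convergent[of "\<lambda>n. f (X n)" m] lower main by blast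
  have "summable (\<lambda>n. f (X n) - f (X (Suc n)))" using telescope_summable'[OF l] by simp
  then have summ: "summable (\<lambda>n. \<delta> n * norm (F n))"
    using desc nn by (intro summable_comparison_test[of "\<lambda>n. \<delta> n * norm (F n)"]) auto
  have "\<exists>n\<ge>N. norm (F n) < e" if "e > 0" for e N
    using not_summable_liminf_zero[OF \<delta>(3) _ summ _ that] \<delta>(1) by (meson less_imp_le norm_ge_zero)
  then have "\<exists>n\<ge>k. norm (F n) < 1 / (real k + 1)" for k by simp
  \<comment> \<open>Indices with small \<open>F\<close> are picked first, the compactness
    subsequence \<open>t\<close> second. \<open>s\<close> need not be increasing;
    \<open>s k \<ge> k\<close> suffices for the composite indices to tend to infinity.\<close>
  then obtain s where s: "\<And>k. s k \<ge> k" "\<And>k. norm (F (s k)) < 1 / (real k + 1)" by metis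
  have "\<forall>k. X (s k) \<in> {x\<in>D. f x \<le> f (X 0)}" using main by auto
  then obtain x t where x: "x \<in> {x\<in>D. f x \<le> f (X 0)}" and t: "strict_mono t"
    and lim: "((\<lambda>k. X (s k)) \<circ> t) \<longlonglongrightarrow> x" 
    using comp[unfolded compact_def, THEN spec, of "\<lambda>k. X (s k)"] by blast
  define u where "u k = s (t k)" for k
  have Xu: "(\<lambda>k. X (u k)) \<longlonglongrightarrow> x" using lim by (simp add: u_def o_def)
  have "u k \<ge> k" for k using s(1)[of "t k"] seq_suble[OF t, of k] by (simp add: u_def)
  then have ufil: "filterlim u at_top sequentially"
    by (intro filterlim_at_top_mono[OF filterlim_ident]) auto
  have Fu: "(\<lambda>k. F (u k)) \<longlonglongrightarrow> 0"
  proof (rule Lim_null_comparison[OF always_eventually])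
    show "\<forall>k. norm (F (u k)) \<le> 1 / (real (t k) + 1)" using s(2) by (auto simp: u_def less_imp_le)
    have "(\<lambda>k. 1 / (real k + 1)) \<longlonglongrightarrow> 0"
      using LIMSEQ_Suc[OF lim_1_over_n] by (simp add: add.commute)
    from LIMSEQ_subseq_LIMSEQ[OF this t] show "(\<lambda>k. 1 / (real (t k) + 1)) \<longlonglongrightarrow> 0"
      by (simp add: o_def)
  qed
  have xD: "x \<in> D" using x by simp
  have "(\<lambda>k. f (X (u k))) \<longlonglongrightarrow> f x"
    using locally_weakly_convex_isCont[OF f xD] Xu isCont_tendsto_compose by blast
  moreover have "(\<lambda>k. f (X (u k))) \<longlonglongrightarrow> l" using filterlim_compose[OF l ufil] .
  ultimately have lx: "l = f x" using LIMSEQ_unique by blast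
  obtain r C L where q: "quadratically_supported f x r C L" using locally_weakly_convex_onE[OF f xD] by metis
  then interpret quadratically_supported f x r C L .
  define \<rho> where "\<rho> k = norm (X (u k) - x) + \<delta> (u k)" for k
  have "(\<lambda>k. norm (X (u k) - x) + \<delta> (u k)) \<longlonglongrightarrow> norm (x - x) + 0"
    by (intro tendsto_intros Xu filterlim_compose[OF \<delta>(2) ufil])
  then have \<rho>0: "\<rho> \<longlonglongrightarrow> 0" unfolding \<rho>_def by simp
  then have ev: "\<forall>\<^sub>F k in sequentially. \<rho> k < r" using r_pos order_tendstoD(2) by blast
  have "f z \<ge> f x - (2 * C) * (norm (z - x))\<^sup>2" if z: "z \<in> ball x r" for z
  proof -
    \<comment> \<open>Limit of \<open>goldstein_support\<close>: the subgradients and the radii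
      \<open>\<rho> k\<close> both tend to 0.\<close>
    have "f z \<ge> f x + 0 \<bullet> (z - x) - 2 * C * (norm (z - x))\<^sup>2 - (2 * \<Lambda> + 2 * C * 0) * 0"
    proof (rule tendsto_le[OF trivial_limit_sequentially tendsto_const])
      show "(\<lambda>k. f x + F (u k) \<bullet> (z - x) - 2 * C * (norm (z - x))\<^sup>2 - (2 * \<Lambda> + 2 * C * \<rho> k) * \<rho> k)
        \<longlonglongrightarrow> f x + 0 \<bullet> (z - x) - 2 * C * (norm (z - x))\<^sup>2 - (2 * \<Lambda> + 2 * C * 0) * 0"
        by (intro tendsto_intros Fu \<rho>0)
      show "\<forall>\<^sub>F k in sequentially. f x + F (u k) \<bullet> (z - x) - 2 * C * (norm (z - x))\<^sup>2 
          - (2 * \<Lambda> + 2 * C * \<rho> k) * \<rho> k \<le> f z"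
        using ev
      proof eventually_elim
        case (elim k)
        show ?case
        proof (rule goldstein_support[OF q])
          show "F (u k) \<in> goldstein_subdiff f D (\<delta> (u k)) (X (u k))"
            using F by (auto simp: min_norm_elem_def)
        qed (use elim z in \<open>auto simp: \<rho>_def\<close>)
      qed
    qed
    then show ?thesis by simp
  qed
  then show ?thesis using that[of x r "2 * C"] main xD l lx r_pos C_nonneg by auto
qed

section \<open>Symmetric matrices and the resolvent in real coordinates\<close>

lemma matrix_vector_mult_sum_right:
  fixes A :: "real^'n^'m"
  shows "A *v (\<Sum>i\<in>I. f i) = (\<Sum>i\<in>I. A *v f i)"
  by (induction I rule: infinite_finite_induct) (auto simp: matrix_vector_right_distrib)

lemma transpose_eq_self_iff:
  fixes P :: "real^'n^'n"
  shows "transpose P = P \<longleftrightarrow> (\<forall>x y. x \<bullet> (P *v y) = (P *v x) \<bullet> y)"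
proof
  assume "transpose P = P"
  then show "\<forall>x y. x \<bullet> (P *v y) = (P *v x) \<bullet> y"
    by (metis dot_lmul_matrix transpose_matrix_vector)
next
  assume *: "\<forall>x y. x \<bullet> (P *v y) = (P *v x) \<bullet> y"
  have "(transpose P *v x) \<bullet> y = (P *v x) \<bullet> y" for x y
    using * by (simp add: dot_lmul_matrix)
  then show "transpose P = P" unfolding matrix_eq by (metis vector_eq_rdot)
qed

text \<open>The squared norm of \<open>(e\<^bsup>i\<theta>\<^esup> I - M) (a + i b)\<close>. Complex vectors are represented by pairs
  of real vectors.\<close>

definition resolvent_sq :: "real^'n^'n \<Rightarrow> real \<Rightarrow> real^'n \<Rightarrow> real^'n \<Rightarrow> real" where
  "resolvent_sq M \<theta> a b = (norm (cos \<theta> *\<^sub>R a - sin \<theta> *\<^sub>R b - M *v a))\<^sup>2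
     + (norm (sin \<theta> *\<^sub>R a + cos \<theta> *\<^sub>R b - M *v b))\<^sup>2"

lemma resolvent_sq_nonneg: "resolvent_sq M \<theta> a b \<ge> 0"
  by (simp add: resolvent_sq_def)

subsection \<open>Quadratic forms from the parallelogram law\<close>

text \<open>The homogeneity defect \<open>e\<close> is additive and vanishes at the integers, so it
  depends only on the fractional part of \<open>t\<close> and is bounded. A bounded additive
  function is 0, because \<open>e (n t) = n e t\<close>.\<close>

lemma additive_bounded_linear:
  fixes f :: "'a::real_normed_vector \<Rightarrow> real"
  assumes add: "\<And>x y. f (x + y) = f x + f y"
    and bounded: "\<And>r. \<exists>K. \<forall>x. norm x \<le> r \<longrightarrow> \<bar>f x\<bar> \<le> K"
  shows "linear f"
proof (rule linearI[OF add])
  fix t x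
  define e where "e t = f (t *\<^sub>R x) - t * f x" for t
  have e_add: "e (s + t) = e s + e t" for s t by (simp add: e_def add scaleR_add_left algebra_simps)
  have e_nat: "e (of_nat n * t) = of_nat n * e t" for n t
    by (induction n) (use e_add[of 0 0] in \<open>simp_all add: e_add distrib_right\<close>)
  have e1: "e 1 = 0" by (simp add: e_def)
  have e_neg: "e (- t) = - e t" for t using e_add[of t "- t"] e_add[of 0 0] by simp
  have e_int: "e (of_int k) = 0" for k
  proof (cases k)
    case (nonneg n) then show ?thesis using e_nat[of n 1] e1 by simp
  next
    case (neg n) then show ?thesis using e_nat[of "Suc n" 1] e_neg[of "of_nat (Suc n)"] e1 by simp
  qed
  obtain K where K: "\<And>y. norm y \<le> norm x \<Longrightarrow> \<bar>f y\<bar> \<le> K" using bounded by blast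
  have e_bound: "\<bar>e t\<bar> \<le> K + \<bar>f x\<bar>" for t
  proof -
    have fr: "0 \<le> frac t" "frac t \<le> 1" by (auto simp: frac_lt_1 less_imp_le)
    have "e t = e (frac t)" using e_add[of "frac t" "of_int \<lfloor>t\<rfloor>"] e_int by (simp add: frac_def)
    also have "\<bar>\<dots>\<bar> \<le> \<bar>f (frac t *\<^sub>R x)\<bar> + frac t * \<bar>f x\<bar>" using abs_triangle_ineq4[of "f (frac t *\<^sub>R x)" "frac t * f x"] fr(1)
      unfolding e_def by (simp only: abs_mult abs_of_nonneg)
    also have "\<dots> \<le> K + \<bar>f x\<bar>" using fr by (intro add_mono K) (auto intro: mult_left_le_one_le)
    finally show ?thesis .
  qed
  have "e t = 0"
  proof (rule ccontr)
    assume "e t \<noteq> 0"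
    then obtain n :: nat where "K + \<bar>f x\<bar> < of_nat n * \<bar>e t\<bar>"
      using reals_Archimedean3[of "\<bar>e t\<bar>"] by auto
    then show False using e_bound[of "of_nat n * t"] by (simp add: e_nat abs_mult)
  qed
  then show "f (t *\<^sub>R x) = t *\<^sub>R f x" by (simp add: e_def)
qed

text \<open>Jordan-von Neumann: polarisation turns the parallelogram law into additivity in one
  argument, the bounds on \<open>V\<close> turn additivity into linearity, and the Riesz vectors
  \<open>w y\<close> of \<open>B\<close> form the matrix.\<close>

lemma parallelogram_matrix:
  fixes V :: "real^'n \<Rightarrow> real"
  assumes par: "\<And>x y. V (x + y) + V (x - y) = 2 * V x + 2 * V y"
    and hom: "\<And>t x. V (t *\<^sub>R x) = t\<^sup>2 * V x"
    and bnd: "\<And>x. 0 \<le> V x" "\<And>x. V x \<le> g * (norm x)\<^sup>2" and g: "g \<ge> 0"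
  obtains P :: "real^'n^'n" where "transpose P = P" "\<And>x. x \<bullet> (P *v x) = V x"
proof -
  define B where "B x y = (V (x + y) - V (x - y)) / 4" for x y
  have Vneg: "V (- x) = V x" for x using hom[of "-1" x] by simp
  have sym: "B x y = B y x" for x y
    using Vneg[of "x - y"] by (simp add: B_def add.commute)
  have B0: "B 0 y = 0" for y using Vneg[of y] by (simp add: B_def)
  have B2: "B (x + x') y + B (x - x') y = 2 * B x y" for x x' y
    proof -
    have "x + x' + y = x + y + x'" "x + x' - y = x - y + x'" "x - x' + y = x + y - x'" "x - x' - y = x - y - x'"
      by (simp_all add: algebra_simps)
    then show ?thesis using par[of "x + y" x'] par[of "x - y" x'] by (simp add: B_def field_simps)
  qed
  have add: "B (u + v) y = B u y + B v y" for u v y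
  proof -
    define p q where "p = (1/2) *\<^sub>R (u + v)" and "q = (1/2) *\<^sub>R (u - v)"
    have "p + q = u" "p - q = v" "p + p = u + v"
      by (auto simp: p_def q_def vec_eq_iff field_simps)
    then show ?thesis using B2[of p q y] B2[of p p y] B0[of y] by simp
  qed
  have lin: "linear (\<lambda>x. B x y)" for y
  proof (rule additive_bounded_linear[OF add])
    fix r
    have "\<bar>B x y\<bar> \<le> g * (\<bar>r\<bar> + norm y)\<^sup>2" if "norm x \<le> r" for x
    proof -
      have "V z \<le> g * (\<bar>r\<bar> + norm y)\<^sup>2" if "norm z \<le> \<bar>r\<bar> + norm y" for z
        using bnd(2)[of z] g that by (smt (verit, ccfv_SIG) mult_left_mono norm_ge_zero power_mono)
      from this[of "x + y"] this[of "x - y"]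
      have "V (x + y) \<le> g * (\<bar>r\<bar> + norm y)\<^sup>2" "V (x - y) \<le> g * (\<bar>r\<bar> + norm y)\<^sup>2"
        using that norm_triangle_ineq[of x y] norm_triangle_ineq4[of x y] by linarith+
      then show ?thesis using bnd(1)[of "x + y"] bnd(1)[of "x - y"] by (simp add: B_def abs_le_iff)
    qed
    then show "\<exists>K. \<forall>x. norm x \<le> r \<longrightarrow> \<bar>B x y\<bar> \<le> K" by blast
  qed
  define w where "w y = adjoint (\<lambda>x. B x y) 1" for y
  have w: "x \<bullet> w y = B x y" for x y using adjoint_works[OF lin, of x y 1] by (simp add: w_def)
  have lin2: "B x (u + v) = B x u + B x v" "B x (t *\<^sub>R u) = t * B x u" for x u v t
    using linear_add[OF lin] linear_scale[OF lin] by (auto simp: sym[of x])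
  have "linear w"
  proof (rule linearI)
    show "w (u + v) = w u + w v" for u v
      by (subst vector_eq_ldot[symmetric]) (simp add: w inner_add_right lin2)
    show "w (t *\<^sub>R u) = t *\<^sub>R w u" for u t
      by (subst vector_eq_ldot[symmetric]) (simp add: w lin2)
  qed
  then have mw: "matrix w *v y = w y" for y by (simp add: matrix_works linear_matrix_vector_mul_eq)
  show ?thesis
  proof
    show "transpose (matrix w) = matrix w"
      unfolding transpose_eq_self_iff mw by (metis inner_commute sym w)
    have "V (x + x) = 4 * V x" "V 0 = 0" for x using hom[of 2 x] hom[of 0 x] by (simp_all add: scaleR_2)
    then show "x \<bullet> (matrix w *v x) = V x" for x by (simp add: mw w B_def)
  qed
qed

subsection \<open>Discrete Fourier transform of periodic trajectories\<close>

text \<open>For \<open>s \<noteq> t\<close>, the real part of a full geometric sum over an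
  \<open>N\<close>-th root of unity, which differs from 1 because \<open>s - t\<close> is not a
  multiple of \<open>N\<close>.\<close>

lemma sum_cos_roots_of_unity:
  fixes N s t :: nat
  assumes "s < N" "t < N"
  shows "(\<Sum>k<N. cos (2 * pi * k / N * s - 2 * pi * k / N * t)) = (if s = t then real N else 0)"
proof (cases "s = t")
  case False
  define x where "x = 2 * pi * (real s - real t) / N"
  have N: "real N > 0" using assms by simp
  have "cis x \<noteq> 1"
  proof
    assume "cis x = 1"
    then have "cos x = 1" by (metis cis.sel(1) one_complex.sel(1))
    then obtain n :: int where "x = of_int n * 2 * pi" using cos_one_2pi_int by blast
    then have "real s - real t = of_int n * N" using N pi_gt_zero unfolding x_def by (simp add: divide_simps mult.commute mult.left_commute)
    then have eq: "int s - int t = n * int N" 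
    proof -
      have "real_of_int (int s - int t) = real_of_int (n * int N)"
        using \<open>real s - real t = of_int n * N\<close> by simp
      then show ?thesis by (simp only: of_int_eq_iff)
    qed
    then have "n \<noteq> 0" using False by auto
    then have "1 \<le> \<bar>n\<bar>" by linarith
    then have "\<bar>n * int N\<bar> \<ge> int N" by (simp add: abs_mult mult_le_cancel_right1)
    then show False using eq assms by linarith
  qed
  moreover have "cis x ^ N = 1"
  proof -
    have "cis x ^ N = cis (2 * pi * of_int (int s - int t))" 
    proof -
      have "real N * x = 2 * pi * of_int (int s - int t)" using N by (simp add: x_def)
      then show ?thesis using Complex.DeMoivre[of x N] by metis
    qed
    then show ?thesis by (metis cis_multiple_2pi Ints_of_int)
  qed
  ultimately have "(\<Sum>k<N. cis x ^ k) = 0" by (simp add: geometric_sum)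
  then have "Re (\<Sum>k<N. cis x ^ k) = 0" by simp
  then have "(\<Sum>k<N. cos (real k * x)) = 0" by (simp add: Complex.DeMoivre)
  moreover have "real k * x = 2 * pi * k / N * s - 2 * pi * k / N * t" for k
    by (simp add: x_def algebra_simps diff_divide_distrib)
  ultimately show ?thesis using False by simp
qed simp

text \<open>Real part of the transform with kernel exp(-i \<theta> t); \<open>dft_sin\<close> is the
  imaginary part, whence its sign.\<close>

definition dft_cos :: "nat \<Rightarrow> (nat \<Rightarrow> real^'n) \<Rightarrow> nat \<Rightarrow> real^'n" where
  "dft_cos N x k = (\<Sum>t<N. cos (2 * pi * k / N * t) *\<^sub>R x t)"

definition dft_sin :: "nat \<Rightarrow> (nat \<Rightarrow> real^'n) \<Rightarrow> nat \<Rightarrow> real^'n" where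
  "dft_sin N x k = - (\<Sum>t<N. sin (2 * pi * k / N * t) *\<^sub>R x t)"

text \<open>Expanding both forms produces cos cos + sin sin, the cosine of a difference;
  orthogonality over \<open>k\<close> leaves only the diagonal.\<close>

lemma dft_parseval:
  fixes S :: "real^'n^'n"
  shows "(\<Sum>k<N. dft_cos N x k \<bullet> (S *v dft_cos N x k) + dft_sin N x k \<bullet> (S *v dft_sin N x k))
    = N * (\<Sum>t<N. x t \<bullet> (S *v x t))"
proof -
  have quad: "(\<Sum>t<N. c t *\<^sub>R x t) \<bullet> (S *v (\<Sum>t<N. c t *\<^sub>R x t))
      = (\<Sum>s<N. \<Sum>t<N. c s * c t * (x s \<bullet> (S *v x t)))" for c :: "nat \<Rightarrow> real"
    by (subst sum.swap) (simp add: matrix_vector_mult_sum_right inner_sum_left inner_sum_right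
        matrix_vector_mult_scaleR sum_distrib_left mult.assoc mult.left_commute)
  have "dft_cos N x k \<bullet> (S *v dft_cos N x k) + dft_sin N x k \<bullet> (S *v dft_sin N x k)
     = (\<Sum>s<N. \<Sum>t<N. cos (2 * pi * k / N * s - 2 * pi * k / N * t) * (x s \<bullet> (S *v x t)))" for k
    using linear_neg[OF matrix_vector_mul_linear, of S]
    by (simp add: dft_cos_def dft_sin_def quad cos_diff distrib_right sum.distrib)
  then have "(\<Sum>k<N. dft_cos N x k \<bullet> (S *v dft_cos N x k) + dft_sin N x k \<bullet> (S *v dft_sin N x k))
     = (\<Sum>k<N. \<Sum>s<N. \<Sum>t<N. cos (2 * pi * k / N * s - 2 * pi * k / N * t) * (x s \<bullet> (S *v x t)))"
    by simp
  also have "\<dots> = (\<Sum>s<N. \<Sum>k<N. \<Sum>t<N. cos (2 * pi * k / N * s - 2 * pi * k / N * t) * (x s \<bullet> (S *v x t)))"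
    by (rule sum.swap)
  also have "\<dots> = (\<Sum>s<N. \<Sum>t<N. \<Sum>k<N. cos (2 * pi * k / N * s - 2 * pi * k / N * t) * (x s \<bullet> (S *v x t)))"
    by (intro sum.cong refl sum.swap)
  also have "\<dots> = (\<Sum>s<N. \<Sum>t<N. (if s = t then real N else 0) * (x s \<bullet> (S *v x t)))"
    by (intro sum.cong refl, subst sum_distrib_right[symmetric], subst sum_cos_roots_of_unity) auto
  also have "\<dots> = N * (\<Sum>t<N. x t \<bullet> (S *v x t))"
    by (simp add: sum_distrib_left if_distrib[of "\<lambda>c. c * _"] cong: if_cong)
  finally show ?thesis .
qed

text \<open>A shift by one multiplies the transform by exp(i \<theta>), here a rotation of the pair.
  Periodicity lets the shifted sum run over the same period.\<close>

lemma dft_shift: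
  assumes per: "x N = x 0"
  defines "\<theta> k \<equiv> 2 * pi * real k / real N"
  shows "dft_cos N (\<lambda>t. x (Suc t)) k = cos (\<theta> k) *\<^sub>R dft_cos N x k - sin (\<theta> k) *\<^sub>R dft_sin N x k"
    and "dft_sin N (\<lambda>t. x (Suc t)) k = sin (\<theta> k) *\<^sub>R dft_cos N x k + cos (\<theta> k) *\<^sub>R dft_sin N x k"
proof -
  have shift: "(\<Sum>t<N. f (Suc t)) = (\<Sum>t<N. f t)" if "f N = f 0" for f :: "nat \<Rightarrow> real^'a"
    using sum.lessThan_Suc_shift[of f N] that by (simp add: add.commute)
  have \<theta>N: "cos (\<theta> k * N) = 1 \<and> sin (\<theta> k * N) = 0"
  proof (cases "N = 0")
    case False
    then have "\<theta> k * N = 2 * pi * real k" by (simp add: \<theta>_def)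
    then show ?thesis using sin_int_2pin[of "int k"] cos_int_2pin[of "int k"] by simp
  qed simp
  have c: "(\<Sum>t<N. cos (\<theta> k * Suc t) *\<^sub>R x (Suc t)) = dft_cos N x k"
    using shift[of "\<lambda>t. cos (\<theta> k * t) *\<^sub>R x t"] \<theta>N per by (simp add: dft_cos_def \<theta>_def)
  have s: "(\<Sum>t<N. sin (\<theta> k * Suc t) *\<^sub>R x (Suc t)) = - dft_sin N x k"
    using shift[of "\<lambda>t. sin (\<theta> k * t) *\<^sub>R x t"] \<theta>N per by (simp add: dft_sin_def \<theta>_def)
  have eq: "\<theta> k * t = \<theta> k * Suc t - \<theta> k" for t by (simp add: algebra_simps)
  have "dft_cos N (\<lambda>t. x (Suc t)) k = (\<Sum>t<N. cos (\<theta> k * t) *\<^sub>R x (Suc t))"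
    by (simp add: dft_cos_def \<theta>_def)
  also have "\<dots> = cos (\<theta> k) *\<^sub>R (\<Sum>t<N. cos (\<theta> k * Suc t) *\<^sub>R x (Suc t))
      + sin (\<theta> k) *\<^sub>R (\<Sum>t<N. sin (\<theta> k * Suc t) *\<^sub>R x (Suc t))"
    unfolding scaleR_sum_right sum.distrib[symmetric] 
    by (subst eq, subst cos_diff) (simp add: scaleR_add_left mult.commute)
  finally show "dft_cos N (\<lambda>t. x (Suc t)) k = cos (\<theta> k) *\<^sub>R dft_cos N x k - sin (\<theta> k) *\<^sub>R dft_sin N x k"
    unfolding c s by simp
  have "dft_sin N (\<lambda>t. x (Suc t)) k = - (\<Sum>t<N. sin (\<theta> k * t) *\<^sub>R x (Suc t))"
    by (simp add: dft_sin_def \<theta>_def)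
  also have "\<dots> = sin (\<theta> k) *\<^sub>R (\<Sum>t<N. cos (\<theta> k * Suc t) *\<^sub>R x (Suc t))
      - cos (\<theta> k) *\<^sub>R (\<Sum>t<N. sin (\<theta> k * Suc t) *\<^sub>R x (Suc t))"
    unfolding scaleR_sum_right sum_subtractf[symmetric] sum_negf[symmetric]
    by (subst eq, subst sin_diff) (simp add: scaleR_diff_left mult.commute)
  finally show "dft_sin N (\<lambda>t. x (Suc t)) k = sin (\<theta> k) *\<^sub>R dft_cos N x k + cos (\<theta> k) *\<^sub>R dft_sin N x k"
    unfolding c s by simp
qed

section \<open>Costs of finite trajectories\<close>

text \<open>A trajectory is an arbitrary sequence and its disturbance is the residual
  \<open>\<xi> (Suc t) - M *v \<xi> t\<close>. The dynamics are thus no constraint, and the cost is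
  a quadratic form in \<open>\<xi>\<close>.\<close>

definition traj_cost :: "real^'n^'n \<Rightarrow> real^'n^'n \<Rightarrow> real \<Rightarrow> (nat \<Rightarrow> real^'n) \<Rightarrow> nat \<Rightarrow> real" where
  "traj_cost M S g \<xi> N = (\<Sum>t<N. \<xi> t \<bullet> (S *v \<xi> t) - g * (norm (\<xi> (Suc t) - M *v \<xi> t))\<^sup>2)"

text \<open>For a periodic trajectory the transform of the residual is the resolvent factor applied
  to the transform of \<open>\<xi>\<close>. So \<open>H\<close> applies at each frequency and
  Parseval sums the results.\<close>

lemma periodic_traj_cost_nonpos:
  assumes H: "\<And>\<theta> a b. a \<bullet> (S *v a) + b \<bullet> (S *v b) \<le> g * resolvent_sq M \<theta> a b"
    and per: "\<xi> N = \<xi> 0"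
  shows "traj_cost M S g \<xi> N \<le> 0"
proof (cases "N = 0")
  case False
  define w where "w t = \<xi> (Suc t) - M *v \<xi> t" for t
  have wc: "dft_cos N w k = dft_cos N (\<lambda>t. \<xi> (Suc t)) k - M *v dft_cos N \<xi> k" for k
    by (simp add: dft_cos_def w_def matrix_vector_mult_sum_right matrix_vector_mult_scaleR
        scaleR_diff_right sum_subtractf)
  have ws: "dft_sin N w k = dft_sin N (\<lambda>t. \<xi> (Suc t)) k - M *v dft_sin N \<xi> k" for k
    using linear_neg[OF matrix_vector_mul_linear, of M]
    by (simp add: dft_sin_def w_def matrix_vector_mult_sum_right matrix_vector_mult_scaleR
        scaleR_diff_right sum_subtractf)
  have eq: "(norm (dft_cos N w k))\<^sup>2 + (norm (dft_sin N w k))\<^sup>2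
      = resolvent_sq M (2 * pi * k / N) (dft_cos N \<xi> k) (dft_sin N \<xi> k)" for k
    unfolding wc ws dft_shift[where x=\<xi>, OF per] resolvent_sq_def by simp
  have "N * (\<Sum>t<N. \<xi> t \<bullet> (S *v \<xi> t))
     = (\<Sum>k<N. dft_cos N \<xi> k \<bullet> (S *v dft_cos N \<xi> k) + dft_sin N \<xi> k \<bullet> (S *v dft_sin N \<xi> k))"
    by (simp add: dft_parseval)
  also have "\<dots> \<le> (\<Sum>k<N. g * ((norm (dft_cos N w k))\<^sup>2 + (norm (dft_sin N w k))\<^sup>2))"
    unfolding eq by (intro sum_mono H)
  also have "\<dots> = g * (\<Sum>k<N. dft_cos N w k \<bullet> (mat 1 *v dft_cos N w k) + dft_sin N w k \<bullet> (mat 1 *v dft_sin N w k))"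
    by (simp add: sum_distrib_left power2_norm_eq_inner)
  also have "\<dots> = N * (\<Sum>t<N. g * (norm (w t))\<^sup>2)"
    unfolding dft_parseval by (simp add: power2_norm_eq_inner sum_distrib_left mult.left_commute)
  finally have "(\<Sum>t<N. \<xi> t \<bullet> (S *v \<xi> t)) \<le> (\<Sum>t<N. g * (norm (w t))\<^sup>2)" using False by simp
  then show ?thesis by (simp add: traj_cost_def w_def sum_subtractf)
qed (simp add: traj_cost_def)

definition free_extension :: "real^'n^'n \<Rightarrow> (nat \<Rightarrow> real^'n) \<Rightarrow> nat \<Rightarrow> nat \<Rightarrow> real^'n" where
  "free_extension M \<xi> N t = (if t \<le> N then \<xi> t else ((*v) M ^^ (t - N)) (\<xi> N))"

lemma traj_cost_cong:
  assumes "\<And>t. t \<le> N \<Longrightarrow> \<xi> t = \<eta> t"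
  shows "traj_cost M S g \<xi> N = traj_cost M S g \<eta> N"
  unfolding traj_cost_def by (intro sum.cong refl) (use assms in auto)

text \<open>Running on with zero disturbance pays no penalty and only collects nonnegative terms of
  the form \<open>S\<close>.\<close>

lemma traj_cost_free_extension:
  assumes psd: "\<And>x. 0 \<le> x \<bullet> (S *v x)"
  shows "traj_cost M S g \<xi> N \<le> traj_cost M S g (free_extension M \<xi> N) (N + m)"
proof (induction m)
  case 0
  have "traj_cost M S g \<xi> N = traj_cost M S g (free_extension M \<xi> N) N"
    by (rule traj_cost_cong) (simp add: free_extension_def)
  then show ?case by simp
next
  case (Suc m)
  have "free_extension M \<xi> N (Suc (N + m)) = M *v free_extension M \<xi> N (N + m)"
    by (auto simp: free_extension_def Suc_diff_le)
  then show ?case using Suc psd[of "free_extension M \<xi> N (N + m)"] by (simp add: traj_cost_def)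
qed

subsection \<open>The bounded real lemma\<close>

text \<open>The storage function is the available storage: the supremum of the supply extracted along
  finite trajectories. Closing a trajectory to a periodic one bounds it, and the parallelogram law,
  which the cost inherits from being quadratic in the trajectory, makes it a quadratic form.\<close>

theorem bounded_real_lemma:
  fixes M S :: "real^'n^'n"
  assumes lim: "\<And>x. (\<lambda>k. ((*v) M ^^ k) x) \<longlonglongrightarrow> 0"
    and psd: "\<And>x. 0 \<le> x \<bullet> (S *v x)" and g: "g \<ge> 0"
    and H: "\<And>\<theta> a b. a \<bullet> (S *v a) + b \<bullet> (S *v b) \<le> g * resolvent_sq M \<theta> a b"
  obtains P where "transpose P = P"
    "\<And>x y. y \<bullet> (P *v y) + x \<bullet> (S *v x) \<le> x \<bullet> (P *v x) + g * (norm (y - M *v x))\<^sup>2"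
    "\<And>x. 0 \<le> x \<bullet> (P *v x)"
proof -
  let ?c = "traj_cost M S g"
  have bound: "?c \<xi> N \<le> g * (norm (\<xi> 0))\<^sup>2" for \<xi> N
  proof -
    define y where "y m = ((*v) M ^^ Suc m) (\<xi> N)" for m
    have "?c \<xi> N \<le> g * (norm (\<xi> 0 - y m))\<^sup>2" for m
    proof -
      \<comment> \<open>\<open>\<zeta>\<close> coasts for \<open>m\<close> steps after time
        \<open>N\<close>, and \<open>\<eta>\<close> then jumps back to the start, which makes it
        periodic. The jump costs the disturbance \<open>\<xi> 0 - y m\<close>, and
        \<open>y m\<close> tends to 0.\<close>
      define \<zeta> where "\<zeta> = free_extension M \<xi> N"
      define \<eta> where "\<eta> = \<zeta>(Suc (N + m) := \<xi> 0)"
      have "\<eta> (Suc (N + m)) = \<eta> 0" by (simp add: \<eta>_def \<zeta>_def free_extension_def)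
      then have "?c \<eta> (Suc (N + m)) \<le> 0" by (rule periodic_traj_cost_nonpos[OF H])
      moreover have "?c \<eta> (N + m) = ?c \<zeta> (N + m)" by (rule traj_cost_cong) (simp add: \<eta>_def)
      moreover have "?c \<eta> (Suc (N + m)) = ?c \<eta> (N + m) + (\<zeta> (N + m) \<bullet> (S *v \<zeta> (N + m))
          - g * (norm (\<xi> 0 - M *v \<zeta> (N + m)))\<^sup>2)"
        by (simp add: traj_cost_def \<eta>_def)
      moreover have "M *v \<zeta> (N + m) = y m" by (auto simp: \<zeta>_def y_def free_extension_def)
      moreover have "?c \<xi> N \<le> ?c \<zeta> (N + m)" unfolding \<zeta>_def by (rule traj_cost_free_extension[OF psd])
      ultimately show ?thesis using psd[of "\<zeta> (N + m)"] by simp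
    qed
    moreover have "(\<lambda>m. g * (norm (\<xi> 0 - y m))\<^sup>2) \<longlonglongrightarrow> g * (norm (\<xi> 0 - 0))\<^sup>2"
      unfolding y_def by (intro tendsto_intros LIMSEQ_Suc[OF lim])
    ultimately have "?c \<xi> N \<le> g * (norm (\<xi> 0 - 0))\<^sup>2" by (intro LIMSEQ_le_const) auto
    then show ?thesis by simp
  qed
  define V where "V x = (SUP p\<in>{p. fst p 0 = x}. ?c (fst p) (snd p))" for x
  have ne: "{p :: (nat \<Rightarrow> real^'n) \<times> nat. fst p 0 = x} \<noteq> {}" for x
    by (auto intro: exI[of _ "\<lambda>_. x"])
  have Vge: "?c \<xi> N \<le> V (\<xi> 0)" for \<xi> N
  proof -
    have "bdd_above ((\<lambda>p. ?c (fst p) (snd p)) ` {p. fst p 0 = \<xi> 0})"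
      by (rule bdd_aboveI[of _ "g * (norm (\<xi> 0))\<^sup>2"]) (auto, metis bound)
    then show ?thesis unfolding V_def using cSUP_upper[of "(\<xi>, N)" "{p. fst p 0 = \<xi> 0}" "\<lambda>p. ?c (fst p) (snd p)"] by simp
  qed
  have Vle: "V x \<le> K" if "\<And>\<xi> N. \<xi> (0::nat) = x \<Longrightarrow> ?c \<xi> N \<le> K" for x K
    unfolding V_def by (rule cSUP_least[OF ne]) (use that in auto)
  have V0: "0 \<le> V x" for x using Vge[of "\<lambda>_. x" 0] by (simp add: traj_cost_def)
  have Vg: "V x \<le> g * (norm x)\<^sup>2" for x by (rule Vle) (use bound in metis)
  have scale: "?c (\<lambda>t. s *\<^sub>R \<xi> t) N = s\<^sup>2 * ?c \<xi> N" for s \<xi> N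
  proof -
    have "s *\<^sub>R \<xi> (Suc t) - M *v (s *\<^sub>R \<xi> t) = s *\<^sub>R (\<xi> (Suc t) - M *v \<xi> t)" for t
      by (simp add: matrix_vector_mult_scaleR scaleR_diff_right)
    then show ?thesis unfolding traj_cost_def sum_distrib_left
      by (intro sum.cong refl)
        (simp add: matrix_vector_mult_scaleR power_mult_distrib power2_eq_square right_diff_distrib)
  qed
  have hom1: "s\<^sup>2 * V x \<le> V (s *\<^sub>R x)" if "s \<noteq> 0" for s x
  proof -
    have "V x \<le> V (s *\<^sub>R x) / s\<^sup>2"
    proof (rule Vle)
      fix \<xi> :: "nat \<Rightarrow> real^'n" and N assume "\<xi> 0 = x"
      then show "?c \<xi> N \<le> V (s *\<^sub>R x) / s\<^sup>2"
        using Vge[of "\<lambda>t. s *\<^sub>R \<xi> t" N] that by (simp add: scale field_simps)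
    qed
    then show ?thesis using that by (simp add: field_simps)
  qed
  have hom: "V (s *\<^sub>R x) = s\<^sup>2 * V x" for s x
  proof (cases "s = 0")
    case True then show ?thesis using V0[of 0] Vg[of 0] by simp
  next
    case False
    then have "V (s *\<^sub>R x) \<le> s\<^sup>2 * V x" using hom1[of "1/s" "s *\<^sub>R x"] by (simp add: field_simps)
    then show ?thesis using hom1[OF False] by (simp add: order_antisym)
  qed
  have cpar: "?c (\<lambda>t. \<xi> t + \<eta> t) N + ?c (\<lambda>t. \<xi> t - \<eta> t) N = 2 * ?c \<xi> N + 2 * ?c \<eta> N" for \<xi> \<eta> N
  proof -
    have 1: "(x + y) \<bullet> (S *v (x + y)) + (x - y) \<bullet> (S *v (x - y)) = 2 * (x \<bullet> (S *v x)) + 2 * (y \<bullet> (S *v y))" for x y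
      by (simp add: matrix_vector_right_distrib matrix_vector_mult_diff_distrib inner_simps)
    have 2: "(norm ((x + y) - M *v (x' + y')))\<^sup>2 + (norm ((x - y) - M *v (x' - y')))\<^sup>2
        = 2 * (norm (x - M *v x'))\<^sup>2 + 2 * (norm (y - M *v y'))\<^sup>2" for x x' y y'
    proof -
      have "(x + y) - M *v (x' + y') = (x - M *v x') + (y - M *v y')"
        "(x - y) - M *v (x' - y') = (x - M *v x') - (y - M *v y')"
        by (simp_all add: matrix_vector_right_distrib matrix_vector_mult_diff_distrib)
      moreover have "(norm (u + v))\<^sup>2 + (norm (u - v))\<^sup>2 = 2 * (norm u)\<^sup>2 + 2 * (norm v)\<^sup>2" for u v :: "real^'n"
        by (simp add: power2_norm_eq_inner inner_simps)
      ultimately show ?thesis by (simp only:)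
    qed
    show ?thesis unfolding traj_cost_def sum_distrib_left sum.distrib[symmetric]
    proof (intro sum.cong refl)
      fix t
      show "(\<xi> t + \<eta> t) \<bullet> (S *v (\<xi> t + \<eta> t)) - g * (norm (\<xi> (Suc t) + \<eta> (Suc t) - M *v (\<xi> t + \<eta> t)))\<^sup>2 +
         ((\<xi> t - \<eta> t) \<bullet> (S *v (\<xi> t - \<eta> t)) - g * (norm (\<xi> (Suc t) - \<eta> (Suc t) - M *v (\<xi> t - \<eta> t)))\<^sup>2) =
         2 * (\<xi> t \<bullet> (S *v \<xi> t) - g * (norm (\<xi> (Suc t) - M *v \<xi> t))\<^sup>2) +
         2 * (\<eta> t \<bullet> (S *v \<eta> t) - g * (norm (\<eta> (Suc t) - M *v \<eta> t))\<^sup>2)"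
        using 1[of "\<xi> t" "\<eta> t"] arg_cong[OF 2[of "\<xi> (Suc t)" "\<eta> (Suc t)" "\<xi> t" "\<eta> t"], of "\<lambda>z. g * z"]
        by (simp add: algebra_simps)
    qed
  qed
  have par1: "V (x + y) + V (x - y) \<le> 2 * V x + 2 * V y" for x y
  proof -
    have main: "?c \<xi> N + ?c \<eta> N' \<le> 2 * V x + 2 * V y" if "\<xi> 0 = x + y" "\<eta> 0 = x - y"
      for \<xi> \<eta> :: "nat \<Rightarrow> real^'n" and N N'
    proof -
      \<comment> \<open>Coasting gives both trajectories the common horizon \<open>K\<close> without
        lowering their costs; their half sum and half difference then start at \<open>x\<close> and
        \<open>y\<close>.\<close>
      define \<xi>' \<eta>' where "\<xi>' = free_extension M \<xi> N" and "\<eta>' = free_extension M \<eta> N'"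
      define K where "K = N + N'"
      define p q where "p t = (1/2) *\<^sub>R (\<xi>' t + \<eta>' t)" and "q t = (1/2) *\<^sub>R (\<xi>' t - \<eta>' t)" for t
      have pq: "p t + q t = \<xi>' t" "p t - q t = \<eta>' t" for t
        by (auto simp: p_def q_def vec_eq_iff field_simps)
      have "\<xi>' 0 = x + y" "\<eta>' 0 = x - y" by (simp_all add: \<xi>'_def \<eta>'_def free_extension_def that)
      then have "p 0 = x" "q 0 = y" by (auto simp: p_def q_def vec_eq_iff)
      then have "?c p K \<le> V x" "?c q K \<le> V y" using Vge by metis+
      moreover have "?c \<xi>' K + ?c \<eta>' K = 2 * ?c p K + 2 * ?c q K" using cpar[of p q K] by (simp add: pq)
      moreover have "?c \<xi> N \<le> ?c \<xi>' K" "?c \<eta> N' \<le> ?c \<eta>' K"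
        using traj_cost_free_extension[OF psd, of M g \<xi> N N'] traj_cost_free_extension[OF psd, of M g \<eta> N' N]
        by (simp_all add: \<xi>'_def \<eta>'_def K_def add.commute)
      ultimately show ?thesis by linarith
    qed
    have "?c \<eta> N' \<le> 2 * V x + 2 * V y - V (x + y)" if "\<eta> 0 = x - y"
      for \<eta> :: "nat \<Rightarrow> real^'n" and N'
    proof -
      have "V (x + y) \<le> 2 * V x + 2 * V y - ?c \<eta> N'"
        by (rule Vle) (use main[where \<eta>=\<eta>, OF _ that] in \<open>auto simp: le_diff_eq\<close>)
      then show ?thesis by simp
    qed
    then have "V (x - y) \<le> 2 * V x + 2 * V y - V (x + y)" by (rule Vle)
    then show ?thesis by simp
  qed
  \<comment> \<open>The reverse inequality is \<open>par1\<close> at \<open>x + y\<close> and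
    \<open>x - y\<close>, with homogeneity turning the doubled arguments into factors 4.\<close>
  have par: "V (x + y) + V (x - y) = 2 * V x + 2 * V y" for x y
  proof (rule order_antisym[OF par1])
    have "V (2 *\<^sub>R x) + V (2 *\<^sub>R y) \<le> 2 * V (x + y) + 2 * V (x - y)"
      using par1[of "x + y" "x - y"] by (simp add: scaleR_2)
    then show "2 * V x + 2 * V y \<le> V (x + y) + V (x - y)" by (simp add: hom)
  qed
  obtain P where P: "transpose P = P" "\<And>x. x \<bullet> (P *v x) = V x"
    using parallelogram_matrix[OF par hom V0 Vg g] by blast
  show ?thesis
  proof
    fix x y
    \<comment> \<open>Prepending \<open>x\<close> to a trajectory from \<open>y\<close> gives one
      from \<open>x\<close>; the extra stage is the dissipation inequality.\<close>
    have "V y \<le> V x + g * (norm (y - M *v x))\<^sup>2 - x \<bullet> (S *v x)"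
    proof (rule Vle)
      fix \<xi> :: "nat \<Rightarrow> real^'n" and N assume "\<xi> 0 = y"
      then show "?c \<xi> N \<le> V x + g * (norm (y - M *v x))\<^sup>2 - x \<bullet> (S *v x)"
        using Vge[of "case_nat x \<xi>" "Suc N"] unfolding traj_cost_def sum.lessThan_Suc_shift by simp
    qed
    then show "y \<bullet> (P *v y) + x \<bullet> (S *v x) \<le> x \<bullet> (P *v x) + g * (norm (y - M *v x))\<^sup>2"
      by (simp add: P)
  qed (use P V0 in auto)
qed

section \<open>Continuity and bounds of matrix products\<close>

lemma bounded_bilinear_matrix_vector_mult:
  "bounded_bilinear ((*v) :: real^'n^'m \<Rightarrow> real^'n \<Rightarrow> real^'m)"
  unfolding bilinear_conv_bounded_bilinear[symmetric] bilinear_def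
  by (auto intro!: linearI simp: algebra_simps scaleR_matrix_vector_assoc)

lemmas continuous_on_matrix_vector_mult [continuous_intros] =
  bounded_bilinear.continuous_on[OF bounded_bilinear_matrix_vector_mult]

lemma bounded_bilinear_matrix_mult:
  "bounded_bilinear ((**) :: real^'n^'m \<Rightarrow> real^'k^'n \<Rightarrow> real^'k^'m)"
  unfolding bilinear_conv_bounded_bilinear[symmetric] bilinear_def
  by (auto intro!: linearI simp: matrix_matrix_mult_def vec_eq_iff sum.distrib sum_distrib_left algebra_simps)

lemmas continuous_on_matrix_mult [continuous_intros] =
  bounded_bilinear.continuous_on[OF bounded_bilinear_matrix_mult]

lemma matrix_vector_mult_norm_bound:
  fixes M :: "real^'n^'m"
  obtains K where "K > 0" "\<And>x. norm (M *v x) \<le> K * norm x"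
  using linear_bounded_pos[OF matrix_vector_mul_linear, of M] by blast

subsection \<open>Spectra through pairs of real vectors\<close>

text \<open>No eigenvalue \<open>r * cis \<theta>\<close> with \<open>r \<ge> 1\<close>, written out
  for an eigenvector a + i b. Unlike a bound on \<open>spectral_radius\<close>, this involves no
  supremum.\<close>

definition schur_stable :: "real^'n^'n \<Rightarrow> bool" where
  "schur_stable M \<longleftrightarrow> (\<forall>r\<ge>1. \<forall>\<theta> a b. M *v a = r *\<^sub>R (cos \<theta> *\<^sub>R a - sin \<theta> *\<^sub>R b) \<longrightarrow>
     M *v b = r *\<^sub>R (sin \<theta> *\<^sub>R a + cos \<theta> *\<^sub>R b) \<longrightarrow> a = 0 \<and> b = 0)"

definition cvec :: "real^'n \<Rightarrow> real^'n \<Rightarrow> complex^'n" where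
  "cvec a b = (\<chi> i. Complex (a $ i) (b $ i))"

lemma cvec_exhaust: obtains a b where "v = cvec a b"
proof
  show "v = cvec (\<chi> i. Re (v $ i)) (\<chi> i. Im (v $ i))" by (simp add: cvec_def vec_eq_iff)
qed

lemma cvec_eq_iff: "cvec a b = cvec c d \<longleftrightarrow> a = c \<and> b = d"
  by (auto simp: cvec_def vec_eq_iff)

lemma cvec_eq_0_iff: "cvec a b = 0 \<longleftrightarrow> a = 0 \<and> b = 0"
  by (auto simp: cvec_def vec_eq_iff complex_eq_iff)

lemma cvec_diff: "cvec a b - cvec c d = cvec (a - c) (b - d)"
  by (simp add: cvec_def vec_eq_iff complex_eq_iff)

lemma cvec_scalar: "z *s cvec a b = cvec (Re z *\<^sub>R a - Im z *\<^sub>R b) (Im z *\<^sub>R a + Re z *\<^sub>R b)"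
  by (simp add: cvec_def vec_eq_iff complex_eq_iff)

lemma cmat_mult_cvec: "cmat M *v cvec a b = cvec (M *v a) (M *v b)"
  by (simp add: cmat_def cvec_def matrix_vector_mult_def vec_eq_iff complex_eq_iff Re_sum Im_sum)

lemma inner_cvec: "cvec a b \<bullet> cvec c d = a \<bullet> c + b \<bullet> d"
  by (simp add: cvec_def inner_vec_def inner_complex_def sum.distrib)

lemma eigenvalues_cmat_iff:
  "z \<in> eigenvalues (cmat M) \<longleftrightarrow> (\<exists>a b. (a \<noteq> 0 \<or> b \<noteq> 0) \<and>
     M *v a = Re z *\<^sub>R a - Im z *\<^sub>R b \<and> M *v b = Im z *\<^sub>R a + Re z *\<^sub>R b)"
  (is "?L = ?R")
proof
  assume ?L
  then obtain v where v: "v \<noteq> 0" "cmat M *v v = z *s v" by (auto simp: eigenvalues_def)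
  obtain a b where "v = cvec a b" using cvec_exhaust by blast
  then show ?R using v by (auto simp: cvec_eq_0_iff cmat_mult_cvec cvec_scalar cvec_eq_iff)
next
  assume ?R
  then obtain a b where "(a \<noteq> 0 \<or> b \<noteq> 0) \<and>
     M *v a = Re z *\<^sub>R a - Im z *\<^sub>R b \<and> M *v b = Im z *\<^sub>R a + Re z *\<^sub>R b" by blast
  then have "cvec a b \<noteq> 0" "cmat M *v cvec a b = z *s cvec a b"
    by (auto simp: cvec_eq_0_iff cmat_mult_cvec cvec_scalar)
  then show ?L unfolding eigenvalues_def by blast
qed

lemma norm_rotation:
  fixes a b :: "'a::real_inner"
  shows "(norm (c *\<^sub>R a - s *\<^sub>R b))\<^sup>2 + (norm (s *\<^sub>R a + c *\<^sub>R b))\<^sup>2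
    = (c\<^sup>2 + s\<^sup>2) * ((norm a)\<^sup>2 + (norm b)\<^sup>2)"
  unfolding power2_norm_eq_inner by (simp add: inner_simps power2_eq_square inner_commute algebra_simps)

lemma cmod_eigenvalue_le:
  fixes M :: "real^'n^'n"
  assumes "z \<in> eigenvalues (cmat M)" "K > 0" "\<And>x. norm (M *v x) \<le> K * norm x"
  shows "cmod z \<le> K"
proof -
  obtain a b where ab: "a \<noteq> 0 \<or> b \<noteq> 0" "M *v a = Re z *\<^sub>R a - Im z *\<^sub>R b" "M *v b = Im z *\<^sub>R a + Re z *\<^sub>R b"
    using assms(1) eigenvalues_cmat_iff by blast
  have pos: "(norm a)\<^sup>2 + (norm b)\<^sup>2 > 0" using ab(1) by (simp add: sum_power2_gt_zero_iff)
  have "(cmod z)\<^sup>2 * ((norm a)\<^sup>2 + (norm b)\<^sup>2) = (norm (M *v a))\<^sup>2 + (norm (M *v b))\<^sup>2"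
    unfolding ab(2,3) cmod_power2 norm_rotation ..
  also have "\<dots> \<le> (K * norm a)\<^sup>2 + (K * norm b)\<^sup>2" by (intro add_mono power_mono assms(3)) auto
  also have "\<dots> = K\<^sup>2 * ((norm a)\<^sup>2 + (norm b)\<^sup>2)" by (simp add: power_mult_distrib distrib_left)
  finally have "(cmod z)\<^sup>2 \<le> K\<^sup>2" using pos by simp
  then show ?thesis using assms(2) by (simp add: power2_le_iff_abs_le)
qed

text \<open>An eigenvalue lies below the real supremum \<open>spectral_radius\<close> only once the
  set of moduli is known to be bounded; an operator bound for \<open>M\<close> supplies
  this.\<close>

lemma spectral_radius_less_1_imp_stable:
  assumes "spectral_radius M < 1"
  shows "schur_stable M"
  unfolding schur_stable_def
proof (intro allI impI, rule ccontr)
  fix r :: real and \<theta> a b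
  assume r: "1 \<le> r" and a: "M *v a = r *\<^sub>R (cos \<theta> *\<^sub>R a - sin \<theta> *\<^sub>R b)"
    and b: "M *v b = r *\<^sub>R (sin \<theta> *\<^sub>R a + cos \<theta> *\<^sub>R b)" and n: "\<not> (a = 0 \<and> b = 0)"
  have ev: "rcis r \<theta> \<in> eigenvalues (cmat M)"
    unfolding eigenvalues_cmat_iff using a b n
    by (intro exI[of _ a] exI[of _ b]) (auto simp: scaleR_diff_right scaleR_add_right)
  obtain K where K: "K > 0" "\<And>x. norm (M *v x) \<le> K * norm x" using matrix_vector_mult_norm_bound by blast
  have "bdd_above (cmod ` eigenvalues (cmat M))"
    by (rule bdd_aboveI[of _ K]) (use cmod_eigenvalue_le K in blast)
  then have "cmod (rcis r \<theta>) \<le> spectral_radius M"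
    unfolding spectral_radius_def using ev by (intro cSup_upper imageI)
  then show False using assms r by simp
qed

text \<open>A point of the unit circle replaces the angle, and homogeneity reduces
  \<open>(a, b)\<close> to a unit sphere, so a positive continuous function is minimised over a
  compact set. The parameter \<open>t\<close> later scales a matrix or moves the gain.\<close>

lemma resolvent_sq_uniform_lower_bound:
  fixes m :: "'t::topological_space \<Rightarrow> real^'n^'n"
  assumes T: "compact T" and m: "continuous_on T m"
    and nz: "\<And>t \<theta> a b. t \<in> T \<Longrightarrow> resolvent_sq (m t) \<theta> a b = 0 \<Longrightarrow> a = 0 \<and> b = 0"
  obtains d where "d > 0" "\<And>t \<theta> a b. t \<in> T \<Longrightarrow> d * ((norm a)\<^sup>2 + (norm b)\<^sup>2) \<le> resolvent_sq (m t) \<theta> a b"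
proof (cases "T = {}")
  case True
  then show ?thesis using that[of 1] by simp
next
  case False
  define f where "f = (\<lambda>(t, (c, s), (a, b)). (norm (c *\<^sub>R a - s *\<^sub>R b - m t *v a))\<^sup>2
     + (norm (s *\<^sub>R a + c *\<^sub>R b - m t *v b))\<^sup>2)"
  have fr: "f (t, (cos \<theta>, sin \<theta>), (a, b)) = resolvent_sq (m t) \<theta> a b" for t \<theta> a b
    by (simp add: f_def resolvent_sq_def)
  let ?S = "T \<times> (sphere (0 :: real \<times> real) 1 \<times> sphere (0 :: (real^'n) \<times> (real^'n)) 1)"
  have "compact ?S" by (intro compact_Times T compact_sphere)
  moreover have "sphere (0 :: real \<times> real) 1 \<noteq> {}" "sphere (0 :: (real^'n) \<times> (real^'n)) 1 \<noteq> {}"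
    using vector_choose_size[of 1] by (metis dist_0_norm empty_iff mem_sphere zero_le_one)+
  then have "?S \<noteq> {}" using False by blast
  moreover have "continuous_on ?S f"
    unfolding f_def case_prod_beta
    by (intro continuous_intros continuous_on_compose2[OF m]) auto
  ultimately obtain p where p: "p \<in> ?S" "\<And>q. q \<in> ?S \<Longrightarrow> f p \<le> f q"
    using continuous_attains_inf[of ?S f] by blast
  obtain t c s a b where peq: "p = (t, (c, s), (a, b))" by (metis prod.collapse)
  have t: "t \<in> T" and cs: "c\<^sup>2 + s\<^sup>2 = 1" and ab: "(a, b) \<noteq> (0, 0)"
    using p(1) by (auto simp: peq norm_Pair)
  obtain \<theta> where "c = cos \<theta>" "s = sin \<theta>" using sincos_total_2pi[OF cs] by metis
  then have "f p \<noteq> 0" using nz[OF t, of \<theta> a b] ab by (auto simp: peq fr)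
  moreover have "f p \<ge> 0" by (simp add: peq f_def)
  ultimately have pos: "f p > 0" by simp
  have "f p * ((norm a)\<^sup>2 + (norm b)\<^sup>2) \<le> resolvent_sq (m t) \<theta> a b" if t: "t \<in> T" for t \<theta> a b
  proof (cases "a = 0 \<and> b = 0")
    case True then show ?thesis by (simp add: resolvent_sq_nonneg)
  next
    case False
    define l where "l = norm (a, b)"
    have l: "l > 0" "l\<^sup>2 = (norm a)\<^sup>2 + (norm b)\<^sup>2" using False by (auto simp: l_def norm_Pair sum_power2_gt_zero_iff)
    have "norm ((1/l) *\<^sub>R (a, b)) = 1" unfolding norm_scaleR l_def[symmetric] using l(1) by simp
    then have "(t, (cos \<theta>, sin \<theta>), ((1/l) *\<^sub>R a, (1/l) *\<^sub>R b)) \<in> ?S"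
      using t by (simp add: norm_Pair)
    from p(2)[OF this] have "f p \<le> resolvent_sq (m t) \<theta> ((1/l) *\<^sub>R a) ((1/l) *\<^sub>R b)" by (simp add: fr)
    also have "\<dots> = (1/l)\<^sup>2 * resolvent_sq (m t) \<theta> a b"
    proof -
      have "cos \<theta> *\<^sub>R (1/l) *\<^sub>R a - sin \<theta> *\<^sub>R (1/l) *\<^sub>R b - m t *v (1/l) *\<^sub>R a
          = (1/l) *\<^sub>R (cos \<theta> *\<^sub>R a - sin \<theta> *\<^sub>R b - m t *v a)"
        "sin \<theta> *\<^sub>R (1/l) *\<^sub>R a + cos \<theta> *\<^sub>R (1/l) *\<^sub>R b - m t *v (1/l) *\<^sub>R b
          = (1/l) *\<^sub>R (sin \<theta> *\<^sub>R a + cos \<theta> *\<^sub>R b - m t *v b)"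
        by (simp_all add: matrix_vector_mult_scaleR scaleR_diff_right scaleR_add_right)
      then show ?thesis unfolding resolvent_sq_def by (simp add: power_mult_distrib power_divide distrib_left add_divide_distrib)
    qed
    finally have "f p * l\<^sup>2 \<le> resolvent_sq (m t) \<theta> a b" using l(1) by (simp add: power_divide field_simps)
    then show ?thesis by (simp add: l)
  qed
  then show ?thesis using that pos by blast
qed

text \<open>A singular resolvent of \<open>s *\<^sub>R M\<close> exhibits an eigenvalue of
  \<open>M\<close> of modulus \<open>1 / s \<ge> 1\<close>; for \<open>s = 0\<close> the resolvent
  is a rotation.\<close>

lemma resolvent_sq_eq_0_imp_zero:
  assumes "schur_stable M" "0 \<le> s" "s \<le> 1" "resolvent_sq (s *\<^sub>R M) \<theta> a b = 0"
  shows "a = 0 \<and> b = 0"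
proof -
  have eq: "s *\<^sub>R (M *v a) = cos \<theta> *\<^sub>R a - sin \<theta> *\<^sub>R b" "s *\<^sub>R (M *v b) = sin \<theta> *\<^sub>R a + cos \<theta> *\<^sub>R b"
    using assms(4) by (simp_all add: resolvent_sq_def add_nonneg_eq_0_iff scaleR_matrix_vector_assoc[symmetric])
  show ?thesis
  proof (cases "s = 0")
    case True
    then show ?thesis using norm_rotation[of "cos \<theta>" a "sin \<theta>" b] eq
      by (simp add: add_nonneg_eq_0_iff)
  next
    case False
    then have "M *v a = (1/s) *\<^sub>R (cos \<theta> *\<^sub>R a - sin \<theta> *\<^sub>R b)" "M *v b = (1/s) *\<^sub>R (sin \<theta> *\<^sub>R a + cos \<theta> *\<^sub>R b)"
      by (simp_all add: eq[symmetric])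
    moreover have "1 / s \<ge> 1" using False assms by simp
    ultimately show ?thesis using assms(1) unfolding schur_stable_def by blast
  qed
qed

lemma funpow_scaleR_matrix:
  fixes N :: "real^'n^'n"
  shows "((*v) (\<tau> *\<^sub>R N) ^^ k) x = \<tau> ^ k *\<^sub>R ((*v) N ^^ k) x"
  by (induction k) (simp_all add: scaleR_matrix_vector_assoc[symmetric] matrix_vector_mult_scaleR)

text \<open>The successors \<open>y = 0\<close> and \<open>y = M *v x\<close>, the latter without
  disturbance.\<close>

lemma storage_bounds:
  fixes P :: "real^'n^'n"
  assumes diss: "\<And>x y. y \<bullet> (P *v y) + x \<bullet> (S *v x) \<le> x \<bullet> (P *v x) + g * (norm (y - M *v x))\<^sup>2"
  shows "x \<bullet> (P *v x) \<le> g * (norm x)\<^sup>2"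
    and "(M *v x) \<bullet> (P *v (M *v x)) + x \<bullet> (S *v x) \<le> x \<bullet> (P *v x)"
  using diss[of x 0] diss[of "M *v x" x] by simp_all

text \<open>Continuation in \<open>s\<close> from \<open>s M\<close> with \<open>s\<close> small: the storage function of \<open>s M\<close> makes the powers
  of \<open>s M\<close> decay at a rate depending only on the uniform resolvent bound, so \<open>s\<close> may be increased by a
  fixed factor.\<close>

lemma stable_imp_powers_tendsto_0:
  fixes M :: "real^'n^'n"
  assumes "schur_stable M"
  shows "(\<lambda>k. ((*v) M ^^ k) x) \<longlonglongrightarrow> 0"
proof -
  have "continuous_on {0..1::real} (\<lambda>s. s *\<^sub>R M)" by (intro continuous_intros)
  then obtain d0 where d0: "d0 > 0" "\<And>s \<theta> a b. s \<in> {0..1} \<Longrightarrow> d0 * ((norm a)\<^sup>2 + (norm b)\<^sup>2) \<le> resolvent_sq (s *\<^sub>R M) \<theta> a b"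
    using resolvent_sq_uniform_lower_bound[of "{0..1::real}" "\<lambda>s. s *\<^sub>R M"] resolvent_sq_eq_0_imp_zero[OF assms]
    by (metis atLeastAtMost_iff compact_Icc)
  \<comment> \<open>Capping at 1 keeps the contraction factor \<open>1 - d\<close>
    nonnegative.\<close>
  define d where "d = min d0 1"
  have d: "0 < d" "d \<le> 1" using d0 by (auto simp: d_def)
  have dres: "(norm a)\<^sup>2 + (norm b)\<^sup>2 \<le> (1/d) * resolvent_sq (s *\<^sub>R M) \<theta> a b" if "0 \<le> s" "s \<le> 1" for s \<theta> a b
  proof -
    have "d * ((norm a)\<^sup>2 + (norm b)\<^sup>2) \<le> d0 * ((norm a)\<^sup>2 + (norm b)\<^sup>2)"
      by (rule mult_right_mono) (auto simp: d_def)
    also have "\<dots> \<le> resolvent_sq (s *\<^sub>R M) \<theta> a b" using d0(2) that by simp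
    finally show ?thesis using d by (simp add: field_simps)
  qed
  define T where "T s \<longleftrightarrow> (\<forall>x. (\<lambda>k. ((*v) (s *\<^sub>R M) ^^ k) x) \<longlonglongrightarrow> 0)" for s
  \<comment> \<open>Enlarging \<open>s\<close> by \<open>\<eta>\<close> multiplies squared norms by
    at most \<open>\<eta>^2\<close> per step; the decay \<open>1 - d\<close> of the storage
    outweighs this because \<open>\<eta>^2 \<le> 1 + d\<close>.\<close>
  define \<eta> where "\<eta> = 1 + d / 4"
  have \<eta>: "\<eta> > 1" "0 \<le> \<eta>\<^sup>2 * (1 - d)" "\<eta>\<^sup>2 * (1 - d) < 1"
  proof -
    show "\<eta> > 1" "0 \<le> \<eta>\<^sup>2 * (1 - d)" using d by (auto simp: \<eta>_def)
    have "d * d \<le> d" using d by (simp add: mult_left_le)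
    then have "\<eta>\<^sup>2 \<le> 1 + d" using d by (simp add: \<eta>_def power2_eq_square field_simps)
    then have "\<eta>\<^sup>2 * (1 - d) \<le> (1 + d) * (1 - d)" using d by (intro mult_right_mono) auto
    also have "\<dots> < 1" using d by (simp add: algebra_simps)
    finally show "\<eta>\<^sup>2 * (1 - d) < 1" .
  qed
  have step: "T s'" if Ts: "T s" and s: "0 < s" "s \<le> 1" and "0 \<le> s'" "s' \<le> s * \<eta>" for s s'
  proof -
    obtain P where P: "\<And>x y. y \<bullet> (P *v y) + x \<bullet> (mat 1 *v x) \<le> x \<bullet> (P *v x) + (1/d) * (norm (y - (s *\<^sub>R M) *v x))\<^sup>2"
      "\<And>x. 0 \<le> x \<bullet> (P *v x)"
    proof (rule bounded_real_lemma[of "s *\<^sub>R M" "mat 1" "1/d"])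
      show "\<And>x. (\<lambda>k. ((*v) (s *\<^sub>R M) ^^ k) x) \<longlonglongrightarrow> 0" using Ts by (simp add: T_def)
      show "a \<bullet> (mat 1 *v a) + b \<bullet> (mat 1 *v b) \<le> 1 / d * resolvent_sq (s *\<^sub>R M) \<theta> a b" for \<theta> a b
        using dres[of s a b \<theta>] s by (simp add: power2_norm_eq_inner)
    qed (use d in auto)
    define E where "E x = x \<bullet> (P *v x)" for x
    note sb = storage_bounds[OF P(1)]
    have E1: "(norm x)\<^sup>2 \<le> E x" for x
      using sb(2)[of x] P(2)[of "(s *\<^sub>R M) *v x"] by (simp add: E_def power2_norm_eq_inner)
    \<comment> \<open>The loss per step is the squared norm of \<open>x\<close>, which is at least
      \<open>d * E x\<close> by the upper bound on the storage.\<close>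
    have E2: "E ((s *\<^sub>R M) *v x) \<le> (1 - d) * E x" for x
    proof -
      have "E x \<le> (1/d) * (norm x)\<^sup>2" unfolding E_def by (rule sb(1))
      then have "d * E x \<le> (norm x)\<^sup>2" using d by (simp add: field_simps)
      then show ?thesis using sb(2)[of x] by (simp add: E_def power2_norm_eq_inner algebra_simps)
    qed
    have E3: "E (((*v) (s *\<^sub>R M) ^^ k) x) \<le> (1 - d) ^ k * E x" for k x
    proof (induction k)
      case (Suc k)
      have "E (((*v) (s *\<^sub>R M) ^^ Suc k) x) \<le> (1 - d) * E (((*v) (s *\<^sub>R M) ^^ k) x)"
        using E2 by simp
      also have "\<dots> \<le> (1 - d) * ((1 - d) ^ k * E x)" using Suc d by (intro mult_left_mono) auto
      finally show ?case by simp
    qed simp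
    define \<tau> where "\<tau> = s' / s"
    have \<tau>: "0 \<le> \<tau>" "\<tau> \<le> \<eta>" "s' *\<^sub>R M = \<tau> *\<^sub>R (s *\<^sub>R M)" using that by (auto simp: \<tau>_def field_simps)
    show "T s'"
      unfolding T_def
    proof
      fix x
      have "(norm (((*v) (s' *\<^sub>R M) ^^ k) x))\<^sup>2 \<le> (\<eta>\<^sup>2 * (1 - d)) ^ k * E x" for k
      proof -
        have "(norm (((*v) (s' *\<^sub>R M) ^^ k) x))\<^sup>2 = (\<tau>\<^sup>2) ^ k * (norm (((*v) (s *\<^sub>R M) ^^ k) x))\<^sup>2"
          unfolding \<tau>(3) funpow_scaleR_matrix[where \<tau>=\<tau>]
          using \<tau>(1) by (simp add: power_mult_distrib power_mult[symmetric] mult.commute)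
        also have "\<dots> \<le> (\<eta>\<^sup>2) ^ k * ((1 - d) ^ k * E x)"
          using \<tau> E1[of "((*v) (s *\<^sub>R M) ^^ k) x"] E3[of k x] by (intro mult_mono power_mono) auto
        finally show ?thesis by (simp add: power_mult_distrib)
      qed
      moreover have "(\<lambda>k. (\<eta>\<^sup>2 * (1 - d)) ^ k * E x) \<longlonglongrightarrow> 0"
        by (intro tendsto_mult_left_zero LIMSEQ_realpow_zero \<eta>)
      ultimately have "(\<lambda>k. (norm (((*v) (s' *\<^sub>R M) ^^ k) x))\<^sup>2) \<longlonglongrightarrow> 0"
        by (intro Lim_null_comparison[of "\<lambda>k. (norm (((*v) (s' *\<^sub>R M) ^^ k) x))\<^sup>2"]) auto
      then have "(\<lambda>k. sqrt ((norm (((*v) (s' *\<^sub>R M) ^^ k) x))\<^sup>2)) \<longlonglongrightarrow> sqrt 0"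
        by (intro tendsto_real_sqrt)
      then show "(\<lambda>k. ((*v) (s' *\<^sub>R M) ^^ k) x) \<longlonglongrightarrow> 0" by (simp add: tendsto_norm_zero_iff)
    qed
  qed
  obtain K where K: "K > 0" "\<And>x. norm (M *v x) \<le> K * norm x" using matrix_vector_mult_norm_bound by blast
  \<comment> \<open>Start of the continuation: \<open>s0 *\<^sub>R M\<close> at least halves every
    norm.\<close>
  define s0 where "s0 = min 1 (1 / (2 * K))"
  have s0: "0 < s0" "s0 \<le> 1" "s0 * K \<le> 1/2" using K by (auto simp: s0_def min_def field_simps)
  have "T s0"
    unfolding T_def
  proof
    fix x
    have "norm (((*v) (s0 *\<^sub>R M) ^^ k) x) \<le> (1/2) ^ k * norm x" for k
    proof (induction k)
      case (Suc k)
      let ?y = "((*v) (s0 *\<^sub>R M) ^^ k) x"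
      have "norm (((*v) (s0 *\<^sub>R M) ^^ Suc k) x) = s0 * norm (M *v ?y)"
        using s0 by (simp add: scaleR_matrix_vector_assoc[symmetric])
      also have "\<dots> \<le> s0 * (K * norm ?y)" using s0 K by (intro mult_left_mono) auto
      also have "\<dots> = (s0 * K) * norm ?y" by simp
      also have "\<dots> \<le> (1/2) * ((1/2) ^ k * norm x)" using Suc s0 K by (intro mult_mono) auto
      finally show ?case by simp
    qed simp
    moreover have "(\<lambda>k. (1/2) ^ k * norm x) \<longlonglongrightarrow> 0"
      by (intro tendsto_mult_left_zero LIMSEQ_realpow_zero) auto
    ultimately show "(\<lambda>k. ((*v) (s0 *\<^sub>R M) ^^ k) x) \<longlonglongrightarrow> 0"
      by (intro Lim_null_comparison[of "\<lambda>k. ((*v) (s0 *\<^sub>R M) ^^ k) x"]) auto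
  qed
  \<comment> \<open>The cap at 1 lets the geometric growth end exactly at \<open>M\<close>.\<close>
  have all: "T (min 1 (s0 * \<eta> ^ j))" for j
  proof (induction j)
    case 0 then show ?case using \<open>T s0\<close> s0 by simp
  next
    case (Suc j)
    have pos: "s0 * \<eta> ^ j > 0" using s0 \<eta> by simp
    show ?case
    proof (rule step[OF Suc])
      show "min 1 (s0 * \<eta> ^ Suc j) \<le> min 1 (s0 * \<eta> ^ j) * \<eta>"
      proof (cases "s0 * \<eta> ^ j \<le> 1")
        case True
        then have "min 1 (s0 * \<eta> ^ j) = s0 * \<eta> ^ j" by simp
        then have "min 1 (s0 * \<eta> ^ j) * \<eta> = s0 * \<eta> ^ Suc j" by (simp only: power_Suc mult_ac)
        then show ?thesis by (simp only: min.cobounded2)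
      qed (use \<eta>(1) in simp)
    qed (use pos \<eta> s0 in auto)
  qed
  obtain j where "1 / s0 < \<eta> ^ j" using real_arch_pow[OF \<eta>(1)] by blast
  then have "min 1 (s0 * \<eta> ^ j) = 1" using s0 by (simp add: min_def field_simps)
  then show ?thesis using all[of j] by (simp add: T_def)
qed

text \<open>Without eigenvalues \<open>M\<close> is injective and its multiple \<open>N\<close> is
  vacuously Schur stable, although it stretches every vector by a factor of at least 4. Its
  resolvent is then so large that a gain below 1 is possible, giving a storage function that is at
  least the squared norm and at most half of it.\<close>

lemma eigenvalues_cmat_nonempty:
  fixes M :: "real^'n^'n"
  shows "eigenvalues (cmat M) \<noteq> {}"
proof
  assume empty: "eigenvalues (cmat M) = {}"
  have none: "a = 0 \<and> b = 0" if "M *v a = u *\<^sub>R a - v *\<^sub>R b" "M *v b = v *\<^sub>R a + u *\<^sub>R b" for a b u v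
    using empty that eigenvalues_cmat_iff[of "Complex u v" M] by auto
  have "inj ((*v) M)"
    unfolding linear_injective_0[OF matrix_vector_mul_linear] using none[of _ 0 0 0] by auto
  then obtain m where m: "m > 0" "\<And>x. m * norm x \<le> norm (M *v x)"
    using linear_inj_bounded_below_pos[OF matrix_vector_mul_linear] by blast
  \<comment> \<open>Makes \<open>norm (N *v x) \<ge> 4 * norm x\<close>, enough for the gain 1/2 in
    \<open>H\<close>.\<close>
  define r where "r = m / 4"
  have r: "r > 0" using m by (simp add: r_def)
  define N where "N = (1/r) *\<^sub>R M"
  have "schur_stable N"
    unfolding schur_stable_def
  proof (intro allI impI)
    fix \<rho> :: real and \<theta> a b
    assume "N *v a = \<rho> *\<^sub>R (cos \<theta> *\<^sub>R a - sin \<theta> *\<^sub>R b)" "N *v b = \<rho> *\<^sub>R (sin \<theta> *\<^sub>R a + cos \<theta> *\<^sub>R b)"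
    then have "r *\<^sub>R (N *v a) = r *\<^sub>R \<rho> *\<^sub>R (cos \<theta> *\<^sub>R a - sin \<theta> *\<^sub>R b)" "r *\<^sub>R (N *v b) = r *\<^sub>R \<rho> *\<^sub>R (sin \<theta> *\<^sub>R a + cos \<theta> *\<^sub>R b)"
      by auto
    then have "M *v a = (r * \<rho> * cos \<theta>) *\<^sub>R a - (r * \<rho> * sin \<theta>) *\<^sub>R b"
       "M *v b = (r * \<rho> * sin \<theta>) *\<^sub>R a + (r * \<rho> * cos \<theta>) *\<^sub>R b"
      using r by (simp_all add: N_def scaleR_matrix_vector_assoc[symmetric] scaleR_diff_right scaleR_add_right mult.assoc)
    then show "a = 0 \<and> b = 0" by (rule none)
  qed
  note lim = stable_imp_powers_tendsto_0[OF this]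
  have H: "(norm a)\<^sup>2 + (norm b)\<^sup>2 \<le> (1/2) * resolvent_sq N \<theta> a b" for \<theta> a b
  proof -
    define p q where "p = cos \<theta> *\<^sub>R a - sin \<theta> *\<^sub>R b" and "q = sin \<theta> *\<^sub>R a + cos \<theta> *\<^sub>R b"
    have pq: "(norm p)\<^sup>2 + (norm q)\<^sup>2 = (norm a)\<^sup>2 + (norm b)\<^sup>2"
      unfolding p_def q_def norm_rotation by simp
    have low: "16 * (norm x)\<^sup>2 \<le> 2 * (norm (y - N *v x))\<^sup>2 + 2 * (norm y)\<^sup>2" for x y
    proof -
      have "4 * norm x \<le> norm (N *v x)" using m(2)[of x] r
        by (simp add: N_def r_def scaleR_matrix_vector_assoc[symmetric] field_simps)
      also have "\<dots> \<le> norm (y - N *v x) + norm y" using norm_triangle_ineq4[of y "y - N *v x"] by simp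
      finally have "(4 * norm x)\<^sup>2 \<le> (norm (y - N *v x) + norm y)\<^sup>2" by (rule power_mono) simp
      also have "\<dots> \<le> 2 * (norm (y - N *v x))\<^sup>2 + 2 * (norm y)\<^sup>2"
        using sum_squares_bound[of "norm (y - N *v x)" "norm y"] by (simp add: power2_sum)
      finally show ?thesis by (simp add: power_mult_distrib)
    qed
    have "resolvent_sq N \<theta> a b = (norm (p - N *v a))\<^sup>2 + (norm (q - N *v b))\<^sup>2" by (simp add: resolvent_sq_def p_def q_def)
    then show ?thesis using low[of a p] low[of b q] pq by (simp add: sum_power2_ge_zero) (smt (verit) zero_le_power2)
  qed
  obtain P where P: "\<And>x y. y \<bullet> (P *v y) + x \<bullet> (mat 1 *v x) \<le> x \<bullet> (P *v x) + (1/2) * (norm (y - N *v x))\<^sup>2"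
     "\<And>x. 0 \<le> x \<bullet> (P *v x)"
    by (rule bounded_real_lemma[OF lim, of "mat 1" "1/2"]) (use H in \<open>auto simp: power2_norm_eq_inner\<close>)
  obtain x :: "real^'n" where x: "norm x = 1" using vector_choose_size[of 1] by auto
  have "(norm x)\<^sup>2 \<le> (1/2) * (norm x)\<^sup>2"
    using storage_bounds[OF P(1), of x] P(2)[of "N *v x"] by (simp add: power2_norm_eq_inner)
  then show False using x by simp
qed

text \<open>On an eigenvector a + i b the form of \<open>P\<close> is multiplied by the squared
  modulus of the eigenvalue, so every modulus is at most \<open>sqrt t\<close>. Existence of an
  eigenvalue transfers this bound to the supremum.\<close>

lemma lyapunov_imp_spectral_radius_less_1:
  fixes M P :: "real^'n^'n"
  assumes sym: "transpose P = P" and pos: "\<And>x. x \<noteq> 0 \<Longrightarrow> 0 < x \<bullet> (P *v x)"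
    and t: "0 \<le> t" "t < 1" and dec: "\<And>x. (M *v x) \<bullet> (P *v (M *v x)) \<le> t * (x \<bullet> (P *v x))"
  shows "spectral_radius M < 1"
proof -
  have nn: "0 \<le> x \<bullet> (P *v x)" for x using pos[of x] by (cases "x = 0") auto
  have "cmod z \<le> sqrt t" if z: "z \<in> eigenvalues (cmat M)" for z
  proof -
    obtain a b where ab: "a \<noteq> 0 \<or> b \<noteq> 0" "M *v a = Re z *\<^sub>R a - Im z *\<^sub>R b" "M *v b = Im z *\<^sub>R a + Re z *\<^sub>R b"
      using z eigenvalues_cmat_iff by blast
    have sw: "a \<bullet> (P *v b) = b \<bullet> (P *v a)"
      using sym unfolding transpose_eq_self_iff by (metis inner_commute)
    have E: "a \<bullet> (P *v a) + b \<bullet> (P *v b) > 0" using ab(1) pos nn by (metis add_nonneg_pos add_pos_nonneg)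
    have "(cmod z)\<^sup>2 * (a \<bullet> (P *v a) + b \<bullet> (P *v b))
      = (M *v a) \<bullet> (P *v (M *v a)) + (M *v b) \<bullet> (P *v (M *v b))"
      unfolding ab(2,3) cmod_power2
      by (simp add: sw matrix_vector_mult_scaleR matrix_vector_right_distrib matrix_vector_mult_diff_distrib
          inner_simps power2_eq_square algebra_simps)
    also have "\<dots> \<le> t * (a \<bullet> (P *v a) + b \<bullet> (P *v b))" using dec[of a] dec[of b] by (simp add: distrib_left)
    finally have "(cmod z)\<^sup>2 \<le> t" using E by simp
    then show ?thesis by (simp add: real_le_rsqrt)
  qed
  then have "spectral_radius M \<le> sqrt t"
    unfolding spectral_radius_def using eigenvalues_cmat_nonempty by (intro cSup_least) auto
  also have "\<dots> < 1" using t by simp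
  finally show ?thesis .
qed

subsection \<open>The frequency-domain norm\<close>

text \<open>The inner product is the real part of the Hermitian one. A maximiser \<open>v\<close> of
  the form on the unit sphere is an eigenvector because the first variation \<open>w\<close>
  vanishes there, and no real eigenvalue exceeds the maximum.\<close>

lemma lambda_max_variational:
  fixes H :: "complex^'n^'n"
  assumes sa: "\<And>x y. x \<bullet> (H *v y) = (H *v x) \<bullet> y"
  shows "x \<bullet> (H *v x) \<le> lambda_max H * (norm x)\<^sup>2"
    and "\<exists>v. v \<noteq> 0 \<and> v \<bullet> (H *v v) = lambda_max H * (norm v)\<^sup>2"
proof -
  have lin: "linear ((*v) H)" by simp
  have "sphere (0::complex^'n) 1 \<noteq> {}"
    using vector_choose_size[of 1] by (metis dist_0_norm empty_iff mem_sphere zero_le_one)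
  moreover have "continuous_on (sphere (0::complex^'n) 1) (\<lambda>x. x \<bullet> (H *v x))"
    by (intro continuous_intros linear_continuous_on linear_conv_bounded_linear[THEN iffD1] lin)
  ultimately obtain v where v: "norm v = 1" and vmax: "\<And>x. norm x = 1 \<Longrightarrow> x \<bullet> (H *v x) \<le> v \<bullet> (H *v v)"
    using continuous_attains_sup[of "sphere (0::complex^'n) 1" "\<lambda>x. x \<bullet> (H *v x)"] by auto
  define m where "m = v \<bullet> (H *v v)"
  have le: "x \<bullet> (H *v x) \<le> m * (norm x)\<^sup>2" for x
  proof (cases "x = 0")
    case False
    define u where "u = (1 / norm x) *\<^sub>R x"
    have "norm u = 1" using False by (simp add: u_def)
    moreover have "x = norm x *\<^sub>R u" using False by (simp add: u_def)
    then have "x \<bullet> (H *v x) = (norm x)\<^sup>2 * (u \<bullet> (H *v u))"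
      by (metis inner_scaleR_left inner_scaleR_right linear_scale[OF lin] mult.assoc power2_eq_square)
    ultimately show ?thesis using vmax[of u] by (simp add: m_def mult.commute mult_right_mono)
  qed simp
  obtain C where C: "C > 0" "\<And>x. norm (H *v x) \<le> C * norm x" using linear_bounded_pos[OF lin] by blast
  define w where "w = H *v v - m *\<^sub>R v"
  have "w = 0"
  proof (rule inner_le_quadratic_imp_zero)
    show "(0::real) < 1" by simp
    fix h
    have "(v + h) \<bullet> (H *v (v + h)) = m + 2 * ((H *v v) \<bullet> h) + h \<bullet> (H *v h)"
      using sa[of v h] by (simp add: linear_add[OF lin] inner_simps m_def inner_commute)
    moreover have "(norm (v + h))\<^sup>2 = 1 + 2 * (v \<bullet> h) + (norm h)\<^sup>2"
      using v by (simp add: power2_norm_eq_inner inner_simps inner_commute norm_eq_1)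
    ultimately have "2 * ((H *v v) \<bullet> h) + h \<bullet> (H *v h) \<le> m * (2 * (v \<bullet> h)) + m * (norm h)\<^sup>2"
      using le[of "v + h"] by (simp add: algebra_simps)
    moreover have "\<bar>h \<bullet> (H *v h)\<bar> \<le> C * (norm h)\<^sup>2"
    proof -
      have "\<bar>h \<bullet> (H *v h)\<bar> \<le> norm h * norm (H *v h)" by (rule Cauchy_Schwarz_ineq2)
      also have "\<dots> \<le> norm h * (C * norm h)" by (intro mult_left_mono C) simp
      finally show ?thesis by (simp add: power2_eq_square mult.left_commute)
    qed
    ultimately show "w \<bullet> h \<le> ((m + C) / 2) * (norm h)\<^sup>2"
      by (simp add: w_def inner_diff_left algebra_simps)
  qed
  then have Hv: "H *v v = m *\<^sub>R v" by (simp add: w_def)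
  have sc: "complex_of_real r *s x = r *\<^sub>R x" for r and x :: "complex^'n"
    by (simp add: vec_eq_iff complex_eq_iff)
  have "lambda_max H = m"
    unfolding lambda_max_def
  proof (rule cSup_eq_maximum)
    have "v \<noteq> 0" using v by auto
    then show "m \<in> {r. complex_of_real r \<in> eigenvalues H}" using Hv sc by (auto simp: eigenvalues_def)
    fix r assume "r \<in> {r. complex_of_real r \<in> eigenvalues H}"
    then obtain x where x: "x \<noteq> 0" "H *v x = r *\<^sub>R x" by (auto simp: eigenvalues_def sc)
    have "r * (norm x)\<^sup>2 \<le> m * (norm x)\<^sup>2" using le[of x] by (simp add: x power2_norm_eq_inner)
    then show "r \<le> m" using x by simp
  qed
  then show "x \<bullet> (H *v x) \<le> lambda_max H * (norm x)\<^sup>2"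
    "\<exists>v. v \<noteq> 0 \<and> v \<bullet> (H *v v) = lambda_max H * (norm v)\<^sup>2"
    using le v by (auto intro!: exI[of _ v] simp: m_def)
qed

definition freq_matrix :: "real^'n^'n \<Rightarrow> real^'n^'n \<Rightarrow> real \<Rightarrow> complex^'n^'n" where
  "freq_matrix M S \<omega> = transpose (matrix_inv (mat (cis (-\<omega>)) - cmat M)) ** cmat S
     ** matrix_inv (mat (cis \<omega>) - cmat M)"

definition hinf_norm :: "real^'n^'n \<Rightarrow> real^'n^'n \<Rightarrow> real" where
  "hinf_norm M S = (SUP \<omega>\<in>{0..2*pi}. sqrt (lambda_max (freq_matrix M S \<omega>)))"

lemma Jcost_eq_hinf_norm:
  "Jcost A B Q R K = hinf_norm (A - B ** K) (Q + transpose K ** R ** K)"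
proof -
  have "mat z - cmat A + cmat (B ** K) = mat z - cmat (A - B ** K)" for z
    by (simp add: cmat_def vec_eq_iff)
  then show ?thesis by (simp only: Jcost_def hinf_norm_def freq_matrix_def)
qed

lemma mat_mult_cvec: "mat z *v v = z *s (v :: complex^'n)"
proof -
  have "(\<Sum>j\<in>UNIV. (if i = j then z else 0) * v $ j) = z * v $ i" for i
    by (simp add: if_distrib[of "\<lambda>c. c * _"] cong: if_cong)
  then show ?thesis by (simp add: mat_def matrix_vector_mult_def vec_eq_iff)
qed

lemma resolvent_mult_cvec:
  "(mat (cis \<omega>) - cmat M) *v cvec a b
    = cvec (cos \<omega> *\<^sub>R a - sin \<omega> *\<^sub>R b - M *v a) (sin \<omega> *\<^sub>R a + cos \<omega> *\<^sub>R b - M *v b)"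
  by (simp add: matrix_vector_mult_diff_rdistrib mat_mult_cvec cvec_scalar cmat_mult_cvec cvec_diff)

lemma norm_resolvent_mult_cvec: "(norm ((mat (cis \<omega>) - cmat M) *v cvec a b))\<^sup>2 = resolvent_sq M \<omega> a b"
  by (simp add: resolvent_mult_cvec power2_norm_eq_inner inner_cvec resolvent_sq_def)

text \<open>As \<open>M\<close> is real, the plain transpose at \<open>-\<omega>\<close> is the
  conjugate transpose at \<open>\<omega>\<close>.\<close>

lemma transpose_resolvent_adjoint:
  "((mat (cis \<omega>) - cmat M) *v x) \<bullet> y = x \<bullet> (transpose (mat (cis (-\<omega>)) - cmat M) *v y)"
proof -
  obtain a b where x: "x = cvec a b" using cvec_exhaust by blast
  obtain c d where y: "y = cvec c d" using cvec_exhaust by blast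
  have tr: "transpose (mat (cis (-\<omega>)) - cmat M) = mat (cis (-\<omega>)) - cmat (transpose M)"
    by (simp add: transpose_def cmat_def mat_def vec_eq_iff)
  have adj: "u \<bullet> (transpose M *v v) = (M *v u) \<bullet> v" for u v
    by (metis dot_lmul_matrix transpose_matrix_vector transpose_transpose)
  show ?thesis unfolding x y tr resolvent_mult_cvec inner_cvec
    by (simp add: inner_diff_right adj del: transpose_matrix_vector) (simp add: inner_simps algebra_simps)
qed

lemma stable_resolvent_invertible:
  assumes "schur_stable M"
  shows "invertible (mat (cis \<omega>) - cmat M)"
proof -
  have "inj ((*v) (mat (cis \<omega>) - cmat M))"
    unfolding linear_injective_0[OF matrix_vector_mul_linear]
  proof (intro allI impI)
    fix v assume v: "(mat (cis \<omega>) - cmat M) *v v = 0"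
    obtain a b where ab: "v = cvec a b" using cvec_exhaust by blast
    have "resolvent_sq M \<omega> a b = 0" using v norm_resolvent_mult_cvec[of \<omega> M a b] by (simp add: ab)
    then show "v = 0" using resolvent_sq_eq_0_imp_zero[OF assms, of 1 \<omega> a b] by (simp add: ab cvec_eq_0_iff)
  qed
  then show ?thesis by (meson invertible_left_inverse matrix_left_invertible_injective)
qed

lemma invertible_matrix_inv:
  assumes "invertible A"
  shows "A ** matrix_inv A = mat 1" "matrix_inv A ** A = mat 1"
  using someI_ex[OF assms[unfolded invertible_def]] by (simp_all add: matrix_inv_def)

text \<open>The frequency matrix is thus \<open>S\<close> conjugated by the inverse resolvent, and
  Hermitian for symmetric \<open>S\<close> although it is written with a plain transpose.\<close>

lemma freq_matrix_inner:
  assumes "schur_stable M"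
  shows "x \<bullet> (freq_matrix M S \<omega> *v y) = (matrix_inv (mat (cis \<omega>) - cmat M) *v x)
     \<bullet> (cmat S *v (matrix_inv (mat (cis \<omega>) - cmat M) *v y))"
proof -
  define N where "N = mat (cis \<omega>) - cmat M"
  define X where "X = mat (cis (-\<omega>)) - cmat M"
  have inv: "N ** matrix_inv N = mat 1" "X ** matrix_inv X = mat 1" "matrix_inv X ** X = mat 1"
    using stable_resolvent_invertible[OF assms] by (auto simp: N_def X_def invertible_matrix_inv)
  define z where "z = cmat S *v (matrix_inv N *v y)"
  define u where "u = transpose (matrix_inv X) *v z"
  have "transpose X *v u = (transpose X ** transpose (matrix_inv X)) *v z"
    unfolding u_def by (rule matrix_vector_mul_assoc)
  also have "\<dots> = z" by (simp only: matrix_transpose_mul[symmetric] inv transpose_mat matrix_vector_mul_lid)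
  finally have Xu: "transpose X *v u = z" .
  have "(matrix_inv N *v x) \<bullet> z = (N *v (matrix_inv N *v x)) \<bullet> u"
    unfolding Xu[symmetric] N_def X_def by (rule transpose_resolvent_adjoint[symmetric])
  also have "\<dots> = x \<bullet> u" by (simp add: matrix_vector_mul_assoc inv)
  finally show ?thesis
    unfolding freq_matrix_def N_def[symmetric] X_def[symmetric]
    by (simp add: z_def u_def matrix_vector_mul_assoc[symmetric] del: transpose_matrix_vector)
qed

text \<open>Taking the test vector to be the resolvent factor applied to a + i b cancels the
  inverse: the Rayleigh quotient becomes the form of \<open>S\<close> over
  \<open>resolvent_sq\<close>.\<close>

lemma lambda_max_freq_matrix:
  assumes st: "schur_stable M" and sym: "transpose S = S"
  shows "a \<bullet> (S *v a) + b \<bullet> (S *v b) \<le> lambda_max (freq_matrix M S \<omega>) * resolvent_sq M \<omega> a b"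
    and "\<exists>a b. resolvent_sq M \<omega> a b > 0 \<and> a \<bullet> (S *v a) + b \<bullet> (S *v b) = lambda_max (freq_matrix M S \<omega>) * resolvent_sq M \<omega> a b"
proof -
  define N where "N = mat (cis \<omega>) - cmat M"
  have invN: "matrix_inv N ** N = mat 1" "N ** matrix_inv N = mat 1"
    using stable_resolvent_invertible[OF st] by (auto simp: N_def invertible_matrix_inv)
  have S_sym: "x \<bullet> (cmat S *v y) = (cmat S *v x) \<bullet> y" for x y
  proof -
    obtain a b where x: "x = cvec a b" using cvec_exhaust by blast
    obtain c d where y: "y = cvec c d" using cvec_exhaust by blast
    show ?thesis using sym unfolding transpose_eq_self_iff by (simp add: x y cmat_mult_cvec inner_cvec)
  qed
  note fi = freq_matrix_inner[OF st, of _ S \<omega>, folded N_def]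
  have "x \<bullet> (freq_matrix M S \<omega> *v y) = (freq_matrix M S \<omega> *v x) \<bullet> y" for x y
    using fi[of x y] fi[of y x] S_sym by (metis inner_commute)
  note var = lambda_max_variational[OF this]
  have form: "(N *v cvec a b) \<bullet> (freq_matrix M S \<omega> *v (N *v cvec a b)) = a \<bullet> (S *v a) + b \<bullet> (S *v b)" for a b
  proof -
    have "matrix_inv N *v (N *v v) = v" for v by (simp add: matrix_vector_mul_assoc invN)
    then show ?thesis by (simp only: fi cmat_mult_cvec inner_cvec)
  qed
  show "a \<bullet> (S *v a) + b \<bullet> (S *v b) \<le> lambda_max (freq_matrix M S \<omega>) * resolvent_sq M \<omega> a b"
    using var(1)[of "N *v cvec a b"] by (simp add: form) (simp add: N_def norm_resolvent_mult_cvec)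
  obtain v where v: "v \<noteq> 0" "v \<bullet> (freq_matrix M S \<omega> *v v) = lambda_max (freq_matrix M S \<omega>) * (norm v)\<^sup>2"
    using var(2) by blast
  obtain a b where ab: "matrix_inv N *v v = cvec a b" using cvec_exhaust by blast
  have "N *v cvec a b = v" unfolding ab[symmetric] by (simp add: matrix_vector_mul_assoc invN)
  moreover from this have "resolvent_sq M \<omega> a b = (norm v)\<^sup>2" using norm_resolvent_mult_cvec[of \<omega> M a b] by (simp add: N_def)
  ultimately show "\<exists>a b. resolvent_sq M \<omega> a b > 0 \<and> a \<bullet> (S *v a) + b \<bullet> (S *v b) = lambda_max (freq_matrix M S \<omega>) * resolvent_sq M \<omega> a b"
    using v form[of a b] by (intro exI[of _ a] exI[of _ b]) simp
qed

lemma matrix_quadratic_form_bound: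
  fixes S :: "real^'n^'n"
  obtains K where "K > 0" "\<And>x. \<bar>x \<bullet> (S *v x)\<bar> \<le> K * (norm x)\<^sup>2"
proof -
  obtain K where K: "K > 0" "\<And>x. norm (S *v x) \<le> K * norm x" using matrix_vector_mult_norm_bound by blast
  have "\<bar>x \<bullet> (S *v x)\<bar> \<le> K * (norm x)\<^sup>2" for x
  proof -
    have "\<bar>x \<bullet> (S *v x)\<bar> \<le> norm x * norm (S *v x)" by (rule Cauchy_Schwarz_ineq2)
    also have "\<dots> \<le> norm x * (K * norm x)" by (intro mult_left_mono K) simp
    finally show ?thesis by (simp add: power2_eq_square mult.left_commute)
  qed
  then show ?thesis using that K by blast
qed

context
  fixes M S :: "real^'n^'n"
  assumes st: "schur_stable M" and sym: "transpose S = S" and psd: "\<And>x. 0 \<le> x \<bullet> (S *v x)"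
begin

lemma stable_resolvent_sq_lower_bound:
  obtains d where "d > 0" "\<And>\<theta> a b. d * ((norm a)\<^sup>2 + (norm b)\<^sup>2) \<le> resolvent_sq M \<theta> a b"
  using resolvent_sq_uniform_lower_bound[of "{0::nat}" "\<lambda>_. M"] resolvent_sq_eq_0_imp_zero[OF st, of 1]
  by (metis compact_insert compact_empty continuous_on_const insertI1 order_refl scaleR_one zero_le_one)

lemma freq_lambda_max_nonneg: "0 \<le> lambda_max (freq_matrix M S \<omega>)"
proof -
  obtain a b where "resolvent_sq M \<omega> a b > 0" "a \<bullet> (S *v a) + b \<bullet> (S *v b) = lambda_max (freq_matrix M S \<omega>) * resolvent_sq M \<omega> a b"
    using lambda_max_freq_matrix(2)[OF st sym] by blast
  then show ?thesis using psd[of a] psd[of b] by (metis add_nonneg_nonneg linorder_not_le mult_neg_pos)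
qed

lemma freq_lambda_max_le:
  assumes "\<And>\<theta> a b. a \<bullet> (S *v a) + b \<bullet> (S *v b) \<le> g * resolvent_sq M \<theta> a b"
  shows "lambda_max (freq_matrix M S \<omega>) \<le> g"
proof -
  obtain a b where "resolvent_sq M \<omega> a b > 0" "a \<bullet> (S *v a) + b \<bullet> (S *v b) = lambda_max (freq_matrix M S \<omega>) * resolvent_sq M \<omega> a b"
    using lambda_max_freq_matrix(2)[OF st sym] by blast
  then show ?thesis using assms[of a b \<omega>] by simp
qed

lemma hinf_norm_le:
  assumes "\<And>\<theta> a b. a \<bullet> (S *v a) + b \<bullet> (S *v b) \<le> g * resolvent_sq M \<theta> a b"
  shows "hinf_norm M S \<le> sqrt g"
  unfolding hinf_norm_def
  by (rule cSUP_least) (use freq_lambda_max_le[OF assms] in auto)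

text \<open>The resolvent bound makes the supremum finite, so it dominates every frequency in the
  interval; other angles are reduced by periodicity.\<close>

lemma hinf_norm_bound:
  shows "0 \<le> hinf_norm M S"
    and "a \<bullet> (S *v a) + b \<bullet> (S *v b) \<le> (hinf_norm M S)\<^sup>2 * resolvent_sq M \<theta> a b"
proof -
  obtain d where d: "d > 0" "\<And>\<theta> a b. d * ((norm a)\<^sup>2 + (norm b)\<^sup>2) \<le> resolvent_sq M \<theta> a b"
    using stable_resolvent_sq_lower_bound by blast
  obtain K where K: "K > 0" "\<And>x. \<bar>x \<bullet> (S *v x)\<bar> \<le> K * (norm x)\<^sup>2" using matrix_quadratic_form_bound by blast
  have "a \<bullet> (S *v a) + b \<bullet> (S *v b) \<le> (K / d) * resolvent_sq M \<theta> a b" for a b \<theta>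
  proof -
    have "a \<bullet> (S *v a) + b \<bullet> (S *v b) \<le> K * ((norm a)\<^sup>2 + (norm b)\<^sup>2)"
      using K(2)[of a] K(2)[of b] by (simp add: distrib_left)
    also have "\<dots> = (K / d) * (d * ((norm a)\<^sup>2 + (norm b)\<^sup>2))" using d by simp
    also have "\<dots> \<le> (K / d) * resolvent_sq M \<theta> a b" using d K by (intro mult_left_mono) auto
    finally show ?thesis .
  qed
  then have "lambda_max (freq_matrix M S \<omega>) \<le> K / d" for \<omega> by (rule freq_lambda_max_le)
  then have bdd: "bdd_above ((\<lambda>\<omega>. sqrt (lambda_max (freq_matrix M S \<omega>))) ` {0..2*pi})"
    by (intro bdd_aboveI[of _ "sqrt (K / d)"]) auto
  have up: "sqrt (lambda_max (freq_matrix M S \<omega>)) \<le> hinf_norm M S" if "\<omega> \<in> {0..2*pi}" for \<omega>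
    unfolding hinf_norm_def by (rule cSUP_upper[OF that bdd])
  show nn: "0 \<le> hinf_norm M S"
    using up[of 0] freq_lambda_max_nonneg[of 0] by (metis atLeastAtMost_iff order_refl order_trans pi_ge_zero
        real_sqrt_ge_zero zero_le_mult_iff zero_le_numeral)
  obtain \<omega> where \<omega>: "0 \<le> \<omega>" "\<omega> < 2 * pi" "cos \<theta> = cos \<omega>" "sin \<theta> = sin \<omega>"
    using sincos_total_2pi[of "cos \<theta>" "sin \<theta>"] by (metis sin_cos_squared_add2)
  have "lambda_max (freq_matrix M S \<omega>) \<le> (hinf_norm M S)\<^sup>2"
    using up[of \<omega>] \<omega> nn by (simp add: sqrt_le_D)
  then have "lambda_max (freq_matrix M S \<omega>) * resolvent_sq M \<omega> a b \<le> (hinf_norm M S)\<^sup>2 * resolvent_sq M \<omega> a b"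
    by (intro mult_right_mono resolvent_sq_nonneg)
  moreover have "resolvent_sq M \<theta> a b = resolvent_sq M \<omega> a b" by (simp add: resolvent_sq_def \<omega>)
  ultimately show "a \<bullet> (S *v a) + b \<bullet> (S *v b) \<le> (hinf_norm M S)\<^sup>2 * resolvent_sq M \<theta> a b"
    using lambda_max_freq_matrix(1)[OF st sym, of a b \<omega>] by simp
qed

text \<open>The maximum \<open>g\<close> of the Rayleigh quotient exists by compactness and equals
  the squared norm. A maximiser is the datum from which the support of the cost is built.\<close>

lemma hinf_norm_attained:
  obtains \<theta> a b where "(norm a)\<^sup>2 + (norm b)\<^sup>2 = 1"
    "a \<bullet> (S *v a) + b \<bullet> (S *v b) = (hinf_norm M S)\<^sup>2 * resolvent_sq M \<theta> a b"
proof -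
  obtain d where d: "d > 0" "\<And>\<theta> a b. d * ((norm a)\<^sup>2 + (norm b)\<^sup>2) \<le> resolvent_sq M \<theta> a b"
    using stable_resolvent_sq_lower_bound by blast
  define N D where "N = (\<lambda>((c::real, s::real), (a, b)). a \<bullet> (S *v a) + b \<bullet> (S *v b))"
    and "D = (\<lambda>((c, s), (a, b)). (norm (c *\<^sub>R a - s *\<^sub>R b - M *v a))\<^sup>2
     + (norm (s *\<^sub>R a + c *\<^sub>R b - M *v b))\<^sup>2)"
  have Dr: "D ((cos \<theta>, sin \<theta>), (a, b)) = resolvent_sq M \<theta> a b" for \<theta> a b by (simp add: D_def resolvent_sq_def)
  let ?S = "sphere (0 :: real \<times> real) 1 \<times> sphere (0 :: (real^'n) \<times> (real^'n)) 1"
  have Spos: "D p > 0" if "p \<in> ?S" for p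
  proof -
    obtain c s a b where p: "p = ((c, s), (a, b))" by (metis prod.collapse)
    have cs: "c\<^sup>2 + s\<^sup>2 = 1" and ab: "(norm a)\<^sup>2 + (norm b)\<^sup>2 = 1" using that by (auto simp: p norm_Pair)
    obtain \<theta> where "c = cos \<theta>" "s = sin \<theta>" using sincos_total_2pi[OF cs] by metis
    then show ?thesis using d(2)[of a b \<theta>] d(1) ab by (simp add: p Dr)
  qed
  have "compact ?S" by (intro compact_Times compact_sphere)
  moreover have "sphere (0 :: real \<times> real) 1 \<noteq> {}" "sphere (0 :: (real^'n) \<times> (real^'n)) 1 \<noteq> {}"
    using vector_choose_size[of 1] by (metis dist_0_norm empty_iff mem_sphere zero_le_one)+
  then have "?S \<noteq> {}" by blast
  moreover have "continuous_on ?S (\<lambda>p. N p / D p)"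
  proof (intro continuous_on_divide ballI)
    show "continuous_on ?S N" "continuous_on ?S D"
      unfolding N_def D_def case_prod_beta by (intro continuous_intros)+
  qed (use Spos in force)
  ultimately obtain p where p: "p \<in> ?S" "\<And>q. q \<in> ?S \<Longrightarrow> N q / D q \<le> N p / D p"
    using continuous_attains_sup[of ?S "\<lambda>p. N p / D p"] by blast
  obtain c s a b where peq: "p = ((c, s), (a, b))" by (metis prod.collapse)
  have cs: "c\<^sup>2 + s\<^sup>2 = 1" and ab: "(norm a)\<^sup>2 + (norm b)\<^sup>2 = 1" using p(1) by (auto simp: peq norm_Pair)
  obtain \<theta> where \<theta>: "c = cos \<theta>" "s = sin \<theta>" using sincos_total_2pi[OF cs] by metis
  define g where "g = N p / D p"
  have Dp: "D p > 0" by (rule Spos[OF p(1)])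
  have Np: "N p = g * D p" using Dp by (simp add: g_def)
  have g0: "g \<ge> 0" using Dp psd[of a] psd[of b] by (simp add: g_def N_def peq)
  have all: "a \<bullet> (S *v a) + b \<bullet> (S *v b) \<le> g * resolvent_sq M \<theta> a b" for a b \<theta>
  proof (cases "a = 0 \<and> b = 0")
    case True then show ?thesis using g0 by (simp add: resolvent_sq_nonneg)
  next
    case False
    define l where "l = norm (a, b)"
    have l: "l > 0" using False by (auto simp: l_def norm_Pair sum_power2_gt_zero_iff)
    define q where "q = ((cos \<theta>, sin \<theta>), ((1/l) *\<^sub>R a, (1/l) *\<^sub>R b))"
    have "norm ((1/l) *\<^sub>R (a, b)) = 1" unfolding norm_scaleR l_def[symmetric] using l by simp
    then have q: "q \<in> ?S" by (simp add: q_def norm_Pair)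
    have Dq: "D q = (1/l)\<^sup>2 * resolvent_sq M \<theta> a b"
    proof -
      have "cos \<theta> *\<^sub>R (1/l) *\<^sub>R a - sin \<theta> *\<^sub>R (1/l) *\<^sub>R b - M *v (1/l) *\<^sub>R a
          = (1/l) *\<^sub>R (cos \<theta> *\<^sub>R a - sin \<theta> *\<^sub>R b - M *v a)"
        "sin \<theta> *\<^sub>R (1/l) *\<^sub>R a + cos \<theta> *\<^sub>R (1/l) *\<^sub>R b - M *v (1/l) *\<^sub>R b
          = (1/l) *\<^sub>R (sin \<theta> *\<^sub>R a + cos \<theta> *\<^sub>R b - M *v b)"
        by (simp_all add: matrix_vector_mult_scaleR scaleR_diff_right scaleR_add_right)
      then show ?thesis unfolding q_def Dr resolvent_sq_def
        by (simp add: power_mult_distrib power_divide distrib_left add_divide_distrib)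
    qed
    have Nq: "N q = (1/l)\<^sup>2 * (a \<bullet> (S *v a) + b \<bullet> (S *v b))"
      by (simp add: N_def q_def matrix_vector_mult_scaleR power2_eq_square add_divide_distrib)
    have "N q \<le> g * D q" using p(2)[OF q] Spos[OF q] by (simp add: g_def pos_divide_le_eq)
    then have "(1/l)\<^sup>2 * (a \<bullet> (S *v a) + b \<bullet> (S *v b)) \<le> (1/l)\<^sup>2 * (g * resolvent_sq M \<theta> a b)"
      by (simp only: Nq Dq mult.left_commute)
    then show ?thesis using l by (simp only: mult_le_cancel_left_pos zero_less_power zero_less_divide_1_iff)
  qed
  have "(hinf_norm M S)\<^sup>2 \<le> g"
    using hinf_norm_le[OF all] hinf_norm_bound(1) g0 by (metis power_mono real_sqrt_pow2)
  moreover have "g * D p \<le> (hinf_norm M S)\<^sup>2 * D p"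
    using hinf_norm_bound(2)[of a b \<theta>] Np by (simp add: peq N_def Dr \<theta>)
  then have "g \<le> (hinf_norm M S)\<^sup>2" using Dp by simp
  ultimately have "g = (hinf_norm M S)\<^sup>2" by simp
  then show ?thesis using that[of a b \<theta>] ab Np by (simp add: peq N_def Dr \<theta>)
qed

end

subsection \<open>Dissipation certificates\<close>

lemma sym_pos_def_lower_bound:
  fixes Q :: "real^'n^'n"
  assumes "sym_pos_def Q"
  obtains q where "q > 0" "\<And>x. q * (norm x)\<^sup>2 \<le> x \<bullet> (Q *v x)"
proof -
  have "sphere (0::real^'n) 1 \<noteq> {}"
    using vector_choose_size[of 1] by (metis dist_0_norm empty_iff mem_sphere zero_le_one)
  moreover have "continuous_on (sphere (0::real^'n) 1) (\<lambda>x. x \<bullet> (Q *v x))"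
    by (intro continuous_intros)
  ultimately obtain v where v: "norm v = 1" and vmin: "\<And>x. norm x = 1 \<Longrightarrow> v \<bullet> (Q *v v) \<le> x \<bullet> (Q *v x)"
    using continuous_attains_inf[of "sphere (0::real^'n) 1" "\<lambda>x. x \<bullet> (Q *v x)"] by auto
  define m where "m = v \<bullet> (Q *v v)"
  have "v \<noteq> 0" using v by auto
  then have "m > 0" using assms by (simp add: sym_pos_def_def m_def)
  moreover have "m * (norm x)\<^sup>2 \<le> x \<bullet> (Q *v x)" for x
  proof (cases "x = 0")
    case False
    define u where "u = (1 / norm x) *\<^sub>R x"
    have "norm u = 1" using False by (simp add: u_def)
    moreover have "x = norm x *\<^sub>R u" using False by (simp add: u_def)
    then have "x \<bullet> (Q *v x) = (norm x)\<^sup>2 * (u \<bullet> (Q *v u))"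
      by (metis inner_scaleR_left inner_scaleR_right matrix_vector_mult_scaleR mult.assoc power2_eq_square)
    ultimately show ?thesis using vmin[of u] by (simp add: m_def mult.commute mult_right_mono)
  qed simp
  ultimately show ?thesis using that by blast
qed

text \<open>A crude entrywise bound; its applications need only some finite constant.\<close>

lemma norm_matrix_le:
  fixes M :: "real^'n^'m"
  assumes "\<And>x. norm (M *v x) \<le> c * norm x"
  shows "norm M \<le> real CARD('m) * (real CARD('n) * c)"
proof -
  have comp: "\<bar>M $ i $ j\<bar> \<le> c" for i j
  proof -
    have "\<bar>M $ i $ j\<bar> = \<bar>(M *v axis j 1) $ i\<bar>" by (simp add: matrix_vector_mult_basis column_def)
    also have "\<dots> \<le> norm (M *v axis j 1)" by (rule component_le_norm_cart)
    also have "\<dots> \<le> c" using assms[of "axis j 1"] by simp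
    finally show ?thesis .
  qed
  have "norm M \<le> (\<Sum>i\<in>UNIV. norm (M $ i))" unfolding norm_vec_def by (rule L2_set_le_sum) simp
  also have "\<dots> \<le> (\<Sum>i\<in>(UNIV::'m set). real CARD('n) * c)"
  proof (rule sum_mono)
    fix i
    have "norm (M $ i) \<le> (\<Sum>j\<in>UNIV. \<bar>M $ i $ j\<bar>)" by (rule norm_le_l1_cart)
    also have "\<dots> \<le> (\<Sum>j\<in>(UNIV::'n set). c)" by (intro sum_mono comp)
    finally show "norm (M $ i) \<le> real CARD('n) * c" by simp
  qed
  finally show ?thesis by simp
qed

text \<open>Evaluate the form at \<open>x - (1/g) *\<^sub>R p\<close> with
  \<open>p = P *v x\<close>, bounding its values at \<open>x\<close> and \<open>p\<close> from
  above.\<close>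

lemma psd_norm_le:
  fixes P :: "real^'n^'n"
  assumes sym: "transpose P = P" and psd: "\<And>x. 0 \<le> x \<bullet> (P *v x)"
    and up: "\<And>x. x \<bullet> (P *v x) \<le> g * (norm x)\<^sup>2" and g: "g > 0"
  shows "norm (P *v x) \<le> g * norm x"
proof -
  define p where "p = P *v x"
  have sw: "x \<bullet> (P *v p) = p \<bullet> p"
    using sym unfolding transpose_eq_self_iff p_def by metis
  have "0 \<le> (x - (1/g) *\<^sub>R p) \<bullet> (P *v (x - (1/g) *\<^sub>R p))" by (rule psd)
  also have "\<dots> = x \<bullet> (P *v x) - (2/g) * (norm p)\<^sup>2 + (1/g)\<^sup>2 * (p \<bullet> (P *v p))"
    by (simp add: matrix_vector_mult_diff_distrib matrix_vector_mult_scaleR inner_simps sw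
        p_def[symmetric] dot_square_norm power2_eq_square algebra_simps)
  also have "\<dots> \<le> g * (norm x)\<^sup>2 - (2/g) * (norm p)\<^sup>2 + (1/g)\<^sup>2 * (g * (norm p)\<^sup>2)"
    using g by (intro add_mono diff_mono up mult_left_mono) auto
  also have "\<dots> = g * (norm x)\<^sup>2 - (norm p)\<^sup>2 / g" using g by (simp add: field_simps power2_eq_square)
  finally have "(norm p)\<^sup>2 \<le> (g * norm x)\<^sup>2" using g by (simp add: field_simps power2_eq_square)
  then show ?thesis unfolding p_def using g by (simp add: power2_le_iff_abs_le)
qed

text \<open>Since the form is at most \<open>g\<close> times the squared norm, an absolute loss with
  constant \<open>k\<close> is a relative loss of \<open>k / g\<close>.\<close>

lemma decrease_imp_spectral_radius_less_1:
  fixes M P :: "real^'n^'n"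
  assumes sym: "transpose P = P" and psd: "\<And>x. 0 \<le> x \<bullet> (P *v x)"
    and up: "\<And>x. x \<bullet> (P *v x) \<le> g * (norm x)\<^sup>2" and k: "k > 0"
    and dec: "\<And>x. (M *v x) \<bullet> (P *v (M *v x)) + k * (norm x)\<^sup>2 \<le> x \<bullet> (P *v x)"
  shows "spectral_radius M < 1"
proof -
  have low: "k * (norm x)\<^sup>2 \<le> x \<bullet> (P *v x)" for x using dec[of x] psd[of "M *v x"] by linarith
  obtain e :: "real^'n" where e: "norm e = 1" using vector_choose_size[of 1] by auto
  have kg: "k \<le> g" using low[of e] up[of e] e by simp
  show ?thesis
  proof (rule lyapunov_imp_spectral_radius_less_1[OF sym])
    show "0 < x \<bullet> (P *v x)" if "x \<noteq> 0" for x
      using low[of x] k that by (smt (verit) mult_pos_pos zero_less_norm_iff zero_less_power)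
    show "0 \<le> 1 - k / g" "1 - k / g < 1" using k kg by auto
    show "(M *v x) \<bullet> (P *v (M *v x)) \<le> (1 - k / g) * (x \<bullet> (P *v x))" for x
    proof -
      have "(k / g) * (x \<bullet> (P *v x)) \<le> (k / g) * (g * (norm x)\<^sup>2)" using up k kg by (intro mult_left_mono) auto
      also have "\<dots> = k * (norm x)\<^sup>2" using k kg by simp
      finally show ?thesis using dec[of x] by (simp add: algebra_simps)
    qed
  qed
qed

text \<open>\<open>x\<close> is the state, \<open>y\<close> its successor, and the disturbance is
  the deviation of \<open>y\<close> from the closed loop; \<open>g\<close> is the squared gain. No
  inverse occurs, so for fixed \<open>g\<close> the condition is closed in
  \<open>(K, P)\<close>.\<close>

definition dissipative ::
  "real^'nx^'nx \<Rightarrow> real^'nu^'nx \<Rightarrow> real^'nx^'nx \<Rightarrow> real^'nu^'nu \<Rightarrow> real^'nx^'nu \<Rightarrow> real^'nx^'nx \<Rightarrow> real \<Rightarrow> bool" where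
  "dissipative A B Q R K P g \<longleftrightarrow> transpose P = P \<and> (\<forall>x. 0 \<le> x \<bullet> (P *v x)) \<and>
     (\<forall>x y. y \<bullet> (P *v y) + x \<bullet> (Q *v x) + (K *v x) \<bullet> (R *v (K *v x))
        \<le> x \<bullet> (P *v x) + g * (norm (y - (A *v x - B *v (K *v x))))\<^sup>2)"

locale hinf_problem =
  fixes A :: "real^'nx^'nx" and B :: "real^'nu^'nx" and Q :: "real^'nx^'nx" and R :: "real^'nu^'nu"
  assumes Q: "sym_pos_def Q" and R: "sym_pos_def R"
begin

abbreviation "\<K> \<equiv> stab_set A B"
abbreviation "J \<equiv> Jcost A B Q R"
abbreviation "diss \<equiv> dissipative A B Q R"
abbreviation "cl K \<equiv> A - B ** K"
abbreviation "wt K \<equiv> Q + transpose K ** R ** K"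

lemma Q_psd: "0 \<le> x \<bullet> (Q *v x)" and R_psd: "0 \<le> u \<bullet> (R *v u)"
  using Q R unfolding sym_pos_def_def by (metis inner_zero_left order_less_imp_le order_refl)+

lemma Q_sym: "x \<bullet> (Q *v y) = (Q *v x) \<bullet> y" and R_sym: "u \<bullet> (R *v v) = (R *v u) \<bullet> v"
  using Q R unfolding sym_pos_def_def transpose_eq_self_iff by auto

lemma cl_mult: "cl K *v x = A *v x - B *v (K *v x)"
  by (simp add: matrix_vector_mult_diff_rdistrib matrix_vector_mul_assoc)

lemma inner_wt: "x \<bullet> (wt K *v y) = x \<bullet> (Q *v y) + (K *v x) \<bullet> (R *v (K *v y))"
proof -
  have "x \<bullet> ((transpose K ** R ** K) *v y) = x \<bullet> (transpose K *v (R *v (K *v y)))"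
    by (simp only: matrix_vector_mul_assoc[symmetric])
  also have "\<dots> = (K *v x) \<bullet> (R *v (K *v y))"
    by (metis dot_lmul_matrix transpose_matrix_vector transpose_transpose)
  finally show ?thesis by (simp add: matrix_vector_mult_add_rdistrib inner_add_right)
qed

lemma wt_sym: "transpose (wt K) = wt K"
proof -
  have "x \<bullet> (wt K *v y) = (wt K *v x) \<bullet> y" for x y
    unfolding inner_wt inner_commute[of _ y] by (metis Q_sym R_sym inner_commute)
  then show ?thesis using transpose_eq_self_iff by blast
qed

lemma wt_psd: "0 \<le> x \<bullet> (wt K *v x)"
  unfolding inner_wt by (intro add_nonneg_nonneg Q_psd R_psd)

lemma stab_set_stable: "K \<in> \<K> \<Longrightarrow> schur_stable (cl K)"
  unfolding stab_set_def by (simp add: spectral_radius_less_1_imp_stable)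

lemma
  assumes "K \<in> \<K>"
  shows J_nonneg: "0 \<le> J K"
    and J_bound: "a \<bullet> (wt K *v a) + b \<bullet> (wt K *v b) \<le> (J K)\<^sup>2 * resolvent_sq (cl K) \<theta> a b"
  unfolding Jcost_eq_hinf_norm
  using hinf_norm_bound[OF stab_set_stable[OF assms] wt_sym wt_psd] by auto

lemma J_le:
  assumes "K \<in> \<K>" "\<And>\<theta> a b. a \<bullet> (wt K *v a) + b \<bullet> (wt K *v b) \<le> g * resolvent_sq (cl K) \<theta> a b"
  shows "J K \<le> sqrt g"
  unfolding Jcost_eq_hinf_norm
  by (rule hinf_norm_le[OF stab_set_stable[OF assms(1)] wt_sym wt_psd assms(2)])

lemma J_attained:
  assumes "K \<in> \<K>"
  obtains \<theta> a b where "(norm a)\<^sup>2 + (norm b)\<^sup>2 = 1"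
    "a \<bullet> (wt K *v a) + b \<bullet> (wt K *v b) = (J K)\<^sup>2 * resolvent_sq (cl K) \<theta> a b"
  unfolding Jcost_eq_hinf_norm
  by (rule hinf_norm_attained[OF stab_set_stable[OF assms] wt_sym wt_psd])

lemma dissipativeD:
  assumes "diss K P g"
  shows "transpose P = P" "0 \<le> x \<bullet> (P *v x)"
    "y \<bullet> (P *v y) + x \<bullet> (Q *v x) + (K *v x) \<bullet> (R *v (K *v x))
        \<le> x \<bullet> (P *v x) + g * (norm (y - (A *v x - B *v (K *v x))))\<^sup>2"
    "x \<bullet> (P *v x) \<le> g * (norm x)\<^sup>2"
    "x \<bullet> (Q *v x) + (K *v x) \<bullet> (R *v (K *v x)) \<le> x \<bullet> (P *v x)"
proof -
  show 1: "transpose P = P" "0 \<le> x \<bullet> (P *v x)" for x using assms by (auto simp: dissipative_def)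
  show 2: "y \<bullet> (P *v y) + x \<bullet> (Q *v x) + (K *v x) \<bullet> (R *v (K *v x))
        \<le> x \<bullet> (P *v x) + g * (norm (y - (A *v x - B *v (K *v x))))\<^sup>2" for x y
    using assms by (auto simp: dissipative_def)
  show "x \<bullet> (P *v x) \<le> g * (norm x)\<^sup>2" using 2[of x 0] by simp
  show "x \<bullet> (Q *v x) + (K *v x) \<bullet> (R *v (K *v x)) \<le> x \<bullet> (P *v x)"
    using 2[of "A *v x - B *v (K *v x)" x] 1(2)[of "A *v x - B *v (K *v x)"] by simp
qed

lemma stab_imp_dissipative:
  assumes "K \<in> \<K>"
  obtains P where "diss K P ((J K)\<^sup>2)"
proof -
  have "(J K)\<^sup>2 \<ge> 0" by simp
  from bounded_real_lemma[OF stable_imp_powers_tendsto_0[OF stab_set_stable[OF assms]] wt_psd this J_bound[OF assms]]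
  obtain P where "transpose P = P" "\<And>x. 0 \<le> x \<bullet> (P *v x)"
    "\<And>x y. y \<bullet> (P *v y) + x \<bullet> (wt K *v x) \<le> x \<bullet> (P *v x) + (J K)\<^sup>2 * (norm (y - cl K *v x))\<^sup>2" by metis
  then have "diss K P ((J K)\<^sup>2)" unfolding dissipative_def inner_wt cl_mult by (simp add: add.assoc)
  then show ?thesis using that by blast
qed

text \<open>The storage is at least the form of \<open>Q\<close> and at most \<open>g\<close> times
  the squared norm.\<close>

lemma dissipative_gain_pos:
  assumes "diss K P g"
  shows "g > 0"
proof -
  obtain q where q: "q > 0" "\<And>x. q * (norm x)\<^sup>2 \<le> x \<bullet> (Q *v x)" using sym_pos_def_lower_bound[OF Q] by blast
  obtain e :: "real^'nx" where e: "norm e = 1" using vector_choose_size[of 1] by auto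
  show ?thesis using q(1) q(2)[of e] e dissipativeD(4,5)[OF assms, of e] R_psd[of "K *v e"] by simp
qed

text \<open>With the closed loop of \<open>K'\<close> as successor, the disturbance is
  \<open>B *v ((K - K') *v x)\<close>. Its penalty uses at most half of the decrease due to
  \<open>Q\<close>, so \<open>P\<close> is still a Lyapunov function for \<open>K'\<close>.\<close>

lemma dissipative_perturbation_stab:
  assumes d: "diss K P g" and q: "q > 0" "\<And>x. q * (norm x)\<^sup>2 \<le> x \<bullet> (Q *v x)"
    and near: "\<And>x. g * (norm (B *v ((K - K') *v x)))\<^sup>2 \<le> (q/2) * (norm x)\<^sup>2"
  shows "K' \<in> \<K>"
proof -
  have "spectral_radius (cl K') < 1"
  proof (rule decrease_imp_spectral_radius_less_1)
    show "transpose P = P" "\<And>x. 0 \<le> x \<bullet> (P *v x)" "\<And>x. x \<bullet> (P *v x) \<le> g * (norm x)\<^sup>2"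
      using dissipativeD[OF d] by auto
    show "q / 2 > 0" using q by simp
    fix x
    have "cl K' *v x - (A *v x - B *v (K *v x)) = B *v ((K - K') *v x)"
      unfolding cl_mult by (simp only: matrix_vector_mult_diff_rdistrib matrix_vector_mult_diff_distrib) simp
    then show "(cl K' *v x) \<bullet> (P *v (cl K' *v x)) + (q/2) * (norm x)\<^sup>2 \<le> x \<bullet> (P *v x)"
      using dissipativeD(3)[OF d, of "cl K' *v x" x] near[of x] q(2)[of x] R_psd[of "K *v x"] by simp
  qed
  then show ?thesis by (simp add: stab_set_def)
qed

text \<open>The complex successor y + i z = exp(i \<theta>) (a + i b) has the same storage as a + i
  b, so storage cancels when the two real inequalities are added.\<close>

lemma dissipative_imp_stab:
  assumes d: "diss K P g"
  shows "K \<in> \<K>" and "J K \<le> sqrt g"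
proof -
  obtain q where q: "q > 0" "\<And>x. q * (norm x)\<^sup>2 \<le> x \<bullet> (Q *v x)" using sym_pos_def_lower_bound[OF Q] by blast
  show K: "K \<in> \<K>" by (rule dissipative_perturbation_stab[OF d q]) (use q in simp)
  show "J K \<le> sqrt g"
  proof (rule J_le[OF K])
    fix \<theta> :: real and a b :: "real^'nx"
    define y z where "y = cos \<theta> *\<^sub>R a - sin \<theta> *\<^sub>R b" and "z = sin \<theta> *\<^sub>R a + cos \<theta> *\<^sub>R b"
    have sw: "a \<bullet> (P *v b) = b \<bullet> (P *v a)"
      using dissipativeD(1)[OF d] unfolding transpose_eq_self_iff by (metis inner_commute)
    have rot: "(c *\<^sub>R a - s *\<^sub>R b) \<bullet> (P *v (c *\<^sub>R a - s *\<^sub>R b)) + (s *\<^sub>R a + c *\<^sub>R b) \<bullet> (P *v (s *\<^sub>R a + c *\<^sub>R b))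
        = (c\<^sup>2 + s\<^sup>2) * (a \<bullet> (P *v a) + b \<bullet> (P *v b))" for c s :: real
      by (simp add: sw matrix_vector_mult_scaleR matrix_vector_right_distrib matrix_vector_mult_diff_distrib
          inner_simps power2_eq_square algebra_simps)
    have "y \<bullet> (P *v y) + z \<bullet> (P *v z) = a \<bullet> (P *v a) + b \<bullet> (P *v b)"
      unfolding y_def z_def rot by simp
    moreover have "resolvent_sq (cl K) \<theta> a b = (norm (y - (A *v a - B *v (K *v a))))\<^sup>2 + (norm (z - (A *v b - B *v (K *v b))))\<^sup>2"
      by (simp add: resolvent_sq_def cl_mult y_def z_def)
    ultimately show "a \<bullet> (wt K *v a) + b \<bullet> (wt K *v b) \<le> g * resolvent_sq (cl K) \<theta> a b"
      using dissipativeD(3)[OF d, of y a] dissipativeD(3)[OF d, of z b] by (simp add: inner_wt distrib_left)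
  qed
qed

lemma stab_set_ball:
  assumes "K \<in> \<K>"
  obtains r where "r > 0" "r \<le> 1/2" "cball K r \<subseteq> \<K>"
proof -
  obtain P where P: "diss K P ((J K)\<^sup>2)" using stab_imp_dissipative[OF assms] by blast
  define g where "g = (J K)\<^sup>2"
  have g: "g > 0" using dissipative_gain_pos[OF P] by (simp add: g_def)
  obtain q where q: "q > 0" "\<And>x. q * (norm x)\<^sup>2 \<le> x \<bullet> (Q *v x)" using sym_pos_def_lower_bound[OF Q] by blast
  obtain c where c: "c > 0" "\<And>(K::real^'nx^'nu) x. norm (K *v x) \<le> norm K * norm x * c"
    using bounded_bilinear.pos_bounded[OF bounded_bilinear_matrix_vector_mult] by blast
  obtain cB where cB: "cB > 0" "\<And>x. norm (B *v x) \<le> cB * norm x" using matrix_vector_mult_norm_bound by blast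
  \<comment> \<open>The entry 1/2 puts any two points of the ball within distance 1, as the
    expansion of the cost requires; the other entry limits the penalty to
    \<open>q/2\<close>.\<close>
  define r where "r = min (1/2) (sqrt (q / (2 * g)) / (cB * c))"
  have r: "r > 0" using q g c cB by (simp add: r_def)
  have r': "r \<le> 1/2" unfolding r_def by (rule min.cobounded1)
  have "K' \<in> \<K>" if "K' \<in> cball K r" for K'
  proof (rule dissipative_perturbation_stab[OF P q])
    fix x
    have "norm (B *v ((K - K') *v x)) \<le> cB * (norm (K - K') * norm x * c)"
      using cB(2)[of "(K - K') *v x"] c(2)[of "K - K'" x] cB(1) by (meson mult_left_mono less_imp_le order_trans)
    also have "\<dots> \<le> cB * (sqrt (q / (2 * g)) / (cB * c) * norm x * c)"
      using that cB c by (intro mult_left_mono mult_right_mono) (auto simp: r_def dist_norm)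
    also have "\<dots> = sqrt (q / (2 * g)) * norm x" using cB c by simp
    finally have "(norm (B *v ((K - K') *v x)))\<^sup>2 \<le> (sqrt (q / (2 * g)) * norm x)\<^sup>2" by (rule power_mono) simp
    also have "\<dots> = q / (2 * g) * (norm x)\<^sup>2" using q g by (simp add: power_mult_distrib)
    finally have "g * (norm (B *v ((K - K') *v x)))\<^sup>2 \<le> g * (q / (2 * g) * (norm x)\<^sup>2)"
      using g by (intro mult_left_mono) auto
    also have "\<dots> = (q/2) * (norm x)\<^sup>2" using g by simp
    finally show "(J K)\<^sup>2 * (norm (B *v ((K - K') *v x)))\<^sup>2 \<le> (q/2) * (norm x)\<^sup>2" by (simp add: g_def)
  qed
  then show ?thesis using that r r' by blast
qed

text \<open>The sublevel set is the projection of the certificates \<open>(K, P)\<close> of gain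
  \<open>\<gamma>^2\<close>. These are closed, and bounded because the storage is at most
  \<open>\<gamma>^2\<close> times the squared norm and dominates the form of \<open>R\<close> at
  \<open>K *v x\<close>.\<close>

lemma sublevel_compact: "compact {K\<in>\<K>. J K \<le> \<gamma>}"
proof (cases "\<gamma> > 0")
  case False
  have "{K\<in>\<K>. J K \<le> \<gamma>} = {}"
  proof safe
    fix K assume K: "K \<in> \<K>" "J K \<le> \<gamma>"
    then obtain P where "diss K P ((J K)\<^sup>2)" using stab_imp_dissipative by blast
    then have "(J K)\<^sup>2 > 0" by (rule dissipative_gain_pos)
    then show "K \<in> {}" using J_nonneg[OF K(1)] K False by auto
  qed
  then show ?thesis by (simp only: compact_empty)
next
  case True
  define W where "W = {(K, P). diss K P (\<gamma>\<^sup>2)}"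
  have eq: "{K\<in>\<K>. J K \<le> \<gamma>} = fst ` W"
  proof safe
    fix K assume K: "K \<in> \<K>" "J K \<le> \<gamma>"
    then obtain P where P: "diss K P ((J K)\<^sup>2)" using stab_imp_dissipative by blast
    have "(J K)\<^sup>2 \<le> \<gamma>\<^sup>2" using K J_nonneg by (simp add: power_mono)
    then have "diss K P (\<gamma>\<^sup>2)" using P unfolding dissipative_def
      by (smt (verit, best) mult_right_mono zero_le_power2)
    then show "K \<in> fst ` W" unfolding W_def by force
  next
    fix K P assume "(K, P) \<in> W"
    then show "fst (K, P) \<in> \<K>" "J (fst (K, P)) \<le> \<gamma>"
      using dissipative_imp_stab[of K P "\<gamma>\<^sup>2"] True by (auto simp: W_def)
  qed
  have "closed W"
  proof -
    have W: "W = {p. transpose (snd p) = snd p} \<inter> (\<Inter>x. {p. 0 \<le> x \<bullet> (snd p *v x)}) \<inter>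
      (\<Inter>x. \<Inter>y. {p. y \<bullet> (snd p *v y) + x \<bullet> (Q *v x) + (fst p *v x) \<bullet> (R *v (fst p *v x))
        \<le> x \<bullet> (snd p *v x) + \<gamma>\<^sup>2 * (norm (y - (A *v x - B *v (fst p *v x))))\<^sup>2})"
      by (auto simp: W_def dissipative_def)
    show ?thesis unfolding W transpose_eq_self_iff Collect_all_eq
      by (intro closed_Int closed_INT ballI closed_Collect_le closed_Collect_eq continuous_intros)
  qed
  moreover have "bounded W"
  proof -
    obtain \<rho> where \<rho>: "\<rho> > 0" "\<And>u. \<rho> * (norm u)\<^sup>2 \<le> u \<bullet> (R *v u)" using sym_pos_def_lower_bound[OF R] by blast
    define c where "c = \<gamma> / sqrt \<rho>"
    have "W \<subseteq> cball 0 (real CARD('nu) * (real CARD('nx) * c)) \<times> cball 0 (real CARD('nx) * (real CARD('nx) * \<gamma>\<^sup>2))"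
    proof safe
      fix K P assume "(K, P) \<in> W"
      then have d: "diss K P (\<gamma>\<^sup>2)" by (simp add: W_def)
      have "norm (P *v x) \<le> \<gamma>\<^sup>2 * norm x" for x
        by (rule psd_norm_le) (use dissipativeD[OF d] True in auto)
      from norm_matrix_le[OF this] show "P \<in> cball 0 (real CARD('nx) * (real CARD('nx) * \<gamma>\<^sup>2))" by simp
      have "norm (K *v x) \<le> c * norm x" for x
      proof -
        have "\<rho> * (norm (K *v x))\<^sup>2 \<le> \<gamma>\<^sup>2 * (norm x)\<^sup>2"
          using \<rho>(2)[of "K *v x"] dissipativeD(4,5)[OF d, of x] Q_psd[of x] by linarith
        then have "(norm (K *v x))\<^sup>2 \<le> (c * norm x)\<^sup>2"
          using \<rho>(1) by (simp add: c_def power_mult_distrib power_divide field_simps)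
        then show ?thesis using \<rho>(1) True by (simp add: power2_le_iff_abs_le c_def)
      qed
      from norm_matrix_le[OF this] show "K \<in> cball 0 (real CARD('nu) * (real CARD('nx) * c))" by simp
    qed
    then show ?thesis by (rule bounded_subset[OF bounded_Times[OF bounded_cball bounded_cball]])
  qed
  ultimately have "compact W" by (simp add: compact_eq_bounded_closed)
  then show ?thesis unfolding eq by (intro compact_continuous_image continuous_intros)
qed

end

subsection \<open>Local weak convexity of the cost\<close>

text \<open>A second-order lower bound for the square root, phrased through \<open>j\<close> so that
  \<open>\<tau>\<close> may be arbitrarily negative. With \<open>u = j - s\<close>, either the
  linear bound holds outright, or \<open>u^2 \<le> \<tau>^2 / s^2\<close>, to be inserted in
  \<open>2 * s * u + u^2 \<ge> \<tau>\<close>.\<close>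

lemma sqrt_support:
  fixes s j \<tau> :: real
  assumes s: "s > 0" and j: "j \<ge> 0" and ge: "j\<^sup>2 \<ge> s\<^sup>2 + \<tau>"
  shows "j \<ge> s + \<tau> / (2 * s) - \<tau>\<^sup>2 / (2 * s ^ 3)"
proof -
  define u where "u = j - s"
  have u: "2 * s * u + u\<^sup>2 \<ge> \<tau>" using ge by (simp add: u_def power2_eq_square algebra_simps)
  have "s\<^sup>2 * u\<^sup>2 \<le> \<tau>\<^sup>2 \<or> u \<ge> \<tau> / (2 * s)"
  proof (rule disjCI)
    assume "\<not> \<tau> / (2 * s) \<le> u"
    then have lt: "2 * s * u < \<tau>" using s by (simp add: field_simps)
    have "\<bar>s * u\<bar> \<le> \<bar>\<tau>\<bar>"
    proof (cases "u \<ge> 0")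
      case True
      then show ?thesis using lt mult_nonneg_nonneg[of s u] s by linarith
    next
      case False
      have "u * (u + s) \<le> 0" using False j by (intro mult_nonpos_nonneg) (auto simp: u_def)
      then have "u\<^sup>2 \<le> - (s * u)" by (simp add: power2_eq_square algebra_simps)
      then have "\<tau> \<le> s * u" using u by simp
      moreover have "s * u < 0" using False s by (simp add: mult_pos_neg)
      ultimately show ?thesis by simp
    qed
    then have "(s * u)\<^sup>2 \<le> \<tau>\<^sup>2" by (simp add: abs_le_square_iff)
    then show "s\<^sup>2 * u\<^sup>2 \<le> \<tau>\<^sup>2" by (simp add: power_mult_distrib)
  qed
  then have "u \<ge> \<tau> / (2 * s) - \<tau>\<^sup>2 / (2 * s ^ 3)"
  proof
    assume "s\<^sup>2 * u\<^sup>2 \<le> \<tau>\<^sup>2"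
    then have "u\<^sup>2 \<le> \<tau>\<^sup>2 / s\<^sup>2" using s by (simp add: field_simps)
    then have "2 * s * u \<ge> \<tau> - \<tau>\<^sup>2 / s\<^sup>2" using u by linarith
    then have "u \<ge> (\<tau> - \<tau>\<^sup>2 / s\<^sup>2) / (2 * s)" using s by (simp add: field_simps)
    then show ?thesis by (simp add: diff_divide_distrib power2_eq_square power3_eq_cube mult_ac)
  next
    assume "u \<ge> \<tau> / (2 * s)"
    moreover have "\<tau>\<^sup>2 / (2 * s ^ 3) \<ge> 0" using s by simp
    ultimately show ?thesis by linarith
  qed
  then show ?thesis by (simp add: u_def)
qed

text \<open>Lower expansion of the square root of \<open>N / D\<close> about the value
  \<open>s\<close>; \<open>\<alpha>\<close> and \<open>\<beta>\<close> are the linear parts for an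
  increment of size \<open>t\<close>, and \<open>e\<close> helps by its sign. The error constants
  involve only the given bounds, hence are uniform in base point and direction.\<close>

lemma ratio_support:
  fixes s j N D D0 \<alpha> \<beta> e e' t :: real
  assumes j: "j \<ge> 0" "N \<le> j\<^sup>2 * D" and s: "0 < s0" "s0 \<le> s" "s \<le> s1"
    and d: "0 < d" "d \<le> D0" "d \<le> D" and t: "0 \<le> t" "t \<le> 1"
    and N: "N = s\<^sup>2 * D0 + \<alpha> + e" "0 \<le> e" and D: "D = D0 + \<beta> + e'" "0 \<le> e'" "e' \<le> e2 * t\<^sup>2"
    and \<alpha>: "\<bar>\<alpha>\<bar> \<le> a1 * t" and \<beta>: "\<bar>\<beta>\<bar> \<le> b1 * t" and nn: "0 \<le> a1" "0 \<le> b1" "0 \<le> e2"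
  defines "l1 \<equiv> a1 + s1\<^sup>2 * b1"
  shows "j \<ge> s + (\<alpha> - s\<^sup>2 * \<beta>) / (2 * s * D0)
    - ((l1 * (b1 + e2) / d\<^sup>2 + s1\<^sup>2 * e2 / d) / (2 * s0) + ((l1 + s1\<^sup>2 * e2) / d)\<^sup>2 / (2 * s0 ^ 3)) * t\<^sup>2"
proof -
  have spos: "s > 0" and D0: "D0 > 0" and Dpos: "D > 0" using s d by auto
  have tt: "t\<^sup>2 \<le> t" using t by (simp add: power2_eq_square mult_left_le)
  have s2: "s\<^sup>2 \<le> s1\<^sup>2" using s by (intro power_mono) auto
  define l where "l = \<alpha> - s\<^sup>2 * \<beta>"
  have "\<bar>s\<^sup>2 * \<beta>\<bar> \<le> s1\<^sup>2 * (b1 * t)" unfolding abs_mult using s2 \<beta> by (intro mult_mono) auto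
  then have l: "\<bar>l\<bar> \<le> l1 * t" using \<alpha> unfolding l_def l1_def by (simp add: distrib_right)
  have l1: "l1 \<ge> 0" using nn by (simp add: l1_def)
  have se: "s\<^sup>2 * e' \<le> s1\<^sup>2 * e2 * t\<^sup>2"
    using mult_mono[OF s2 D(3)] D(2) by (simp add: mult.assoc)
  \<comment> \<open>A lower bound for \<open>j^2 - s^2\<close>. Its square is of order
    \<open>t^2\<close>, and it falls below \<open>l / D0\<close> by at most that order.\<close>
  define \<tau> where "\<tau> = (l - s\<^sup>2 * e') / D"
  have "N - s\<^sup>2 * D \<ge> l - s\<^sup>2 * e'" using N D(1) by (simp add: l_def algebra_simps)
  then have "(j\<^sup>2 - s\<^sup>2) * D \<ge> l - s\<^sup>2 * e'" using j by (simp add: algebra_simps)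
  then have "j\<^sup>2 \<ge> s\<^sup>2 + \<tau>" using Dpos by (simp add: \<tau>_def field_simps)
  from sqrt_support[OF spos j(1) this]
  have J: "j \<ge> s + \<tau> / (2 * s) - \<tau>\<^sup>2 / (2 * s ^ 3)" .
  have \<tau>abs: "\<bar>\<tau>\<bar> \<le> (l1 + s1\<^sup>2 * e2) / d * t"
  proof -
    have "s1\<^sup>2 * e2 * t\<^sup>2 \<le> s1\<^sup>2 * e2 * t" using tt nn by (intro mult_left_mono) auto
    then have "\<bar>l - s\<^sup>2 * e'\<bar> \<le> (l1 + s1\<^sup>2 * e2) * t" 
      using l se mult_nonneg_nonneg[OF zero_le_power2[of s] D(2)] unfolding distrib_right by linarith
    then have "\<bar>l - s\<^sup>2 * e'\<bar> / D \<le> ((l1 + s1\<^sup>2 * e2) * t) / d" using d by (intro frac_le) auto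
    then show ?thesis using Dpos by (simp add: \<tau>_def abs_divide)
  qed
  have \<tau>2: "\<tau>\<^sup>2 / (2 * s ^ 3) \<le> ((l1 + s1\<^sup>2 * e2) / d)\<^sup>2 / (2 * s0 ^ 3) * t\<^sup>2"
  proof -
    have "\<tau>\<^sup>2 \<le> ((l1 + s1\<^sup>2 * e2) / d * t)\<^sup>2" using \<tau>abs by (metis abs_ge_zero power2_abs power_mono)
    moreover have "s0 ^ 3 \<le> s ^ 3" using s by (intro power_mono) auto
    ultimately have "\<tau>\<^sup>2 / (2 * s ^ 3) \<le> ((l1 + s1\<^sup>2 * e2) / d * t)\<^sup>2 / (2 * s0 ^ 3)"
      using s by (intro frac_le) auto
    moreover have "((l1 + s1\<^sup>2 * e2) / d * t)\<^sup>2 = ((l1 + s1\<^sup>2 * e2) / d)\<^sup>2 * t\<^sup>2" by (rule power_mult_distrib)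
    ultimately show ?thesis by (simp only: times_divide_eq_left)
  qed
  have \<tau>1: "\<tau> \<ge> l / D0 - (l1 * (b1 + e2) / d\<^sup>2 + s1\<^sup>2 * e2 / d) * t\<^sup>2"
  proof -
    have "e2 * t\<^sup>2 \<le> e2 * t" using tt nn by (intro mult_left_mono) auto
    then have DD: "\<bar>D0 - D\<bar> \<le> (b1 + e2) * t" using D \<beta> by (simp add: distrib_right)
    have "\<bar>l * (D0 - D) / (D * D0)\<bar> = \<bar>l\<bar> * \<bar>D0 - D\<bar> / (D * D0)" using Dpos D0 by (simp add: abs_mult)
    also have "\<dots> \<le> (l1 * t) * ((b1 + e2) * t) / (d * d)"
      using l DD d l1 t by (intro frac_le mult_mono) auto
    finally have 1: "\<bar>l * (D0 - D) / (D * D0)\<bar> \<le> l1 * (b1 + e2) / d\<^sup>2 * t\<^sup>2"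
      by (simp add: power2_eq_square mult_ac)
    have 2: "s\<^sup>2 * e' / D \<le> s1\<^sup>2 * e2 / d * t\<^sup>2"
    proof -
      have "s\<^sup>2 * e' / D \<le> s1\<^sup>2 * e2 * t\<^sup>2 / d" using se d nn by (intro frac_le) auto
      then show ?thesis by simp
    qed
    have "\<tau> = l / D0 + l * (D0 - D) / (D * D0) - s\<^sup>2 * e' / D"
      using Dpos D0 by (simp add: \<tau>_def field_simps)
    moreover have "u - (p + q) \<le> \<tau>" if "\<tau> = u + v - w" "\<bar>v\<bar> \<le> p" "w \<le> q" for u v w p q :: real
      using that by linarith
    ultimately show ?thesis using 1 2 unfolding distrib_right by blast
  qed
  define E where "E = (l1 * (b1 + e2) / d\<^sup>2 + s1\<^sup>2 * e2 / d) * t\<^sup>2"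
  have E: "E \<ge> 0" unfolding E_def using l1 nn d by (intro mult_nonneg_nonneg add_nonneg_nonneg) auto
  have "\<tau> / (2 * s) \<ge> (l / D0 - E) / (2 * s)" using \<tau>1 spos by (intro divide_right_mono) (auto simp: E_def)
  moreover have "E / (2 * s) \<le> E / (2 * s0)" using E s by (intro divide_left_mono) auto
  ultimately have "\<tau> / (2 * s) \<ge> l / (2 * s * D0) - E / (2 * s0)"
    using spos D0 by (simp add: diff_divide_distrib mult_ac)
  then have "j \<ge> s + l / (2 * s * D0) - E / (2 * s0) - ((l1 + s1\<^sup>2 * e2) / d)\<^sup>2 / (2 * s0 ^ 3) * t\<^sup>2"
    using J \<tau>2 by linarith
  then show "j \<ge> s + (\<alpha> - s\<^sup>2 * \<beta>) / (2 * s * D0)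
    - ((l1 * (b1 + e2) / d\<^sup>2 + s1\<^sup>2 * e2 / d) / (2 * s0) + ((l1 + s1\<^sup>2 * e2) / d)\<^sup>2 / (2 * s0 ^ 3)) * t\<^sup>2"
    unfolding l_def[symmetric] distrib_right by (simp add: E_def)
qed

lemma linear_functional_gradient:
  fixes \<phi> :: "'a::euclidean_space \<Rightarrow> real"
  assumes "linear \<phi>" and "\<And>h. \<bar>\<phi> h\<bar> \<le> L * norm h"
  obtains g where "norm g \<le> L" "\<And>h. g \<bullet> h = \<phi> h"
proof -
  define g where "g = adjoint \<phi> 1"
  have g: "g \<bullet> h = \<phi> h" for h using adjoint_works[OF assms(1), of h 1] by (simp add: g_def inner_commute)
  have "norm g \<le> L"
  proof (cases "g = 0")
    case True
    obtain h :: 'a where "norm h = 1" using vector_choose_size[of 1] by auto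
    then have "0 \<le> L" using assms(2)[of h] by simp
    then show ?thesis using True by simp
  next
    case False
    define h where "h = (1 / norm g) *\<^sub>R g"
    have "norm h = 1" "g \<bullet> h = norm g" using False by (simp_all add: h_def dot_square_norm power2_eq_square)
    then show ?thesis using assms(2)[of h] g[of h] by simp
  qed
  then show ?thesis using that g by blast
qed

context hinf_problem
begin

text \<open>With \<open>(\<theta>, a, b)\<close> frozen at a maximiser for \<open>y\<close>,
  numerator and denominator are exactly quadratic in the increment \<open>h\<close>; the square of
  \<open>J (y + h)\<close> is at least their quotient, with equality at
  \<open>h = 0\<close>.\<close>

lemma locally_weakly_convex_J: "locally_weakly_convex_on J \<K>"
  unfolding locally_weakly_convex_on_def
proof
  fix K0 assume K0: "K0 \<in> \<K>"
  obtain r where r: "r > 0" "r \<le> 1/2" "cball K0 r \<subseteq> \<K>" using stab_set_ball[OF K0] by blast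
  obtain q where q: "q > 0" "\<And>x. q * (norm x)\<^sup>2 \<le> x \<bullet> (Q *v x)" using sym_pos_def_lower_bound[OF Q] by blast
  obtain c where c: "c > 0" "\<And>(K::real^'nx^'nu) x. norm (K *v x) \<le> norm K * norm x * c"
    using bounded_bilinear.pos_bounded[OF bounded_bilinear_matrix_vector_mult] by blast
  obtain cA where cA: "cA > 0" "\<And>x. norm (A *v x) \<le> cA * norm x" using matrix_vector_mult_norm_bound by blast
  obtain cB where cB: "cB > 0" "\<And>x. norm (B *v x) \<le> cB * norm x" using matrix_vector_mult_norm_bound by blast
  obtain cR where cR: "cR > 0" "\<And>x. norm (R *v x) \<le> cR * norm x" using matrix_vector_mult_norm_bound by blast
  obtain cQ where cQ: "cQ > 0" "\<And>x. \<bar>x \<bullet> (Q *v x)\<bar> \<le> cQ * (norm x)\<^sup>2" using matrix_quadratic_form_bound by blast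
  have "continuous_on (cball K0 r) cl" by (intro continuous_intros)
  moreover have "\<And>K \<theta> a b. K \<in> cball K0 r \<Longrightarrow> resolvent_sq (cl K) \<theta> a b = 0 \<Longrightarrow> a = 0 \<and> b = 0"
    using resolvent_sq_eq_0_imp_zero[OF stab_set_stable, of _ 1] r(3) by (metis order_refl scaleR_one subsetD zero_le_one)
  ultimately obtain d where d: "d > 0"
      "\<And>K \<theta> a b. K \<in> cball K0 r \<Longrightarrow> d * ((norm a)\<^sup>2 + (norm b)\<^sup>2) \<le> resolvent_sq (cl K) \<theta> a b"
    using resolvent_sq_uniform_lower_bound[of "cball K0 r" cl] by (metis compact_cball)
  \<comment> \<open>\<open>k\<close> bounds the gains in the ball, and \<open>\<mu>\<close> the two
    components \<open>p\<close>, \<open>p'\<close> of the resolvent applied to a unit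
    vector.\<close>
  define k where "k = norm K0 + 1"
  have k: "k > 0" unfolding k_def by (smt (verit) norm_ge_zero)
  define \<mu> where "\<mu> = 2 + cA + cB * (c * k)"
  have \<mu>: "\<mu> > 0" using cA cB c k by (simp add: \<mu>_def add_pos_pos)
  define a1 where "a1 = 4 * (cR * c\<^sup>2 * k)"
  define b1 where "b1 = 4 * (\<mu> * cB * c)"
  define e2 where "e2 = 2 * (cB * c)\<^sup>2"
  \<comment> \<open>\<open>s0\<close> and \<open>s1\<close> enclose \<open>J\<close> on the ball:
    for unit vectors the numerator is at least \<open>q\<close> and at most the dividend in
    \<open>s1\<close>, the denominator between \<open>d\<close> and
    \<open>2 * \<mu>^2\<close>.\<close>
  define s0 where "s0 = sqrt (q / (2 * \<mu>\<^sup>2))"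
  define s1 where "s1 = sqrt ((2 * cQ + 2 * (cR * (c * k)\<^sup>2)) / d)"
  have nn: "0 \<le> a1" "0 \<le> b1" "0 \<le> e2" using cR c k \<mu> cB by (auto simp: a1_def b1_def e2_def)
  have s0: "s0 > 0" using q \<mu> by (simp add: s0_def)
  define l1 where "l1 = a1 + s1\<^sup>2 * b1"
  have l1: "l1 \<ge> 0" using nn by (simp add: l1_def)
  define C where "C = (l1 * (b1 + e2) / d\<^sup>2 + s1\<^sup>2 * e2 / d) / (2 * s0) + ((l1 + s1\<^sup>2 * e2) / d)\<^sup>2 / (2 * s0 ^ 3)"
  have C: "C \<ge> 0" using l1 nn d s0 by (simp add: C_def)
  define L where "L = l1 / (2 * s0 * d)"
  have L: "L \<ge> 0" using l1 s0 d by (simp add: L_def)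
  have supp: "\<exists>g. norm g \<le> L \<and> (\<forall>z\<in>cball K0 r. J z \<ge> J y + g \<bullet> (z - y) - C * (norm (z - y))\<^sup>2)"
    if y: "y \<in> cball K0 r" for y
  proof -
    have yK: "y \<in> \<K>" using y r by auto
    obtain \<theta> a b where ab: "(norm a)\<^sup>2 + (norm b)\<^sup>2 = 1"
      and att: "a \<bullet> (wt y *v a) + b \<bullet> (wt y *v b) = (J y)\<^sup>2 * resolvent_sq (cl y) \<theta> a b"
      using J_attained[OF yK] by blast
    have "(norm a)\<^sup>2 \<le> 1\<^sup>2" "(norm b)\<^sup>2 \<le> 1\<^sup>2" using ab by (smt (verit) one_power2 zero_le_power2)+
    then have ab1: "norm a \<le> 1" "norm b \<le> 1" by (auto intro: power2_le_imp_le)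
    have ny: "norm y \<le> k" using y r norm_triangle_ineq[of K0 "y - K0"] by (simp add: k_def dist_norm norm_minus_commute)
    have Kv: "norm (h *v v) \<le> c * norm h" if "norm v \<le> 1" for h :: "real^'nx^'nu" and v
    proof -
      have "norm h * norm v * c \<le> norm h * 1 * c" using that c(1) by (intro mult_right_mono mult_left_mono) auto
      then show ?thesis using c(2)[of h v] by (simp add: mult.commute)
    qed
    have yv: "norm (y *v v) \<le> c * k" if "norm v \<le> 1" for v
      using Kv[OF that, of y] mult_left_mono[OF ny less_imp_le[OF c(1)]] by linarith
    have BKv: "norm (B *v (h *v v)) \<le> cB * c * norm h" if "norm v \<le> 1" for h :: "real^'nx^'nu" and v
      using cB(2)[of "h *v v"] mult_left_mono[OF Kv[OF that, of h] less_imp_le[OF cB(1)]] unfolding mult.assoc by linarith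
    define s where "s = J y"
    define p p' where "p = cos \<theta> *\<^sub>R a - sin \<theta> *\<^sub>R b - cl y *v a" and "p' = sin \<theta> *\<^sub>R a + cos \<theta> *\<^sub>R b - cl y *v b"
    have clv: "norm (cl y *v v) \<le> cA + cB * (c * k)" if "norm v \<le> 1" for v
    proof -
      have "norm (A *v v) \<le> cA" using cA(2)[of v] mult_left_mono[OF that less_imp_le[OF cA(1)]] by linarith
      moreover have "norm (B *v (y *v v)) \<le> cB * (c * k)"
        using cB(2)[of "y *v v"] mult_left_mono[OF yv[OF that] less_imp_le[OF cB(1)]] by linarith
      ultimately show ?thesis unfolding cl_mult using norm_triangle_ineq4[of "A *v v" "B *v (y *v v)"] by linarith
    qed
    have trig: "norm (cos \<theta> *\<^sub>R v) \<le> 1" "norm (sin \<theta> *\<^sub>R v) \<le> 1" if "norm v \<le> 1" for v :: "real^'nx"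
      using that abs_cos_le_one[of \<theta>] abs_sin_le_one[of \<theta>] by (auto simp: mult_le_one)
    have np: "norm p \<le> \<mu>" "norm p' \<le> \<mu>"
    proof -
      have "norm p \<le> norm (cos \<theta> *\<^sub>R a) + norm (sin \<theta> *\<^sub>R b) + norm (cl y *v a)"
        unfolding p_def using norm_triangle_ineq4[of "cos \<theta> *\<^sub>R a - sin \<theta> *\<^sub>R b" "cl y *v a"]
          norm_triangle_ineq4[of "cos \<theta> *\<^sub>R a" "sin \<theta> *\<^sub>R b"] by linarith
      then show "norm p \<le> \<mu>" using trig(1)[OF ab1(1)] trig(2)[OF ab1(2)] clv[OF ab1(1)] unfolding \<mu>_def by linarith
      have "norm p' \<le> norm (sin \<theta> *\<^sub>R a) + norm (cos \<theta> *\<^sub>R b) + norm (cl y *v b)"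
        unfolding p'_def using norm_triangle_ineq4[of "sin \<theta> *\<^sub>R a + cos \<theta> *\<^sub>R b" "cl y *v b"]
          norm_triangle_ineq[of "sin \<theta> *\<^sub>R a" "cos \<theta> *\<^sub>R b"] by linarith
      then show "norm p' \<le> \<mu>" using trig(2)[OF ab1(1)] trig(1)[OF ab1(2)] clv[OF ab1(2)] unfolding \<mu>_def by linarith
    qed
    define D0 where "D0 = resolvent_sq (cl y) \<theta> a b"
    have D0: "D0 = (norm p)\<^sup>2 + (norm p')\<^sup>2" by (simp add: D0_def resolvent_sq_def p_def p'_def)
    have D0d: "d \<le> D0" using d(2)[OF y, of a b \<theta>] ab by (simp add: D0_def)
    have D0\<mu>: "D0 \<le> 2 * \<mu>\<^sup>2" unfolding D0 using power_mono[OF np(1), of 2] power_mono[OF np(2), of 2] by simp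
    define N0 where "N0 = a \<bullet> (wt y *v a) + b \<bullet> (wt y *v b)"
    have N0: "N0 = s\<^sup>2 * D0" using att by (simp add: N0_def s_def D0_def)
    have "N0 \<ge> q * ((norm a)\<^sup>2 + (norm b)\<^sup>2)"
      unfolding N0_def inner_wt distrib_left using q(2)[of a] q(2)[of b] R_psd[of "y *v a"] R_psd[of "y *v b"] by linarith
    then have N0q: "N0 \<ge> q" by (simp add: ab)
    have Rv: "(y *v v) \<bullet> (R *v (y *v v)) \<le> cR * (c * k)\<^sup>2" if "norm v \<le> 1" for v
    proof -
      have "(y *v v) \<bullet> (R *v (y *v v)) \<le> norm (y *v v) * norm (R *v (y *v v))" by (rule norm_cauchy_schwarz)
      also have "\<dots> \<le> norm (y *v v) * (cR * norm (y *v v))" by (intro mult_left_mono cR) simp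
      also have "\<dots> = cR * (norm (y *v v))\<^sup>2" by (simp add: power2_eq_square)
      also have "\<dots> \<le> cR * (c * k)\<^sup>2" using yv[OF that] cR by (intro mult_left_mono power_mono) auto
      finally show ?thesis .
    qed
    have N0u: "N0 \<le> 2 * cQ + 2 * (cR * (c * k)\<^sup>2)"
    proof -
      have "a \<bullet> (Q *v a) \<le> cQ" "b \<bullet> (Q *v b) \<le> cQ"
        using cQ(2)[of a] cQ(2)[of b] mult_left_mono[OF \<open>(norm a)\<^sup>2 \<le> 1\<^sup>2\<close> less_imp_le[OF cQ(1)]]
          mult_left_mono[OF \<open>(norm b)\<^sup>2 \<le> 1\<^sup>2\<close> less_imp_le[OF cQ(1)]] by simp_all
      then show ?thesis unfolding N0_def inner_wt using Rv[OF ab1(1)] Rv[OF ab1(2)] by linarith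
    qed
    have s_nn: "s \<ge> 0" unfolding s_def by (rule J_nonneg[OF yK])
    have s2: "s\<^sup>2 = N0 / D0" using N0 D0d d by (simp add: field_simps)
    have s_low: "s0 \<le> s"
    proof -
      have "q / (2 * \<mu>\<^sup>2) \<le> s\<^sup>2" unfolding s2 using N0q D0\<mu> D0d d q by (intro frac_le) auto
      then show ?thesis unfolding s0_def using s_nn by (simp add: real_le_lsqrt)
    qed
    have s_up: "s \<le> s1"
    proof -
      have "s\<^sup>2 \<le> (2 * cQ + 2 * (cR * (c * k)\<^sup>2)) / d" unfolding s2 using N0u D0d d cQ cR by (intro frac_le) auto
      then show ?thesis unfolding s1_def by (simp add: real_le_rsqrt)
    qed
    \<comment> \<open>\<open>\<alpha>\<close> and \<open>\<beta>\<close> are the linear parts in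
      \<open>h\<close> of the weighted energy and of \<open>resolvent_sq\<close>; the functional
      \<open>\<phi>\<close> below is the derivative of the square root of their quotient at
      \<open>h = 0\<close>.\<close>
    define \<alpha> where "\<alpha> h = 2 * ((h *v a) \<bullet> (R *v (y *v a)) + (h *v b) \<bullet> (R *v (y *v b)))" for h
    define \<beta> where "\<beta> h = 2 * (p \<bullet> (B *v (h *v a)) + p' \<bullet> (B *v (h *v b)))" for h
    have \<alpha>b: "\<bar>\<alpha> h\<bar> \<le> a1 * norm h" for h
    proof -
      have "\<bar>(h *v v) \<bullet> (R *v (y *v v))\<bar> \<le> cR * c\<^sup>2 * k * norm h" if "norm v \<le> 1" for v
      proof -
        have "norm (R *v (y *v v)) \<le> cR * (c * k)"
          using cR(2)[of "y *v v"] mult_left_mono[OF yv[OF that] less_imp_le[OF cR(1)]] by linarith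
        then have "norm (h *v v) * norm (R *v (y *v v)) \<le> (c * norm h) * (cR * (c * k))"
          using Kv[OF that, of h] c by (intro mult_mono) auto
        then show ?thesis using Cauchy_Schwarz_ineq2[of "h *v v" "R *v (y *v v)"]
          by (simp add: power2_eq_square mult_ac)
      qed
      from this[OF ab1(1)] this[OF ab1(2)] show ?thesis by (simp add: \<alpha>_def a1_def)
    qed
    have \<beta>b: "\<bar>\<beta> h\<bar> \<le> b1 * norm h" for h
    proof -
      have "\<bar>p \<bullet> (B *v (h *v a))\<bar> \<le> \<mu> * (cB * c * norm h)" "\<bar>p' \<bullet> (B *v (h *v b))\<bar> \<le> \<mu> * (cB * c * norm h)"
        using Cauchy_Schwarz_ineq2[of p "B *v (h *v a)"] mult_mono[OF np(1) BKv[OF ab1(1), of h]]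
          Cauchy_Schwarz_ineq2[of p' "B *v (h *v b)"] mult_mono[OF np(2) BKv[OF ab1(2), of h]] \<mu> by auto
      then show ?thesis by (simp add: \<beta>_def b1_def mult.assoc)
    qed
    define \<phi> where "\<phi> h = (\<alpha> h - s\<^sup>2 * \<beta> h) / (2 * s * D0)" for h
    have main: "J (y + h) \<ge> s + \<phi> h - C * (norm h)\<^sup>2" if z: "y + h \<in> cball K0 r" and h: "norm h \<le> 1" for h
    proof -
      have zK: "y + h \<in> \<K>" using z r by auto
      define e where "e = (h *v a) \<bullet> (R *v (h *v a)) + (h *v b) \<bullet> (R *v (h *v b))"
      define e' where "e' = (norm (B *v (h *v a)))\<^sup>2 + (norm (B *v (h *v b)))\<^sup>2"
      have wtv: "v \<bullet> (wt (y + h) *v v) = v \<bullet> (wt y *v v) + 2 * ((h *v v) \<bullet> (R *v (y *v v))) + (h *v v) \<bullet> (R *v (h *v v))" for v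
        using R_sym[of "y *v v" "h *v v"] unfolding inner_wt
        by (simp add: matrix_vector_mult_add_rdistrib matrix_vector_right_distrib inner_simps inner_commute)
      have N: "a \<bullet> (wt (y + h) *v a) + b \<bullet> (wt (y + h) *v b) = s\<^sup>2 * D0 + \<alpha> h + e"
        unfolding wtv N0[symmetric] N0_def \<alpha>_def e_def by simp
      have clz: "u - cl (y + h) *v v = (u - cl y *v v) + B *v (h *v v)" for u v
        unfolding cl_mult by (simp add: matrix_vector_mult_add_rdistrib matrix_vector_right_distrib)
      have sq: "(norm (u + v))\<^sup>2 = (norm u)\<^sup>2 + 2 * (u \<bullet> v) + (norm v)\<^sup>2" for u v :: "real^'nx"
        by (simp add: power2_norm_eq_inner inner_simps inner_commute)
      have D: "resolvent_sq (cl (y + h)) \<theta> a b = D0 + \<beta> h + e'"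
        unfolding resolvent_sq_def clz p_def[symmetric] p'_def[symmetric] sq D0 \<beta>_def e'_def by simp
      have e'2: "e' \<le> e2 * (norm h)\<^sup>2"
        using power_mono[OF BKv[OF ab1(1), of h], of 2] power_mono[OF BKv[OF ab1(2), of h], of 2]
        by (simp add: e'_def e2_def power_mult_distrib)
      have "J (y + h) \<ge> s + (\<alpha> h - s\<^sup>2 * \<beta> h) / (2 * s * D0) -
        ((l1 * (b1 + e2) / d\<^sup>2 + s1\<^sup>2 * e2 / d) / (2 * s0) + ((l1 + s1\<^sup>2 * e2) / d)\<^sup>2 / (2 * s0 ^ 3)) * (norm h)\<^sup>2"
        unfolding l1_def
      proof (rule ratio_support[where N="a \<bullet> (wt (y + h) *v a) + b \<bullet> (wt (y + h) *v b)"
              and D="resolvent_sq (cl (y + h)) \<theta> a b" and e=e and e'=e'])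
        show "0 \<le> J (y + h)" by (rule J_nonneg[OF zK])
        show "a \<bullet> (wt (y + h) *v a) + b \<bullet> (wt (y + h) *v b) \<le> (J (y + h))\<^sup>2 * resolvent_sq (cl (y + h)) \<theta> a b"
          by (rule J_bound[OF zK])
        show "d \<le> resolvent_sq (cl (y + h)) \<theta> a b" using d(2)[OF z, of a b \<theta>] ab by simp
        show "0 \<le> e" unfolding e_def by (intro add_nonneg_nonneg R_psd)
      qed (use s0 s_low s_up d D0d h N D e'2 \<alpha>b \<beta>b nn in \<open>auto simp: e'_def\<close>)
      then show ?thesis by (simp add: \<phi>_def C_def)
    qed
    have "linear \<phi>"
      by (rule linearI) (simp_all add: \<phi>_def \<alpha>_def \<beta>_def matrix_vector_mult_add_rdistrib
          matrix_vector_right_distrib inner_simps scaleR_matrix_vector_assoc[symmetric]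
          matrix_vector_mult_scaleR algebra_simps add_divide_distrib diff_divide_distrib)
    moreover have "\<bar>\<phi> h\<bar> \<le> L * norm h" for h
    proof -
      have "\<bar>\<alpha> h - s\<^sup>2 * \<beta> h\<bar> \<le> l1 * norm h"
      proof -
        have "s\<^sup>2 \<le> s1\<^sup>2" using s_up s_nn by (intro power_mono)
        then have "\<bar>s\<^sup>2 * \<beta> h\<bar> \<le> s1\<^sup>2 * (b1 * norm h)" unfolding abs_mult using \<beta>b by (intro mult_mono) auto
        then show ?thesis using \<alpha>b[of h] by (simp add: l1_def distrib_right)
      qed
      then have "\<bar>\<alpha> h - s\<^sup>2 * \<beta> h\<bar> / (2 * s * D0) \<le> (l1 * norm h) / (2 * s0 * d)"
        using s_low s0 D0d d l1 by (intro frac_le mult_mono) auto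
      then show ?thesis using s_low s0 D0d d by (simp add: \<phi>_def L_def abs_divide)
    qed
    ultimately obtain g where g: "norm g \<le> L" "\<And>h. g \<bullet> h = \<phi> h" using linear_functional_gradient by metis
    have "J z \<ge> J y + g \<bullet> (z - y) - C * (norm (z - y))\<^sup>2" if z: "z \<in> cball K0 r" for z
    proof -
      have "dist z y \<le> dist K0 z + dist K0 y" by (metis dist_commute dist_triangle3)
      then have "norm (z - y) \<le> 1" using z y r by (simp add: dist_norm)
      then show ?thesis using main[of "z - y"] z by (simp add: g s_def)
    qed
    then show ?thesis using g by blast
  qed
  show "\<exists>r>0. \<exists>C\<ge>0. \<exists>L\<ge>0. cball K0 r \<subseteq> \<K> \<and>
     (\<forall>y\<in>cball K0 r. \<exists>g. norm g \<le> L \<and> (\<forall>z\<in>cball K0 r. J y + g \<bullet> (z - y) - C * (norm (z - y))\<^sup>2 \<le> J z))"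
    using r C L supp by blast
qed

end

subsection \<open>Hidden convexity\<close>

lemma pos_def_inverse:
  fixes P :: "real^'n^'n"
  assumes sym: "transpose P = P" and pos: "\<And>x. x \<noteq> 0 \<Longrightarrow> 0 < x \<bullet> (P *v x)"
  shows "P ** matrix_inv P = mat 1" "matrix_inv P ** P = mat 1"
    and "transpose (matrix_inv P) = matrix_inv P"
    and "x \<noteq> 0 \<Longrightarrow> 0 < x \<bullet> (matrix_inv P *v x)"
proof -
  have "inj ((*v) P)"
    unfolding linear_injective_0[OF matrix_vector_mul_linear] using pos by (metis inner_zero_right less_irrefl)
  then have "invertible P" by (meson invertible_left_inverse matrix_left_invertible_injective)
  note inv = invertible_matrix_inv[OF this]
  show "P ** matrix_inv P = mat 1" "matrix_inv P ** P = mat 1" by (fact inv)+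
  have PX: "P *v (matrix_inv P *v v) = v" for v by (simp add: matrix_vector_mul_assoc inv)
  show "transpose (matrix_inv P) = matrix_inv P"
    unfolding transpose_eq_self_iff using sym[unfolded transpose_eq_self_iff] PX by metis
  assume "x \<noteq> 0"
  then have "matrix_inv P *v x \<noteq> 0" using PX[of x] by auto
  then show "0 < x \<bullet> (matrix_inv P *v x)" using pos PX[of x] by (metis inner_commute)
qed

lemma psd_form_convex:
  fixes S :: "real^'n^'n"
  assumes psd: "\<And>x. 0 \<le> x \<bullet> (S *v x)" and l: "0 \<le> l" "l \<le> 1"
  shows "((1 - l) *\<^sub>R a + l *\<^sub>R b) \<bullet> (S *v ((1 - l) *\<^sub>R a + l *\<^sub>R b))
     \<le> (1 - l) * (a \<bullet> (S *v a)) + l * (b \<bullet> (S *v b))"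
proof -
  have "(1 - l) * (a \<bullet> (S *v a)) + l * (b \<bullet> (S *v b))
     - ((1 - l) *\<^sub>R a + l *\<^sub>R b) \<bullet> (S *v ((1 - l) *\<^sub>R a + l *\<^sub>R b))
     = l * (1 - l) * ((a - b) \<bullet> (S *v (a - b)))"
    by (simp add: matrix_vector_mult_scaleR matrix_vector_right_distrib matrix_vector_mult_diff_distrib
        inner_simps algebra_simps)
  moreover have "0 \<le> l * (1 - l) * ((a - b) \<bullet> (S *v (a - b)))" using psd l by simp
  ultimately show ?thesis by linarith
qed

text \<open>Nonnegativity of the form at \<open>v - X *v \<eta>\<close>. For fixed
  \<open>\<eta>\<close> the left side is affine in \<open>(v, X)\<close>, and with \<open>X\<close>
  the inverse of \<open>P\<close> it is exact at \<open>\<eta> = P *v v\<close>: this is where joint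
  convexity comes from.\<close>

lemma psd_fenchel:
  fixes P X :: "real^'n^'n"
  assumes sym: "transpose P = P" and psd: "\<And>x. 0 \<le> x \<bullet> (P *v x)" and PX: "P *v (X *v \<eta>) = \<eta>"
  shows "2 * (\<eta> \<bullet> v) - \<eta> \<bullet> (X *v \<eta>) \<le> v \<bullet> (P *v v)"
proof -
  have sw: "(X *v \<eta>) \<bullet> (P *v v) = \<eta> \<bullet> v"
    using sym[unfolded transpose_eq_self_iff] PX by metis
  have "0 \<le> (v - X *v \<eta>) \<bullet> (P *v (v - X *v \<eta>))" by (rule psd)
  also have "\<dots> = v \<bullet> (P *v v) - v \<bullet> \<eta> - \<eta> \<bullet> v + (X *v \<eta>) \<bullet> \<eta>"
    by (simp only: matrix_vector_mult_diff_distrib[of P] PX inner_diff_left inner_diff_right sw)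
  finally show ?thesis by (simp add: inner_commute)
qed

context hinf_problem
begin

lemma dissipative_pos_def:
  assumes "diss K P g" "x \<noteq> 0"
  shows "0 < x \<bullet> (P *v x)"
  using dissipativeD(5)[OF assms(1), of x] R_psd[of "K *v x"] Q assms(2)
  unfolding sym_pos_def_def by (smt (verit))

text \<open>In the variables \<open>X = P\<^sup>-\<^sup>1\<close>, \<open>Y = K X\<close> the dissipation inequality is jointly convex in
  \<open>(X, Y, g)\<close>, because \<open>v\<^sup>T X\<^sup>-\<^sup>1 v\<close> is jointly convex in \<open>(v, X)\<close>.\<close>

lemma dissipative_convexity:
  assumes d1: "diss K1 P1 g1" and d2: "diss K2 P2 g2" and l: "0 \<le> l" "l \<le> 1"
  obtains K P where "diss K P ((1 - l) * g1 + l * g2)"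
    "K - K1 = l *\<^sub>R ((K2 - K1) ** matrix_inv P2 ** P)"
proof -
  define X1 X2 where "X1 = matrix_inv P1" and "X2 = matrix_inv P2"
  note inv1 = pos_def_inverse[OF dissipativeD(1)[OF d1] dissipative_pos_def[OF d1], folded X1_def]
  note inv2 = pos_def_inverse[OF dissipativeD(1)[OF d2] dissipative_pos_def[OF d2], folded X2_def]
  have PX1: "P1 *v (X1 *v v) = v" and PX2: "P2 *v (X2 *v v) = v" for v
    by (simp_all add: matrix_vector_mul_assoc inv1 inv2)
  define X where "X = (1 - l) *\<^sub>R X1 + l *\<^sub>R X2"
  have Xv: "X *v v = (1 - l) *\<^sub>R (X1 *v v) + l *\<^sub>R (X2 *v v)" for v
    by (simp add: X_def matrix_vector_mult_add_rdistrib scaleR_matrix_vector_assoc)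
  have Xsym: "transpose X = X"
    using inv1(3) inv2(3) unfolding transpose_eq_self_iff Xv by (simp add: inner_simps)
  have Xpos: "0 < x \<bullet> (X *v x)" if "x \<noteq> 0" for x
  proof -
    have "0 < x \<bullet> (X1 *v x)" "0 < x \<bullet> (X2 *v x)" using inv1(4) inv2(4) that by auto
    moreover have "0 < (1 - l) \<or> 0 < l" by linarith
    ultimately show ?thesis unfolding Xv inner_add_right inner_scaleR_right using l
      by (metis add_nonneg_pos add_pos_nonneg diff_ge_0_iff_ge less_imp_le mult_nonneg_nonneg mult_pos_pos)
  qed
  define P where "P = matrix_inv X"
  note inv = pos_def_inverse[OF Xsym Xpos, folded P_def]
  have XP: "X *v (P *v v) = v" for v by (simp add: matrix_vector_mul_assoc inv)
  \<comment> \<open>The product \<open>Y\<close> is interpolated and the gain recovered from it;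
    \<open>K\<close> is in general no convex combination of \<open>K1\<close> and
    \<open>K2\<close>.\<close>
  define Y where "Y = (1 - l) *\<^sub>R (K1 ** X1) + l *\<^sub>R (K2 ** X2)"
  define K where "K = Y ** P"
  have Kv: "K *v x = (1 - l) *\<^sub>R (K1 *v (X1 *v (P *v x))) + l *\<^sub>R (K2 *v (X2 *v (P *v x)))" for x
    by (simp add: K_def Y_def matrix_vector_mult_add_rdistrib scaleR_matrix_vector_assoc[symmetric]
        matrix_vector_mul_assoc[symmetric])
  have xv: "x = (1 - l) *\<^sub>R (X1 *v (P *v x)) + l *\<^sub>R (X2 *v (P *v x))" for x
    using XP[of x] unfolding Xv by simp
  have "diss K P ((1 - l) * g1 + l * g2)"
    unfolding dissipative_def
  proof (intro conjI allI)
    show "transpose P = P" by (rule inv)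
    show "0 \<le> x \<bullet> (P *v x)" for x using inv(4)[of x] by (cases "x = 0") auto
    fix x y
    \<comment> \<open>\<open>x\<close> splits into pieces with
      \<open>P1 *v u1 = P2 *v u2 = \<xi>\<close>, so their storages are
      \<open>u1 \<bullet> \<xi>\<close> and \<open>u2 \<bullet> \<xi>\<close> and combine linearly
      to that of \<open>x\<close>.\<close>
    define \<xi> u1 u2 where "\<xi> = P *v x" and "u1 = X1 *v \<xi>" and "u2 = X2 *v \<xi>"
    \<comment> \<open>Both pieces are driven by the same disturbance, so the penalties combine
      linearly in the gain.\<close>
    define w where "w = y - (A *v x - B *v (K *v x))"
    define y1 y2 where "y1 = w + (A *v u1 - B *v (K1 *v u1))" and "y2 = w + (A *v u2 - B *v (K2 *v u2))"
    have x: "x = (1 - l) *\<^sub>R u1 + l *\<^sub>R u2" and Kx: "K *v x = (1 - l) *\<^sub>R (K1 *v u1) + l *\<^sub>R (K2 *v u2)"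
      using xv[of x] Kv[of x] by (simp_all add: u1_def u2_def \<xi>_def)
    have "A *v x - B *v (K *v x) = (1 - l) *\<^sub>R (A *v u1 - B *v (K1 *v u1)) + l *\<^sub>R (A *v u2 - B *v (K2 *v u2))"
      unfolding Kx by (subst x) (simp add: matrix_vector_right_distrib matrix_vector_mult_scaleR scaleR_diff_right)
    then have "y = w + ((1 - l) *\<^sub>R (A *v u1 - B *v (K1 *v u1)) + l *\<^sub>R (A *v u2 - B *v (K2 *v u2)))"
      by (simp add: w_def)
    then have y: "y = (1 - l) *\<^sub>R y1 + l *\<^sub>R y2"
      by (simp add: y1_def y2_def algebra_simps)
    have 1: "y1 \<bullet> (P1 *v y1) + u1 \<bullet> (Q *v u1) + (K1 *v u1) \<bullet> (R *v (K1 *v u1)) \<le> u1 \<bullet> \<xi> + g1 * (norm w)\<^sup>2"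
      using dissipativeD(3)[OF d1, of y1 u1] by (simp add: y1_def u1_def PX1)
    have 2: "y2 \<bullet> (P2 *v y2) + u2 \<bullet> (Q *v u2) + (K2 *v u2) \<bullet> (R *v (K2 *v u2)) \<le> u2 \<bullet> \<xi> + g2 * (norm w)\<^sup>2"
      using dissipativeD(3)[OF d2, of y2 u2] by (simp add: y2_def u2_def PX2)
    have "(1 - l) * (y1 \<bullet> (P1 *v y1) + u1 \<bullet> (Q *v u1) + (K1 *v u1) \<bullet> (R *v (K1 *v u1)))
        + l * (y2 \<bullet> (P2 *v y2) + u2 \<bullet> (Q *v u2) + (K2 *v u2) \<bullet> (R *v (K2 *v u2)))
      \<le> (1 - l) * (u1 \<bullet> \<xi> + g1 * (norm w)\<^sup>2) + l * (u2 \<bullet> \<xi> + g2 * (norm w)\<^sup>2)"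
      using l by (intro add_mono[OF mult_left_mono[OF 1] mult_left_mono[OF 2]]) auto
    also have "\<dots> = ((1 - l) *\<^sub>R u1 + l *\<^sub>R u2) \<bullet> \<xi> + ((1 - l) * g1 + l * g2) * (norm w)\<^sup>2"
      by (simp add: inner_add_left algebra_simps)
    also have "\<dots> = x \<bullet> (P *v x) + ((1 - l) * g1 + l * g2) * (norm w)\<^sup>2"
      unfolding x[symmetric] \<xi>_def ..
    finally have sum: "(1 - l) * (y1 \<bullet> (P1 *v y1)) + l * (y2 \<bullet> (P2 *v y2))
        + ((1 - l) * (u1 \<bullet> (Q *v u1)) + l * (u2 \<bullet> (Q *v u2)))
        + ((1 - l) * ((K1 *v u1) \<bullet> (R *v (K1 *v u1))) + l * ((K2 *v u2) \<bullet> (R *v (K2 *v u2))))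
      \<le> x \<bullet> (P *v x) + ((1 - l) * g1 + l * g2) * (norm w)\<^sup>2" by (simp add: distrib_left)
    have Qc: "x \<bullet> (Q *v x) \<le> (1 - l) * (u1 \<bullet> (Q *v u1)) + l * (u2 \<bullet> (Q *v u2))"
      using psd_form_convex[OF Q_psd l, of u1 u2] unfolding x[symmetric] .
    have Rc: "(K *v x) \<bullet> (R *v (K *v x)) \<le> (1 - l) * ((K1 *v u1) \<bullet> (R *v (K1 *v u1))) + l * ((K2 *v u2) \<bullet> (R *v (K2 *v u2)))"
      using psd_form_convex[OF R_psd l, of "K1 *v u1" "K2 *v u2"] unfolding Kx[symmetric] .
    have Pc: "y \<bullet> (P *v y) \<le> (1 - l) * (y1 \<bullet> (P1 *v y1)) + l * (y2 \<bullet> (P2 *v y2))"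
    proof -
      \<comment> \<open>\<open>psd_fenchel\<close> is exact for \<open>P\<close> at this
        \<open>\<eta>\<close>; the same \<open>\<eta>\<close> gives lower bounds for
        \<open>P1\<close> and \<open>P2\<close>.\<close>
      define \<eta> where "\<eta> = P *v y"
      have "y \<bullet> (P *v y) = 2 * (\<eta> \<bullet> y) - \<eta> \<bullet> (X *v \<eta>)" by (simp add: \<eta>_def XP inner_commute)
      also have "\<dots> = (1 - l) * (2 * (\<eta> \<bullet> y1) - \<eta> \<bullet> (X1 *v \<eta>)) + l * (2 * (\<eta> \<bullet> y2) - \<eta> \<bullet> (X2 *v \<eta>))"
        unfolding y Xv by (simp add: inner_add_right algebra_simps)
      also have "\<dots> \<le> (1 - l) * (y1 \<bullet> (P1 *v y1)) + l * (y2 \<bullet> (P2 *v y2))"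
        using l by (intro add_mono mult_left_mono psd_fenchel dissipativeD(1,2)[OF d1] dissipativeD(1,2)[OF d2] PX1 PX2) auto
      finally show ?thesis .
    qed
    show "y \<bullet> (P *v y) + x \<bullet> (Q *v x) + (K *v x) \<bullet> (R *v (K *v x))
        \<le> x \<bullet> (P *v x) + ((1 - l) * g1 + l * g2) * (norm (y - (A *v x - B *v (K *v x))))\<^sup>2"
      using sum Qc Rc Pc unfolding w_def by linarith
  qed
  \<comment> \<open>Multiplied by \<open>X\<close> from the right this is
    \<open>Y - K1 ** X\<close>, in which the terms with \<open>X1\<close> cancel. The factor
    \<open>l\<close> controls the speed of the curve.\<close>
  moreover have "K - K1 = l *\<^sub>R ((K2 - K1) ** X2 ** P)"
    unfolding matrix_eq
  proof
    fix x
    define u1 u2 where "u1 = X1 *v (P *v x)" and "u2 = X2 *v (P *v x)"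
    have x: "x = (1 - l) *\<^sub>R u1 + l *\<^sub>R u2" using xv by (simp add: u1_def u2_def)
    have "K1 *v x = (1 - l) *\<^sub>R (K1 *v u1) + l *\<^sub>R (K1 *v u2)"
      by (subst x) (simp add: matrix_vector_right_distrib matrix_vector_mult_scaleR)
    moreover have "K *v x = (1 - l) *\<^sub>R (K1 *v u1) + l *\<^sub>R (K2 *v u2)" using Kv by (simp add: u1_def u2_def)
    moreover have "(l *\<^sub>R ((K2 - K1) ** X2 ** P)) *v x = l *\<^sub>R (K2 *v u2 - K1 *v u2)"
      by (simp only: scaleR_matrix_vector_assoc[symmetric] matrix_vector_mul_assoc[symmetric]
          matrix_vector_mult_diff_rdistrib u2_def)
    ultimately show "(K - K1) *v x = (l *\<^sub>R ((K2 - K1) ** X2 ** P)) *v x"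
      by (simp add: matrix_vector_mult_diff_rdistrib scaleR_diff_right)
  qed
  ultimately show ?thesis using that unfolding X2_def by blast
qed

lemma stationary_imp_global_min:
  assumes K1: "K1 \<in> \<K>" and K2: "K2 \<in> \<K>" and r: "r > 0" and C: "C \<ge> 0"
    and stat: "\<And>K. K \<in> ball K1 r \<Longrightarrow> J K \<ge> J K1 - C * (norm (K - K1))\<^sup>2"
  shows "J K1 \<le> J K2"
proof (rule ccontr)
  assume "\<not> ?thesis"
  then have lt: "J K2 < J K1" by simp
  obtain P1 where d1: "diss K1 P1 ((J K1)\<^sup>2)" using stab_imp_dissipative[OF K1] by blast
  obtain P2 where d2: "diss K2 P2 ((J K2)\<^sup>2)" using stab_imp_dissipative[OF K2] by blast
  define g1 g2 where "g1 = (J K1)\<^sup>2" and "g2 = (J K2)\<^sup>2"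
  have g: "g2 < g1" using lt J_nonneg[OF K2] by (simp add: g1_def g2_def power_strict_mono)
  have g1: "g1 > 0" using g by (simp add: g2_def) (smt (verit) zero_le_power2)
  have J1: "J K1 > 0" using lt J_nonneg[OF K2] by linarith
  obtain c where c: "c > 0" "\<And>(M::real^'nx^'nu) (N::real^'nx^'nx). norm (M ** N) \<le> norm M * norm N * c"
    using bounded_bilinear.pos_bounded[OF bounded_bilinear_matrix_mult] by blast
  define b where "b = real CARD('nx) * (real CARD('nx) * g1)"
  have b: "b > 0" using g1 by (simp add: b_def)
  \<comment> \<open>Bounds the speed of the curve: for every \<open>l\<close> the storage has gain
    at most \<open>g1\<close>, hence norm at most \<open>b\<close>. The summand 1 makes
    \<open>m\<close> positive.\<close>
  define m where "m = norm ((K2 - K1) ** matrix_inv P2) * b * c + 1"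
  have m: "m > 0" using b c unfolding m_def by (intro add_nonneg_pos) auto
  have curve: "\<exists>K. K \<in> \<K> \<and> norm (K - K1) \<le> l * m \<and> (J K)\<^sup>2 \<le> g1 - l * (g1 - g2)" if l: "0 \<le> l" "l \<le> 1" for l
  proof -
    obtain K P where KP: "diss K P ((1 - l) * g1 + l * g2)" "K - K1 = l *\<^sub>R ((K2 - K1) ** matrix_inv P2 ** P)"
      using dissipative_convexity[OF d1 d2 l] unfolding g1_def g2_def by blast
    have K: "K \<in> \<K>" "J K \<le> sqrt ((1 - l) * g1 + l * g2)" using dissipative_imp_stab[OF KP(1)] by auto
    have gpos: "(1 - l) * g1 + l * g2 > 0" by (rule dissipative_gain_pos[OF KP(1)])
    have "l * g2 \<le> l * g1" using g l by (intro mult_left_mono) auto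
    then have gle: "(1 - l) * g1 + l * g2 \<le> g1" by (simp add: algebra_simps)
    have "(J K)\<^sup>2 \<le> (sqrt ((1 - l) * g1 + l * g2))\<^sup>2" using K J_nonneg[OF K(1)] by (intro power_mono)
    then have "(J K)\<^sup>2 \<le> g1 - l * (g1 - g2)" using gpos by (simp add: algebra_simps)
    moreover have "norm P \<le> b"
    proof -
      have "norm (P *v x) \<le> g1 * norm x" for x
      proof (rule psd_norm_le[OF dissipativeD(1)[OF KP(1)] dissipativeD(2)[OF KP(1)] _ g1])
        fix x :: "real^'nx"
        have "((1 - l) * g1 + l * g2) * (norm x)\<^sup>2 \<le> g1 * (norm x)\<^sup>2" using gle by (rule mult_right_mono) simp
        then show "x \<bullet> (P *v x) \<le> g1 * (norm x)\<^sup>2" using dissipativeD(4)[OF KP(1), of x] by linarith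
      qed
      from norm_matrix_le[OF this] show ?thesis by (simp add: b_def)
    qed
    then have "norm ((K2 - K1) ** matrix_inv P2 ** P) \<le> norm ((K2 - K1) ** matrix_inv P2) * b * c"
      using c(2)[of "(K2 - K1) ** matrix_inv P2" P] c(1)
      by (smt (verit, ccfv_threshold) mult_left_mono mult_right_mono norm_ge_zero)
    then have "norm (K - K1) \<le> l * m"
      unfolding KP(2) m_def using l by (simp add: mult_left_mono)
    ultimately show ?thesis using K by blast
  qed
  define E where "E = 2 * J K1 * (C * m\<^sup>2)"
  have E: "E \<ge> 0" using J1 C by (simp add: E_def)
  \<comment> \<open>\<open>J\<close>^2 falls by at least \<open>l * (g1 - g2)\<close>, while
    stationarity permits at most \<open>E * l^2\<close>. The last entry makes these incompatible;
    the others keep the curve defined and inside the ball.\<close>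
  define l where "l = min (min 1 (r / (2 * m))) ((g1 - g2) / (2 * (E + 1)))"
  have l: "0 < l" using r m g E by (simp add: l_def)
  have "l \<le> 1" "l \<le> r / (2 * m)" "l \<le> (g1 - g2) / (2 * (E + 1))" by (auto simp: l_def)
  then have l2: "l \<le> 1" "l * m < r" "l * (E + 1) < g1 - g2" using r m g E by (auto simp: field_simps)
  obtain K where K: "K \<in> \<K>" "norm (K - K1) \<le> l * m" "(J K)\<^sup>2 \<le> g1 - l * (g1 - g2)"
    using curve[of l] l l2 by auto
  have "K \<in> ball K1 r" using K(2) l2 by (simp add: dist_norm norm_minus_commute)
  then have "J K1 \<le> J K + C * (norm (K - K1))\<^sup>2" using stat by fastforce
  also have "\<dots> \<le> J K + C * (l * m)\<^sup>2" using K(2) C by (intro add_left_mono mult_left_mono power_mono) auto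
  finally have "J K1 - J K \<le> C * (l * m)\<^sup>2" by simp
  moreover have "(J K1)\<^sup>2 - (J K)\<^sup>2 \<le> 2 * J K1 * (J K1 - J K)"
    using zero_le_power2[of "J K1 - J K"] by (simp add: power2_eq_square algebra_simps)
  moreover have "2 * J K1 * (J K1 - J K) \<le> 2 * J K1 * (C * (l * m)\<^sup>2)"
    using \<open>J K1 - J K \<le> C * (l * m)\<^sup>2\<close> J1 by (intro mult_left_mono) auto
  ultimately have "g1 - (J K)\<^sup>2 \<le> E * l\<^sup>2" unfolding g1_def E_def by (simp add: power_mult_distrib mult_ac)
  then have "l * (g1 - g2) \<le> l * (E * l)" using K(3) by (simp add: power2_eq_square mult_ac)
  then have "g1 - g2 \<le> E * l" using l by simp
  then show False using l2 l by (simp add: algebra_simps)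
qed

end

section \<open>Convergence of the method for the frequency-domain cost\<close>

theorem theorem2:
  fixes A :: "real^'nx^'nx" and B :: "real^'nu^'nx"
    and Q :: "real^'nx^'nx" and R :: "real^'nu^'nu"
    and Ks :: "nat \<Rightarrow> real^'nx^'nu" and F :: "nat \<Rightarrow> real^'nx^'nu"
    and c :: real and \<delta> :: "nat \<Rightarrow> real"
  defines "\<K> \<equiv> stab_set A B"
  defines "J \<equiv> Jcost A B Q R"
  defines "Jstar \<equiv> (INF K\<in>\<K>. J K)"
  defines "\<Delta>0 \<equiv> setdist {K\<in>\<K>. J K \<le> J (Ks 0)} (- \<K>)"
  assumes "sym_pos_def Q" and "sym_pos_def R" and "stabilizable A B"
    and "Ks 0 \<in> \<K>"
    and "\<Delta>0 > 0"
    and "0 < c" and "c < 1"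
    and "\<And>n. \<delta> n = c * \<Delta>0 / (real n + 1)"
    and "\<And>n. min_norm_elem (goldstein_subdiff J \<K> (\<delta> n) (Ks n)) (F n)"
    and "\<And>n. Ks (Suc n) = Ks n - (\<delta> n / norm (F n)) *\<^sub>R F n"
  shows "(\<forall>n. Ks n \<in> \<K>) \<and> (\<lambda>n. J (Ks n)) \<longlonglongrightarrow> Jstar"
proof -
  interpret hinf_problem A B Q R by unfold_locales fact+
  have cD: "c * \<Delta>0 > 0" using assms by simp
  have \<delta>_pos: "\<delta> n > 0" for n using cD by (simp add: assms)
  have \<delta>_eq: "\<delta> = (\<lambda>n. c * \<Delta>0 * (1 / (real n + 1)))" using assms(12) by (simp add: fun_eq_iff)
  have "(\<lambda>n. c * \<Delta>0 * (1 / (real n + 1))) \<longlonglongrightarrow> c * \<Delta>0 * 0"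
    using LIMSEQ_Suc[OF lim_1_over_n] by (intro tendsto_mult tendsto_const) (simp add: add.commute)
  then have \<delta>_lim: "\<delta> \<longlonglongrightarrow> 0" by (simp add: \<delta>_eq)
  have \<delta>_sum: "\<not> summable \<delta>"
  proof
    assume "summable \<delta>"
    then have "summable (\<lambda>n. \<delta> n * (1 / (c * \<Delta>0)))" by (rule summable_mult2)
    moreover have "\<delta> n * (1 / (c * \<Delta>0)) = inverse (real (Suc n))" for n
    proof -
      have "a * b * (1 / a) = b" if "a > 0" for a b :: real using that by simp
      from this[OF cD, of "1 / (real n + 1)"] show ?thesis by (simp only: \<delta>_eq) (simp add: inverse_eq_divide add.commute)
    qed
    ultimately have "summable (\<lambda>n. inverse (real (Suc n)))" by (simp only:)
    then have "summable (\<lambda>n. inverse (real n))" by (subst (asm) summable_Suc_iff)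
    then show False using not_summable_harmonic by blast
  qed
  \<comment> \<open>A point outside the stability region is at distance at least
    \<open>\<Delta>0\<close> from the initial sublevel set, whereas
    \<open>\<delta> n \<le> c * \<Delta>0 < \<Delta>0\<close>.\<close>
  have sub: "cball K (\<delta> n) \<subseteq> \<K>" if "K \<in> \<K>" "J K \<le> J (Ks 0)" for K n
  proof
    fix K' assume K': "K' \<in> cball K (\<delta> n)"
    show "K' \<in> \<K>"
    proof (rule ccontr)
      assume "K' \<notin> \<K>"
      then have "\<Delta>0 \<le> dist K K'" unfolding \<Delta>0_def using that by (intro setdist_le_dist) auto
      also have "\<dots> \<le> c * \<Delta>0 / (real n + 1)" using K' by (simp add: assms(12))
      also have "\<dots> \<le> c * \<Delta>0 / 1" using cD by (intro divide_left_mono) auto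
      also have "\<dots> < \<Delta>0" using assms by simp
      finally show False by simp
    qed
  qed
  obtain K r C where Kn: "\<And>n. Ks n \<in> \<K>" and K: "K \<in> \<K>" and lim: "(\<lambda>n. J (Ks n)) \<longlonglongrightarrow> J K"
    and rC: "r > 0" "C \<ge> 0" "\<And>z. z \<in> ball K r \<Longrightarrow> J z \<ge> J K - C * (norm (z - K))\<^sup>2"
    using goldstein_method_limit[of J \<K> 0 Ks \<delta> F, OF _ _ assms(8) _ \<delta>_pos \<delta>_lim \<delta>_sum sub assms(13,14)]
      locally_weakly_convex_J J_nonneg sublevel_compact[of "J (Ks 0)"]
    unfolding \<K>_def J_def by blast
  have "J K \<le> J K'" if "K' \<in> \<K>" for K'
    using stationary_imp_global_min[of K K' r C] K that rC unfolding \<K>_def J_def by blast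
  \<comment> \<open>The infimum is attained at the accumulation point \<open>K\<close>, so
    \<open>Jstar\<close> is indeed a minimum.\<close>
  then have "Jstar = J K" unfolding Jstar_def using K by (intro cInf_eq_minimum) auto
  then show ?thesis using Kn lim by simp
qed

end
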